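(* Let $n\ge 1$. All irreducible, admissible $\mathcal{H}(n)^{O(n)}$-modules are highest-weight modules.
   Context: Everything is over $\mathbb{C}$. $\mathcal{H}(n)$ is the rank $n$ Heisenberg vertex algebra, generated by fields $\alpha^1,\dots,\alpha^n$ with OPE $\alpha^i(z)\alpha^j(w)\sim\delta_{i,j}(z-w)^{-2}$, graded by conformal weight via the Virasoro element $L=\frac12\sum_{i=1}^n:\alpha^i\alpha^i:$, so that each $\alpha^i$ has weight $1$. The complex orthogonal group $O(n)$ acts on $\mathcal{H}(n)$ by vertex algebra automorphisms, through its standard linear action on the span of the orthonormal vectors $\alpha^1,\dots,\alpha^n$; $\mathcal{H}(n)^{O(n)}$ is the subalgebra of invariants. For a weight-graded vertex algebra $\mathcal{W}=\bigoplus_m\mathcal{W}_m$, a $\mathbb{Z}_{\ge 0}$-graded $\mathcal{W}$-module $M=\bigoplus_{k\ge 0}M_k$ is admissible if $a(r)M_k\subset M_{m+k-r-1}$ for all $a\in\mathcal{W}_m$, $r\in\mathbb{Z}$, $k\ge 0$ (for irreducible nonzero $M$ the grading is normalized so that $M_0\ne 0$). An irreducible admissible module $M$ is called a highest-weight module if $M_0$ is one-dimensional, so that $M$ is cyclic and generated by any nonzero $v\in M_0$ (a highest-weight vector). *)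

theory Defs
  imports "HOL-Analysis.Analysis" "HOL-Library.Groups_Big_Fun"
begin

text \<open>
  Fields are given by their modes: \<^term>\<open>Y a r b\<close> is \<open>a\<^bsub>(r)\<^esub> b\<close>, where
  \<open>Y(a, z) = (\<Sum>r. a\<^bsub>(r)\<^esub> z\<^bsup>-r-1\<^esup>)\<close>.

  The Borcherds (Jacobi) identity for the action on \<open>v\<close> of the modes of \<open>a\<close> and \<open>b\<close> reads
  \<open>(\<Sum>j. binom(p,j) (a\<^bsub>(r+j)\<^esub> b)\<^bsub>(p+q-j)\<^esub> v)
    = (\<Sum>j. (-1)\<^bsup>j\<^esup> binom(r,j) (a\<^bsub>(p+r-j)\<^esub> b\<^bsub>(q+j)\<^esub> v - (-1)\<^bsup>r\<^esup> b\<^bsub>(q+r-j)\<^esub> a\<^bsub>(p+j)\<^esub> v))\<close>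
  with \<open>j\<close> ranging over the natural numbers. It is only imposed together with truncation and
  linearity of the modes, which make both sums finite, so that \<^const>\<open>Sum_any\<close> is the actual sum.
\<close>

definition borcherds_identity ::
  "(complex \<Rightarrow> 'm \<Rightarrow> 'm::ab_group_add) \<Rightarrow> ('v \<Rightarrow> int \<Rightarrow> 'v \<Rightarrow> 'v) \<Rightarrow> ('v \<Rightarrow> int \<Rightarrow> 'm \<Rightarrow> 'm)
    \<Rightarrow> 'v \<Rightarrow> 'v \<Rightarrow> 'm \<Rightarrow> bool"
where
  "borcherds_identity scaleM Y act a b v \<longleftrightarrow> (\<forall>p q r :: int.
     Sum_any (\<lambda>j::nat. scaleM ((of_int p :: complex) gchoose j)
        (act (Y a (r + int j) b) (p + q - int j) v))
   = Sum_any (\<lambda>j::nat. scaleM ((- 1) ^ j * ((of_int r :: complex) gchoose j))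
        (act a (p + r - int j) (act b (q + int j) v)
          - scaleM ((- 1) powi r) (act b (q + r - int j) (act a (p + int j) v)))))"

locale vertex_algebra = vector_space scale
  for scale :: "complex \<Rightarrow> 'v::ab_group_add \<Rightarrow> 'v" +
  fixes Y :: "'v \<Rightarrow> int \<Rightarrow> 'v \<Rightarrow> 'v"
    and vac :: 'v
  assumes Y_add_left: "Y (a + b) r c = Y a r c + Y b r c"
    and Y_scale_left: "Y (scale x a) r c = scale x (Y a r c)"
    and Y_add_right: "Y a r (b + c) = Y a r b + Y a r c"
    and Y_scale_right: "Y a r (scale x c) = scale x (Y a r c)"
    and truncation: "\<exists>N. \<forall>r\<ge>N. Y a r b = 0"
    and vacuum: "Y vac r b = (if r = - 1 then b else 0)"
    and creation: "Y a (- 1) vac = a" "r \<ge> 0 \<Longrightarrow> Y a r vac = 0"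
    and borcherds: "borcherds_identity scale Y Y a b c"
begin

definition vertex_subalgebra :: "'v set \<Rightarrow> bool" where
  "vertex_subalgebra W \<longleftrightarrow>
     subspace W \<and> vac \<in> W \<and> (\<forall>a\<in>W. \<forall>b\<in>W. \<forall>r. Y a r b \<in> W)"

definition automorphism :: "('v \<Rightarrow> 'v) \<Rightarrow> bool" where
  "automorphism g \<longleftrightarrow>
     bij g \<and> Vector_Spaces.linear scale scale g \<and> g vac = vac \<and> (\<forall>a r b. g (Y a r b) = Y (g a) r (g b))"

end

text \<open>
  The rank \<open>CARD('n)\<close> Heisenberg vertex algebra: a nonzero vertex algebra generated by fields with
  OPE \<open>\<alpha>\<^sup>i(z) \<alpha>\<^sup>j(w) \<sim> \<delta>\<^bsub>i,j\<^esub> (z - w)\<^bsup>-2\<^esup>\<close>, i.e. \<open>\<alpha>\<^sup>i\<^bsub>(r)\<^esub> \<alpha>\<^sup>j = \<delta>\<^bsub>i,j\<^esub> \<delta>\<^bsub>r,1\<^esub> vac\<close> for \<open>r \<ge> 0\<close>.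
  These data determine it up to a unique isomorphism preserving the generators, since the universal
  vertex algebra with this OPE is simple.
\<close>

locale heisenberg_vertex_algebra = vertex_algebra scale Y vac
  for scale :: "complex \<Rightarrow> 'v::ab_group_add \<Rightarrow> 'v"
    and Y :: "'v \<Rightarrow> int \<Rightarrow> 'v \<Rightarrow> 'v"
    and vac :: 'v +
  fixes \<alpha> :: "'n::finite \<Rightarrow> 'v"
  assumes nonzero: "vac \<noteq> 0"
    and ope: "r \<ge> 0 \<Longrightarrow> Y (\<alpha> i) r (\<alpha> j) = (if i = j \<and> r = 1 then vac else 0)"
    and generated: "vertex_subalgebra U \<Longrightarrow> range \<alpha> \<subseteq> U \<Longrightarrow> U = UNIV"
begin

definition virasoro :: 'v where
  "virasoro = scale (1 / 2) (\<Sum>i\<in>UNIV. Y (\<alpha> i) (- 1) (\<alpha> i))"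

text \<open>In this indexing of modes the Virasoro operator \<open>L\<^sub>0\<close> is \<^term>\<open>Y virasoro 1\<close>.\<close>

definition weight_space :: "int \<Rightarrow> 'v set" where
  "weight_space m = {a. Y virasoro 1 a = scale (of_int m) a}"

definition lifts :: "complex ^ 'n ^ 'n \<Rightarrow> ('v \<Rightarrow> 'v) \<Rightarrow> bool" where
  "lifts A g \<longleftrightarrow> automorphism g \<and> (\<forall>i. g (\<alpha> i) = (\<Sum>j\<in>UNIV. scale (A $ j $ i) (\<alpha> j)))"

text \<open>
  Every complex orthogonal \<open>A\<close> (\<open>A\<^sup>T A = 1\<close>, no conjugation) has exactly one lift, through which the
  complex orthogonal group acts; hence quantifying over all lifts is quantifying over the group.
\<close>

definition orthogonal_invariants :: "'v set" where
  "orthogonal_invariants = {a. \<forall>A g. orthogonal_matrix A \<and> lifts A g \<longrightarrow> g a = a}"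

definition invariant_weight_space :: "int \<Rightarrow> 'v set" where
  "invariant_weight_space m = orthogonal_invariants \<inter> weight_space m"

lemma lifts_unique:
  assumes "lifts A g" "lifts A h"
  shows "g = h"
proof -
  have lin: "Vector_Spaces.linear scale scale g" "Vector_Spaces.linear scale scale h"
    using assms by (auto simp: lifts_def automorphism_def)
  interpret g: Vector_Spaces.linear scale scale g by (rule lin)
  interpret h: Vector_Spaces.linear scale scale h by (rule lin)
  have "vertex_subalgebra {a. g a = h a}"
    using assms
    by (auto simp: vertex_subalgebra_def subspace_def lifts_def automorphism_def
        g.add h.add g.scale h.scale g.zero h.zero)
  moreover have "range \<alpha> \<subseteq> {a. g a = h a}"
    using assms by (auto simp: lifts_def)
  ultimately have "{a. g a = h a} = UNIV"
    by (rule generated)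
  thus ?thesis by auto
qed

lemma vertex_subalgebra_orthogonal_invariants: "vertex_subalgebra orthogonal_invariants"
proof -
  have eqs: "g (a + b) = g a + g b" "g (scale x a) = scale x (g a)" "g 0 = 0"
      "g vac = vac" "g (Y a r b) = Y (g a) r (g b)"
    if "lifts A g" for A g a b x r
  proof -
    have lin: "Vector_Spaces.linear scale scale g"
      using that by (auto simp: lifts_def automorphism_def)
    interpret g: Vector_Spaces.linear scale scale g by (rule lin)
    show "g (a + b) = g a + g b" "g (scale x a) = scale x (g a)" "g 0 = 0"
      by (simp_all add: g.add g.scale g.zero)
    show "g vac = vac" "g (Y a r b) = Y (g a) r (g b)"
      using that by (auto simp: lifts_def automorphism_def)
  qed
  show ?thesis
    unfolding vertex_subalgebra_def subspace_def orthogonal_invariants_def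
    by (auto simp: eqs) metis+
qed

end

text \<open>
  A module \<^typ>\<open>'m\<close> over the vertex algebra \<open>W\<close>, a subalgebra of an ambient vertex algebra on
  \<^typ>\<open>'v\<close>. Only the modes of elements of \<open>W\<close> are constrained and used.
\<close>

locale vertex_module = vertex_algebra scale Y vac + M: vector_space scaleM
  for scale :: "complex \<Rightarrow> 'v::ab_group_add \<Rightarrow> 'v"
    and Y :: "'v \<Rightarrow> int \<Rightarrow> 'v \<Rightarrow> 'v"
    and vac :: 'v
    and scaleM :: "complex \<Rightarrow> 'm::ab_group_add \<Rightarrow> 'm" +
  fixes W :: "'v set"
    and act :: "'v \<Rightarrow> int \<Rightarrow> 'm \<Rightarrow> 'm"
  assumes subalgebra: "vertex_subalgebra W"
    and act_add_left: "a \<in> W \<Longrightarrow> b \<in> W \<Longrightarrow> act (a + b) r u = act a r u + act b r u"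
    and act_scale_left: "a \<in> W \<Longrightarrow> act (scale x a) r u = scaleM x (act a r u)"
    and act_add_right: "a \<in> W \<Longrightarrow> act a r (u + v) = act a r u + act a r v"
    and act_scale_right: "a \<in> W \<Longrightarrow> act a r (scaleM x u) = scaleM x (act a r u)"
    and act_truncation: "a \<in> W \<Longrightarrow> \<exists>N. \<forall>r\<ge>N. act a r u = 0"
    and act_vacuum: "act vac r u = (if r = - 1 then u else 0)"
    and act_borcherds: "a \<in> W \<Longrightarrow> b \<in> W \<Longrightarrow> borcherds_identity scaleM Y act a b u"
begin

definition submodule :: "'m set \<Rightarrow> bool" where
  "submodule U \<longleftrightarrow> M.subspace U \<and> (\<forall>a\<in>W. \<forall>r. \<forall>u\<in>U. act a r u \<in> U)"

definition irreducible :: bool where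
  "irreducible \<longleftrightarrow> (UNIV :: 'm set) \<noteq> {0} \<and> (\<forall>U. submodule U \<longrightarrow> U = {0} \<or> U = UNIV)"

end

text \<open>The pieces of negative degree of a grading by the natural numbers are zero.\<close>

definition graded_piece :: "(nat \<Rightarrow> 'm::zero set) \<Rightarrow> int \<Rightarrow> 'm set" where
  "graded_piece G d = (if d < 0 then {0} else G (nat d))"

text \<open>Here \<open>Wgr m\<close> is the weight \<open>m\<close> part of \<open>W\<close> and \<open>G k\<close> is the degree \<open>k\<close> part of the module.\<close>

locale admissible_module = vertex_module scale Y vac scaleM W act
  for scale :: "complex \<Rightarrow> 'v::ab_group_add \<Rightarrow> 'v"
    and Y :: "'v \<Rightarrow> int \<Rightarrow> 'v \<Rightarrow> 'v"
    and vac :: 'v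
    and scaleM :: "complex \<Rightarrow> 'm::ab_group_add \<Rightarrow> 'm"
    and W :: "'v set"
    and act :: "'v \<Rightarrow> int \<Rightarrow> 'm \<Rightarrow> 'm" +
  fixes Wgr :: "int \<Rightarrow> 'v set"
    and G :: "nat \<Rightarrow> 'm set"
  assumes grading_subspace: "M.subspace (G k)"
    and grading_direct_sum:
      "\<exists>!c. finite {k. c k \<noteq> 0} \<and> (\<forall>k. c k \<in> G k) \<and> u = (\<Sum>k\<in>{k. c k \<noteq> 0}. c k)"
    and grading_shift:
      "a \<in> Wgr m \<Longrightarrow> u \<in> G k \<Longrightarrow> act a r u \<in> graded_piece G (m + int k - r - 1)"

locale irreducible_admissible_module = admissible_module +
  assumes irreducible: irreducible
    and grading_normalized: "G 0 \<noteq> {0}"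

locale highest_weight_module = irreducible_admissible_module +
  assumes top_one_dimensional: "M.dim (G 0) = 1"
begin

lemma cyclic:
  assumes "v \<in> G 0" "v \<noteq> 0" "submodule U" "v \<in> U"
  shows "U = UNIV"
  using assms irreducible unfolding irreducible_def by auto

end

end

(*
  The zero modes of the invariant algebra commute on the lowest piece M_0 of an irreducible module, and M_0
  is irreducible and of countable dimension under them, so Dixmier's form of Schur's lemma gives dim M_0 = 1.

  Commutation. The invariants are generated by the quadratics sum_i alpha^i(-k-1) alpha^i(-l-1) vac. By
  induction on weight and length, via Zhu's product o(a) o(b) = o(a * b) on M_0, every operator commuting
  with the zero modes of the quadratics commutes with all zero modes. The zero modes of the quadratics act
  diagonally on the Fock space, where they commute; the commutator of two of them is the zero mode of a
  combination of quadratics and vac that acts by zero on the Fock space, and such a combination lies in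
  the image of L_{-1} + L_0, hence acts by zero on every module.

  Generation (the first fundamental theorem for O(n)). Use the Hermitian form on the Fock space for which
  alpha^i(-k) is adjoint to alpha^i(k). By induction on weight, an invariant t orthogonal to the products of
  quadratics is killed by all Laplacians sum_i alpha^i(k) alpha^i(l). With the polarizations
  E_ab = sum_k alpha^a(-k) alpha^b(k) / k, invariance under rotations gives E_ab t = E_ba t, so harmonicity
  yields |E_aa t|^2 <= sum_b |E_ba t|^2 = <t, sum_b E_ab E_ab t> = <t, E_aa t>; invariance under reflections
  makes the eigenvalues of E_aa on t even, so |E_aa t|^2 >= 2 <t, E_aa t>. Hence all alpha^a(k) kill t.
*)

theory Submission
  imports Defs "HOL-Computational_Algebra.Fundamental_Theorem_Algebra"
begin

section \<open>Modes of vertex algebra modules\<close>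

text \<open>The obstacle is that an abstract module carries no Heisenberg modes: only invariants act
  on it, so it has no Fock basis and no visible diagonal action. What can be carried over are
  relations among zero modes that hold in every module. The zero mode of a combination of quadratics
  with coefficients c_kl is recorded by the polynomial f(t) = sum c_kl binom(t-1,k) binom(-t-1,l).
  On the Fock space its bracket with alpha^i(t) is governed by t (f(t) + f(-t)), so only the even
  part of f is seen there. On a module, the zero mode of L_{-1} a is minus the weight of a times the
  zero mode of a; this is the same recursion that the polynomials satisfy, so the zero mode is a
  linear function of f, and the symmetry of the quadratics in k and l makes it blind to the odd
  part. Vanishing on the Fock space thus forces vanishing on the module. Words in the operators are
  avoided throughout: single modes applied to one vector already span a submodule, and products of
  quadratics are indexed by lists of pairs of naturals. This is where countable dimension comes
  from.\<close>

context vertex_module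
begin

lemma Y_closed: "a \<in> W \<Longrightarrow> b \<in> W \<Longrightarrow> Y a r b \<in> W"
  using subalgebra by (auto simp: vertex_subalgebra_def)

lemma vac_in: "vac \<in> W"
  using subalgebra by (auto simp: vertex_subalgebra_def)

lemma subspace_W: "subspace W"
  using subalgebra by (auto simp: vertex_subalgebra_def)

lemma act_zero_left [simp]: "act 0 r u = 0"
  using act_scale_left[OF vac_in, of 0 r u] by simp

lemma act_zero_right [simp]: "a \<in> W \<Longrightarrow> act a r 0 = 0"
  using act_scale_right[of a r 0 0] by simp

lemma act_diff_right: "a \<in> W \<Longrightarrow> act a r (u - v) = act a r u - act a r v"
  using act_add_right[of a r "u - v" v] by simp

lemma act_sum_left: "(\<And>x. x \<in> A \<Longrightarrow> f x \<in> W) \<Longrightarrow> act (sum f A) r u = (\<Sum>x\<in>A. act (f x) r u)"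
  by (induction A rule: infinite_finite_induct)
    (auto simp: act_add_left subspace_sum[OF subspace_W])

lemma act_sum_right: "a \<in> W \<Longrightarrow> act a r (sum f A) = (\<Sum>x\<in>A. act a r (f x))"
  by (induction A rule: infinite_finite_induct) (auto simp: act_add_right)

text \<open>\<open>Sum_any\<close> becomes a sum over any finite set containing the support, so each
  application can choose convenient ranges without computing exact supports.\<close>

lemma borcherds_sums:
  assumes "a \<in> W" "b \<in> W" "finite A" "finite B"
    and A: "\<And>j. j \<notin> A \<Longrightarrow> scaleM ((of_int p :: complex) gchoose j)
        (act (Y a (r + int j) b) (p + q - int j) v) = 0"
    and B: "\<And>j. j \<notin> B \<Longrightarrow> scaleM ((- 1) ^ j * ((of_int r :: complex) gchoose j))
        (act a (p + r - int j) (act b (q + int j) v)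
          - scaleM ((- 1) powi r) (act b (q + r - int j) (act a (p + int j) v))) = 0"
  shows "(\<Sum>j\<in>A. scaleM ((of_int p :: complex) gchoose j)
        (act (Y a (r + int j) b) (p + q - int j) v))
   = (\<Sum>j\<in>B. scaleM ((- 1) ^ j * ((of_int r :: complex) gchoose j))
        (act a (p + r - int j) (act b (q + int j) v)
          - scaleM ((- 1) powi r) (act b (q + r - int j) (act a (p + int j) v))))"
proof -
  have "borcherds_identity scaleM Y act a b v"
    by (rule act_borcherds) fact+
  moreover have "Sum_any (\<lambda>j. scaleM ((of_int p :: complex) gchoose j)
        (act (Y a (r + int j) b) (p + q - int j) v)) = (\<Sum>j\<in>A. scaleM ((of_int p :: complex) gchoose j)
        (act (Y a (r + int j) b) (p + q - int j) v))"
    by (rule Sum_any.expand_superset) (use assms in auto)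
  moreover have "Sum_any (\<lambda>j. scaleM ((- 1) ^ j * ((of_int r :: complex) gchoose j))
        (act a (p + r - int j) (act b (q + int j) v)
          - scaleM ((- 1) powi r) (act b (q + r - int j) (act a (p + int j) v))))
      = (\<Sum>j\<in>B. scaleM ((- 1) ^ j * ((of_int r :: complex) gchoose j))
        (act a (p + r - int j) (act b (q + int j) v)
          - scaleM ((- 1) powi r) (act b (q + r - int j) (act a (p + int j) v))))"
    by (rule Sum_any.expand_superset) (use assms in blast)+
  ultimately show ?thesis
    by (simp add: borcherds_identity_def)
qed

lemma truncation_nat: "\<exists>N. \<forall>j\<ge>N. Y a (r + int j) b = 0"
proof -
  obtain M where M: "\<forall>r\<ge>M. Y a r b = 0" using truncation by blast
  show ?thesis by (rule exI[of _ "nat (M - r)"]) (use M in auto)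
qed

lemma act_truncation_nat:
  assumes "a \<in> W" shows "\<exists>N. \<forall>j\<ge>N. act a (r + int j) u = 0"
proof -
  obtain M where M: "\<forall>r\<ge>M. act a r u = 0" using act_truncation[OF assms] by blast
  show ?thesis by (rule exI[of _ "nat (M - r)"]) (use M in auto)
qed

text \<open>The Borcherds identity at r = 0, where binom(0, j) leaves only j = 0 on the
  right.\<close>

lemma commutator:
  assumes "a \<in> W" "b \<in> W" "\<And>j. j \<ge> N \<Longrightarrow> Y a (int j) b = 0"
  shows "act a p (act b q v) - act b q (act a p v)
    = (\<Sum>j<N. scaleM ((of_int p :: complex) gchoose j) (act (Y a (int j) b) (p + q - int j) v))"
  using borcherds_sums[of a b "{..<N}" "{0}" p 0 q v] assms
  by (simp add: gbinomial_0_left)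

text \<open>The Borcherds identity at p = 0, where only j = 0 survives on the left.\<close>

lemma associativity:
  assumes "a \<in> W" "b \<in> W" "\<And>j. j \<ge> N \<Longrightarrow> act b (q + int j) v = 0" "\<And>j. j \<ge> N \<Longrightarrow> act a (int j) v = 0"
  shows "act (Y a r b) q v
    = (\<Sum>j<N. scaleM ((- 1) ^ j * ((of_int r :: complex) gchoose j))
        (act a (r - int j) (act b (q + int j) v)
          - scaleM ((- 1) powi r) (act b (q + r - int j) (act a (int j) v))))"
  using borcherds_sums[of a b "{0}" "{..<N}" 0 r q v] assms
  by (simp add: gbinomial_0_left)

text \<open>Stated for all large bounds, so that several expansions can be brought to a common
  length.\<close>

lemma associativity_ex:
  assumes "a \<in> W" "b \<in> W"
  shows "\<exists>N0. \<forall>N\<ge>N0. act (Y a r b) q v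
    = (\<Sum>j<N. scaleM ((- 1) ^ j * ((of_int r :: complex) gchoose j))
        (act a (r - int j) (act b (q + int j) v)
          - scaleM ((- 1) powi r) (act b (q + r - int j) (act a (int j) v))))"
proof -
  obtain N1 N2 where "\<forall>j\<ge>N1. act b (q + int j) v = 0" "\<forall>j\<ge>N2. act a (0 + int j) v = 0"
    using act_truncation_nat assms by meson
  thus ?thesis
    by (intro exI[of _ "max N1 N2"] allI impI associativity assms) auto
qed

text \<open>The vector on the left is the divided power T^k a / k! of translation. In the Borcherds
  identity with second argument \<open>vac\<close> the only nonzero vacuum mode is -1, so at most
  one index contributes: j = -1-q if q < 0, none if 0 <= q < k, and j = q-k otherwise.\<close>

lemma act_derivative:
  assumes "a \<in> W"
  shows "act (Y a (- int k - 1) vac) q v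
    = scaleM ((- 1) ^ k * ((of_int q :: complex) gchoose k)) (act a (q - int k) v)"
proof -
  let ?R = "\<lambda>j. scaleM ((- 1) ^ j * ((of_int (- int k - 1) :: complex) gchoose j))
        (act a (- int k - 1 - int j) (act vac (q + int j) v)
          - scaleM ((- 1) powi (- int k - 1)) (act vac (q + (- int k - 1) - int j) (act a (int j) v)))"
  have R0: "?R j = 0" if "q + int j \<noteq> -1" "q - int k - int j \<noteq> 0" for j
    using that assms by (auto simp: act_vacuum)
  have sgn: "(-1 :: complex) powi (- int k - 1) = (-1) ^ (k + 1)"
    by (simp add: power_int_def nat_add_distrib flip: power_Suc)
  have bin: "((of_int (- int k - 1) :: complex) gchoose j) = (-1) ^ j * (of_nat (k + j) gchoose j)" for j
    using gbinomial_negated_upper[of "- of_nat k - 1 :: complex" j] by (simp add: algebra_simps)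
  have bin': "(-1) ^ j * (- of_nat k - 1 gchoose j) = (of_nat (k + j) gchoose j :: complex)" for j
    using bin[of j] by (simp flip: mult.assoc power_mult_distrib)
  have sum_eq: "act (Y a (- int k - 1) vac) q v = (\<Sum>j\<in>B. ?R j)"
    if "finite B" "\<And>j. j \<notin> B \<Longrightarrow> ?R j = 0" for B
    using borcherds_sums[of a vac "{0}" B 0 "- int k - 1" q v] that assms vac_in
    by (simp add: gbinomial_0_left)
  consider "q < 0" | "0 \<le> q" "q < int k" | "int k \<le> q" by linarith
  thus ?thesis
  proof cases
    case 1
    define j where "j = nat (- 1 - q)"
    have q: "q = - 1 - int j" using 1 by (simp add: j_def)
    have "act (Y a (- int k - 1) vac) q v = (\<Sum>i\<in>{j}. ?R i)"
      by (rule sum_eq) (simp, rule R0, auto simp: q)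
    also have "\<dots> = scaleM (of_nat (k + j) gchoose j) (act a (q - int k) v)"
    proof -
      have idx: "- int k - (1 + int j) = - 1 - (int j + int k)" by simp
      show ?thesis using assms bin'[of j] by (simp add: act_vacuum q algebra_simps idx)
    qed
    also have "(of_nat (k + j) gchoose j :: complex) = (- 1) ^ k * ((of_int q :: complex) gchoose k)"
    proof -
      have "(of_nat (k + j) gchoose j :: complex) = of_nat ((k + j) choose k)"
        by (metis add.commute binomial_gbinomial binomial_symmetric add_diff_cancel_left' le_add1)
      moreover have "((of_int q :: complex) gchoose k) = (-1) ^ k * (of_nat (k + j) gchoose k)"
        using gbinomial_negated_upper[of "of_int q :: complex" k] by (simp add: q algebra_simps)
      ultimately show ?thesis by (simp add: binomial_gbinomial flip: mult.assoc power_mult_distrib)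
    qed
    finally show ?thesis .
  next
    case 2
    have "act (Y a (- int k - 1) vac) q v = (\<Sum>i\<in>{}. ?R i)"
      by (rule sum_eq) (simp, rule R0, use 2 in auto)
    moreover have "((of_int q :: complex) gchoose k) = 0"
    proof -
      obtain m where m: "q = int m" using 2 nonneg_int_cases by blast
      show ?thesis using 2 unfolding m by (simp flip: binomial_gbinomial)
    qed
    ultimately show ?thesis by simp
  next
    case 3
    define j where "j = nat (q - int k)"
    have q: "q = int k + int j" using 3 by (simp add: j_def)
    have "act (Y a (- int k - 1) vac) q v = (\<Sum>i\<in>{j}. ?R i)"
      by (rule sum_eq) (simp, rule R0, auto simp: q)
    also have "\<dots> = scaleM ((- 1) ^ k * (of_nat (k + j) gchoose j)) (act a (q - int k) v)"
      using assms bin'[of j] sgn by (simp add: act_vacuum q algebra_simps)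
    also have "(of_nat (k + j) gchoose j :: complex) = (of_int q :: complex) gchoose k"
      using q by (metis add.commute binomial_gbinomial binomial_symmetric add_diff_cancel_left' le_add1 of_int_of_nat_eq of_nat_add)
    finally show ?thesis .
  qed
qed

end

context vertex_algebra
begin

text \<open>Through this, every statement about modes on modules is reused for the algebra
  itself.\<close>

lemma self_module: "vertex_module scale Y vac scale UNIV Y"
proof
  show "vertex_subalgebra UNIV" by (auto simp: vertex_subalgebra_def)
qed (auto simp: Y_add_left Y_scale_left Y_add_right Y_scale_right truncation vacuum borcherds)

lemmas Y_zero_left [simp] = vertex_module.act_zero_left[OF self_module]
lemmas Y_zero_right [simp] = vertex_module.act_zero_right[OF self_module UNIV_I]
lemmas Y_sum_left = vertex_module.act_sum_left[OF self_module UNIV_I]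
lemmas Y_sum_right = vertex_module.act_sum_right[OF self_module UNIV_I]
lemmas Y_diff_right = vertex_module.act_diff_right[OF self_module UNIV_I]
lemmas Y_commutator = vertex_module.commutator[OF self_module UNIV_I UNIV_I]
lemmas Y_associativity_ex = vertex_module.associativity_ex[OF self_module UNIV_I UNIV_I]
lemmas Y_associativity = vertex_module.associativity[OF self_module UNIV_I UNIV_I]
lemmas Y_derivative = vertex_module.act_derivative[OF self_module UNIV_I]
lemmas Y_truncation_nat = vertex_module.truncation_nat[OF self_module]

end

section \<open>The Fock space basis\<close>

context vertex_algebra
begin

lemma subspace_vimage_Y: "subspace U \<Longrightarrow> subspace {v. Y a r v \<in> U}"
  by (auto simp: subspace_def Y_add_right Y_scale_right)

lemma Y_minus_right: "Y a r (- v) = - Y a r v"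
  using Y_scale_right[of a r "-1" v] by (simp add: scale_minus_left)

end

context heisenberg_vertex_algebra
begin

abbreviation h :: "'n \<Rightarrow> int \<Rightarrow> 'v \<Rightarrow> 'v" where
  "h i \<equiv> Y (\<alpha> i)"

text \<open>Only the double pole enters the commutator formula: binom(p,1) = p, and the mode p+q-1
  of \<open>vac\<close> is nonzero exactly when p+q = 0.\<close>

lemma heisenberg_relation:
  "h i p (h j q v) = h j q (h i p v) + (if i = j \<and> p + q = 0 then scale (of_int p) v else 0)"
proof -
  have "h i p (h j q v) - h j q (h i p v) = (\<Sum>k<2. scale ((of_int p :: complex) gchoose k)
      (Y (Y (\<alpha> i) (int k) (\<alpha> j)) (p + q - int k) v))"
    by (rule Y_commutator) (simp add: ope)
  also have "\<dots> = (if i = j \<and> p + q = 0 then scale (of_int p) v else 0)"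
    by (simp add: ope numeral_2_eq_2 vacuum)
  finally show ?thesis by (simp add: algebra_simps)
qed

text \<open>The second index k stands for the mode k+1, so every pair is an admissible variable; the
  remaining mode 0 acts by zero (\<open>h_zero\<close>).\<close>

definition creat :: "'n \<times> nat \<Rightarrow> 'v \<Rightarrow> 'v" where
  "creat x = h (fst x) (- int (snd x) - 1)"

definition annih :: "'n \<times> nat \<Rightarrow> 'v \<Rightarrow> 'v" where
  "annih x = h (fst x) (int (snd x) + 1)"

lemma creat_linear [simp]:
  "creat x (u + v) = creat x u + creat x v" "creat x (scale c v) = scale c (creat x v)" "creat x 0 = 0"
  "creat x (u - v) = creat x u - creat x v" "creat x (sum f A) = (\<Sum>a\<in>A. creat x (f a))"
  by (auto simp: creat_def Y_add_right Y_scale_right Y_diff_right Y_sum_right)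

lemma annih_linear [simp]:
  "annih x (u + v) = annih x u + annih x v" "annih x (scale c v) = scale c (annih x v)" "annih x 0 = 0"
  "annih x (u - v) = annih x u - annih x v" "annih x (sum f A) = (\<Sum>a\<in>A. annih x (f a))"
  by (auto simp: annih_def Y_add_right Y_scale_right Y_diff_right Y_sum_right)

lemma creat_commute: "creat x (creat y v) = creat y (creat x v)"
  unfolding creat_def by (subst heisenberg_relation) simp

lemma annih_commute: "annih x (annih y v) = annih y (annih x v)"
  unfolding annih_def by (subst heisenberg_relation) simp

lemma annih_creat:
  "annih x (creat y v) = creat y (annih x v) + (if x = y then scale (of_nat (snd x) + 1) v else 0)"
  unfolding annih_def creat_def by (subst heisenberg_relation) (auto simp: prod_eq_iff)

sublocale cr: comp_fun_commute creat
  by unfold_locales (auto simp: creat_commute)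

sublocale an: comp_fun_commute annih
  by unfold_locales (auto simp: annih_commute)

definition fock :: "('n \<times> nat) multiset \<Rightarrow> 'v" where
  "fock = fold_mset creat vac"

lemma fock_empty [simp]: "fock {#} = vac"
  by (simp add: fock_def)

lemma fock_add [simp]: "fock (add_mset x \<mu>) = creat x (fock \<mu>)"
  by (simp add: fock_def)

lemma annih_vac [simp]: "annih x vac = 0"
  by (simp add: annih_def creation)

lemma annih_fock:
  "annih x (fock \<mu>) = scale (of_nat (count \<mu> x) * (of_nat (snd x) + 1)) (fock (\<mu> - {#x#}))"
proof (induction \<mu>)
  case empty
  show ?case by simp
next
  case (add y \<mu>)
  show ?case
  proof (cases "x = y")
    case True
    have "creat y (scale (of_nat (count \<mu> y) * (of_nat (snd y) + 1)) (fock (\<mu> - {#y#})))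
        = scale (of_nat (count \<mu> y) * (of_nat (snd y) + 1)) (fock \<mu>)"
      by (cases "y \<in># \<mu>") (auto simp: not_in_iff simp flip: fock_add)
    then have "annih y (fock (add_mset y \<mu>)) = scale (of_nat (count \<mu> y) * (of_nat (snd y) + 1)) (fock \<mu>)
        + scale (of_nat (snd y) + 1) (fock \<mu>)"
      using add True by (simp only: annih_creat fock_add if_True simp_thms)
    also have "\<dots> = scale (of_nat (count (add_mset y \<mu>) y) * (of_nat (snd y) + 1)) (fock \<mu>)"
      unfolding scale_left_distrib[symmetric] by (rule arg_cong[of _ _ "\<lambda>c. scale c _"]) (simp add: algebra_simps)
    finally show ?thesis using True by simp
  next
    case False
    then have "annih x (fock (add_mset y \<mu>)) = creat y (annih x (fock \<mu>))"
      by (simp only: annih_creat fock_add if_False add_0_right)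
    also have "\<dots> = scale (of_nat (count \<mu> x) * (of_nat (snd x) + 1)) (fock (add_mset y (\<mu> - {#x#})))"
      by (simp only: add creat_linear fock_add)
    also have "count \<mu> x = count (add_mset y \<mu>) x" using False by simp
    also have "add_mset y (\<mu> - {#x#}) = add_mset y \<mu> - {#x#}"
      using False by (simp add: diff_add_mset_swap)
    finally show ?thesis .
  qed
qed

text \<open>Associativity writes the modes of \<open>Y a r b\<close> through those of a and b, so
  the elements whose modes preserve U form a vertex subalgebra; it contains the generators.\<close>

lemma subspace_stable_modes:
  assumes U: "subspace U" and \<alpha>: "\<And>i r u. u \<in> U \<Longrightarrow> h i r u \<in> U"
  shows "u \<in> U \<Longrightarrow> Y a r u \<in> U"
proof -
  let ?A = "{a. \<forall>r u. u \<in> U \<longrightarrow> Y a r u \<in> U}"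
  have "vertex_subalgebra ?A"
    unfolding vertex_subalgebra_def
  proof (intro conjI ballI allI)
    show "subspace ?A"
      using U by (auto simp: subspace_def Y_add_left Y_scale_left)
    show "vac \<in> ?A"
      using U by (auto simp: vacuum subspace_def)
    fix a b r assume ab: "a \<in> ?A" "b \<in> ?A"
    show "Y a r b \<in> ?A"
    proof (intro CollectI allI impI)
      fix s u assume "u \<in> U"
      obtain N where "Y (Y a r b) s u
    = (\<Sum>j<N. scale ((- 1) ^ j * ((of_int r :: complex) gchoose j))
        (Y a (r - int j) (Y b (s + int j) u)
          - scale ((- 1) powi r) (Y b (s + r - int j) (Y a (int j) u))))"
        using Y_associativity_ex by blast
      then show "Y (Y a r b) s u \<in> U"
        using ab \<open>u \<in> U\<close> by (auto intro!: subspace_sum[OF U] subspace_scale[OF U] subspace_diff[OF U])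
    qed
  qed
  moreover have "range \<alpha> \<subseteq> ?A" using \<alpha> by auto
  ultimately have "?A = UNIV" by (rule generated)
  then show "u \<in> U \<Longrightarrow> Y a r u \<in> U" by blast
qed

text \<open>The span of the monomials is stable under the Heisenberg modes, hence under all modes;
  \<open>Y a (- 1) vac = a\<close> then reaches every vector.\<close>

lemma span_fock: "span (range fock) = UNIV"
proof -
  let ?U = "span (range fock)"
  have U: "subspace ?U" by simp
  have "h i r (fock \<mu>) \<in> ?U" for i r \<mu>
  proof (cases "r < 0")
    case True
    then have "h i r (fock \<mu>) = fock (add_mset (i, nat (- r - 1)) \<mu>)"
      by (simp add: creat_def)
    then show ?thesis by (metis rangeI span_base)
  next
    case False
    show ?thesis
    proof (induction \<mu>)
      case empty
      then show ?case using False by (simp add: creation span_zero)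
    next
      case (add x \<mu>)
      have "range fock \<subseteq> {v. creat x v \<in> ?U}"
        by (auto simp: span_base simp flip: fock_add)
      then have "?U \<subseteq> {v. creat x v \<in> ?U}"
        unfolding creat_def by (intro span_minimal subspace_vimage_Y U)
      then have "creat x (h i r (fock \<mu>)) \<in> ?U" using add by blast
      then show ?case
        unfolding fock_add creat_def
        by (subst heisenberg_relation) (auto intro!: span_add span_scale simp: span_base)
    qed
  qed
  then have "?U \<subseteq> {v. h i r v \<in> ?U}" for i r
    by (intro span_minimal subspace_vimage_Y U) auto
  then have "h i r v \<in> ?U" if "v \<in> ?U" for i r v using that by blast
  moreover have "vac \<in> ?U" by (metis fock_empty rangeI span_base)
  ultimately have "Y a (- 1) vac \<in> ?U" for a
    by (rule subspace_stable_modes[OF U])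
  then show ?thesis by (auto simp: creation)
qed

lemma fock_induct [case_names add scale vac creat]:
  assumes "\<And>u v. P u \<Longrightarrow> P v \<Longrightarrow> P (u + v)" "\<And>c v. P v \<Longrightarrow> P (scale c v)" "P vac"
    "\<And>x v. P v \<Longrightarrow> P (creat x v)"
  shows "P v"
proof -
  have "P (fock \<mu>)" for \<mu>
    by (induction \<mu>) (use assms in auto)
  then have "span (range fock) \<subseteq> {v. P v}"
    using assms(1,2) assms(2)[OF assms(3), of 0]
    by (intro span_minimal) (auto simp: subspace_def)
  then show ?thesis by (auto simp: span_fock)
qed

text \<open>The mode 0 commutes with all creation operators, because the central term carries the
  factor 0, and it kills \<open>vac\<close>.\<close>

lemma h_zero [simp]: "h i 0 v = 0"
proof (induction v rule: fock_induct)
  case (creat x v)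
  then show ?case unfolding creat_def by (subst heisenberg_relation) simp
qed (auto simp: Y_add_right Y_scale_right creation)

section \<open>Norms of monomials and independence of the Fock basis\<close>

definition nrm :: "('n \<times> nat) multiset \<Rightarrow> real" where
  "nrm \<mu> = (\<Prod>x\<in>set_mset \<mu>. fact (count \<mu> x) * (real (snd x) + 1) ^ count \<mu> x)"

lemma nrm_pos: "nrm \<mu> > 0"
  unfolding nrm_def by (intro prod_pos) auto

lemma nrm_add: "nrm (add_mset x \<mu>) = (real (snd x) + 1) * (real (count \<mu> x) + 1) * nrm \<mu>"
proof -
  let ?f = "\<lambda>\<mu> x. fact (count \<mu> x) * (real (snd x) + 1) ^ count \<mu> x"
  have "nrm (add_mset x \<mu>) = ?f (add_mset x \<mu>) x * (\<Prod>y\<in>set_mset \<mu> - {x}. ?f (add_mset x \<mu>) y)"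
    unfolding nrm_def set_mset_add_mset_insert by (rule prod.insert_remove) simp
  also have "(\<Prod>y\<in>set_mset \<mu> - {x}. ?f (add_mset x \<mu>) y) = (\<Prod>y\<in>set_mset \<mu> - {x}. ?f \<mu> y)"
    by (rule prod.cong) auto
  also have "?f (add_mset x \<mu>) x = (real (snd x) + 1) * (real (count \<mu> x) + 1) * ?f \<mu> x"
    by (simp add: algebra_simps)
  also have "\<dots> * (\<Prod>y\<in>set_mset \<mu> - {x}. ?f \<mu> y)
      = (real (snd x) + 1) * (real (count \<mu> x) + 1) * (\<Prod>y\<in>insert x (set_mset \<mu>). ?f \<mu> y)"
    by (simp add: prod.insert_remove)
  also have "(\<Prod>y\<in>insert x (set_mset \<mu>). ?f \<mu> y) = nrm \<mu>"
    unfolding nrm_def by (rule prod.mono_neutral_right) (auto simp: not_in_iff)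
  finally show ?thesis .
qed

text \<open>Each annihilator removes one matching factor. With at least as many annihilators as
  factors, any mismatch gives zero, so the result detects equality of multisets.\<close>

lemma fold_annih_fock:
  assumes "size \<mu> \<le> size \<nu>"
  shows "fold_mset annih (fock \<mu>) \<nu> = scale (if \<mu> = \<nu> then of_real (nrm \<mu>) else 0) vac"
  using assms
proof (induction \<nu> arbitrary: \<mu>)
  case empty
  then show ?case by (simp add: nrm_def)
next
  case (add x \<nu>)
  have lin: "fold_mset annih (scale c v) \<nu> = scale c (fold_mset annih v \<nu>)" for c v
    by (induction \<nu>) auto
  have "fold_mset annih (fock \<mu>) (add_mset x \<nu>) = fold_mset annih (annih x (fock \<mu>)) \<nu>"
    by (simp add: an.fold_mset_fun_left_comm)
  also have "\<dots> = scale (of_nat (count \<mu> x) * (of_nat (snd x) + 1))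
      (fold_mset annih (fock (\<mu> - {#x#})) \<nu>)"
    by (simp add: annih_fock lin)
  also have "\<dots> = scale (if \<mu> = add_mset x \<nu> then of_real (nrm \<mu>) else 0) vac"
  proof (cases "x \<in># \<mu>")
    case True
    then obtain \<mu>' where \<mu>': "\<mu> = add_mset x \<mu>'" by (metis insert_DiffM)
    then show ?thesis using add by (simp add: nrm_add algebra_simps)
  qed (auto simp: not_in_iff)
  finally show ?case .
qed

lemma inj_fock: "inj fock"
proof -
  have "\<mu> = \<nu>" if "fock \<mu> = fock \<nu>" "size \<mu> \<le> size \<nu>" for \<mu> \<nu>
  proof (rule ccontr)
    assume "\<mu> \<noteq> \<nu>"
    then have "scale (of_real (nrm \<nu>)) vac = 0"
      using fold_annih_fock[OF that(2)] fold_annih_fock[of \<nu> \<nu>] that(1) by simp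
    then show False using nonzero nrm_pos[of \<nu>] by simp
  qed
  then show ?thesis unfolding inj_def by (metis linorder_le_cases)
qed

lemma independent_fock: "independent (range fock)"
proof -
  have "u v = 0" if t: "finite t" "t \<subseteq> range fock" "(\<Sum>v\<in>t. scale (u v) v) = 0" "v \<in> t" for t u v
  proof (rule ccontr)
    assume "u v \<noteq> 0"
    define T where "T = fock -` {w \<in> t. u w \<noteq> 0}"
    have fin: "finite T"
      unfolding T_def by (rule finite_vimageI) (use t inj_fock in auto)
    have "T \<noteq> {}" using t(2,4) \<open>u v \<noteq> 0\<close> by (auto simp: T_def)
    \<comment> \<open>A term of maximal size: its annihilators kill every other term of the
      relation, since none is longer.\<close>
    obtain \<nu> where \<nu>: "\<nu> \<in> T" "\<And>\<mu>. \<mu> \<in> T \<Longrightarrow> size \<mu> \<le> size \<nu>"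
    proof -
      have "Max (size ` T) \<in> size ` T" using fin \<open>T \<noteq> {}\<close> by (intro Max_in) auto
      then obtain \<nu> where "\<nu> \<in> T" "Max (size ` T) = size \<nu>" by auto
      then show ?thesis using that[of \<nu>] fin by (metis Max_ge finite_imageI imageI)
    qed
    have lin: "fold_mset annih (\<Sum>w\<in>S. scale (c w) (f w)) \<nu> = (\<Sum>w\<in>S. scale (c w) (fold_mset annih (f w) \<nu>))"
      for S c and f :: "('n \<times> nat) multiset \<Rightarrow> 'v"
      by (induction \<nu>) auto
    have "(\<Sum>v\<in>t. scale (u v) v) = (\<Sum>v\<in>fock ` T. scale (u v) v)"
      using t by (intro sum.mono_neutral_right) (auto simp: T_def)
    also have "\<dots> = (\<Sum>\<mu>\<in>T. scale (u (fock \<mu>)) (fock \<mu>))"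
      by (subst sum.reindex) (use inj_fock in \<open>auto simp: inj_on_def inj_def\<close>)
    finally have "fold_mset annih (\<Sum>\<mu>\<in>T. scale (u (fock \<mu>)) (fock \<mu>)) \<nu> = fold_mset annih 0 \<nu>"
      using t(3) by simp
    also have "fold_mset annih 0 \<nu> = 0"
      by (induction \<nu>) auto
    also have "fold_mset annih (\<Sum>\<mu>\<in>T. scale (u (fock \<mu>)) (fock \<mu>)) \<nu>
        = (\<Sum>\<mu>\<in>T. scale (u (fock \<mu>)) (scale (if \<mu> = \<nu> then of_real (nrm \<mu>) else 0) vac))"
      unfolding lin by (rule sum.cong) (use \<nu> fold_annih_fock in auto)
    also have "\<dots> = (\<Sum>\<mu>\<in>T. if \<mu> = \<nu> then scale (u (fock \<nu>) * of_real (nrm \<nu>)) vac else 0)"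
      by (rule sum.cong) auto
    also have "\<dots> = scale (u (fock \<nu>) * of_real (nrm \<nu>)) vac"
      using fin \<nu>(1) by simp
    finally have "scale (u (fock \<nu>) * of_real (nrm \<nu>)) vac = 0" by simp
    then show False
      using \<nu>(1) nonzero nrm_pos[of \<nu>] by (simp add: T_def)
  qed
  then show ?thesis
    unfolding independent_explicit_module by blast
qed

definition coeff :: "'v \<Rightarrow> ('n \<times> nat) multiset \<Rightarrow> complex" where
  "coeff v \<mu> = representation (range fock) v (fock \<mu>)"

lemma coeff_add [simp]: "coeff (u + v) \<mu> = coeff u \<mu> + coeff v \<mu>"
  unfolding coeff_def by (subst representation_add) (auto simp: independent_fock span_fock)

lemma coeff_scale [simp]: "coeff (scale c v) \<mu> = c * coeff v \<mu>"
  unfolding coeff_def by (subst representation_scale) (auto simp: independent_fock span_fock)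

lemma coeff_fock: "coeff (fock \<mu>) \<nu> = (if \<nu> = \<mu> then 1 else 0)"
  unfolding coeff_def
  by (subst representation_basis) (use inj_fock in \<open>auto simp: independent_fock inj_eq\<close>)

lemma coeff_zero [simp]: "coeff 0 \<mu> = 0"
  using coeff_scale[of 0 0] by simp

lemma finite_coeff: "finite {\<mu>. coeff v \<mu> \<noteq> 0}"
proof -
  have "{\<mu>. coeff v \<mu> \<noteq> 0} = fock -` {b. representation (range fock) v b \<noteq> 0}"
    by (auto simp: coeff_def)
  then show ?thesis
    using finite_vimageI[OF finite_representation inj_fock] by simp
qed

lemma coeff_expansion:
  assumes "finite F" "{\<mu>. coeff v \<mu> \<noteq> 0} \<subseteq> F"
  shows "(\<Sum>\<mu>\<in>F. scale (coeff v \<mu>) (fock \<mu>)) = v"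
proof -
  have "(\<Sum>\<mu>\<in>F. scale (coeff v \<mu>) (fock \<mu>)) = (\<Sum>\<mu>|coeff v \<mu> \<noteq> 0. scale (coeff v \<mu>) (fock \<mu>))"
    using assms by (intro sum.mono_neutral_right) auto
  also have "\<dots> = (\<Sum>b\<in>fock ` {\<mu>. coeff v \<mu> \<noteq> 0}. scale (representation (range fock) v b) b)"
    using inj_fock by (subst sum.reindex) (auto simp: coeff_def inj_on_def inj_def)
  also have "fock ` {\<mu>. coeff v \<mu> \<noteq> 0} = {b. representation (range fock) v b \<noteq> 0}"
    by (auto simp: coeff_def dest: representation_ne_zero)
  also have "(\<Sum>b\<in>\<dots>. scale (representation (range fock) v b) b) = v"
    by (rule sum_nonzero_representation_eq) (auto simp: independent_fock span_fock)
  finally show ?thesis .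
qed

lemma coeff_eqI:
  assumes "\<And>\<mu>. coeff u \<mu> = coeff v \<mu>"
  shows "u = v"
proof -
  have eq: "coeff u = coeff v" using assms by (rule ext)
  show ?thesis
    using coeff_expansion[OF finite_coeff order_refl, of u]
      coeff_expansion[OF finite_coeff order_refl, of v]
    unfolding eq by (rule trans[OF sym])
qed

definition extend :: "(('n \<times> nat) multiset \<Rightarrow> 'v) \<Rightarrow> 'v \<Rightarrow> 'v" where
  "extend f v = (\<Sum>\<mu>|coeff v \<mu> \<noteq> 0. scale (coeff v \<mu>) (f \<mu>))"

lemma extend_eq:
  assumes "finite F" "{\<mu>. coeff v \<mu> \<noteq> 0} \<subseteq> F"
  shows "extend f v = (\<Sum>\<mu>\<in>F. scale (coeff v \<mu>) (f \<mu>))"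
  unfolding extend_def using assms by (intro sum.mono_neutral_left) auto

lemma extend_fock [simp]: "extend f (fock \<mu>) = f \<mu>"
  by (subst extend_eq[of "{\<mu>}"]) (auto simp: coeff_fock)

lemma extend_scale: "extend f (scale c v) = scale c (extend f v)"
  by (subst extend_eq[of "{\<mu>. coeff v \<mu> \<noteq> 0}"])
    (auto simp: finite_coeff extend_def scale_sum_right)

lemma extend_add: "extend f (u + v) = extend f u + extend f v"
proof -
  let ?F = "{\<mu>. coeff u \<mu> \<noteq> 0} \<union> {\<mu>. coeff v \<mu> \<noteq> 0}"
  have "finite ?F" by (simp add: finite_coeff)
  then show ?thesis
    using extend_eq[of ?F u f] extend_eq[of ?F v f] extend_eq[of ?F "u + v" f]
    by (force simp: scale_left_distrib sum.distrib)
qed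

end

section \<open>Lifts of orthogonal matrices and quadratic invariants\<close>

context heisenberg_vertex_algebra
begin

lemma coeff_sum [simp]: "coeff (\<Sum>x\<in>A. f x) \<mu> = (\<Sum>x\<in>A. coeff (f x) \<mu>)"
  by (induction A rule: infinite_finite_induct) auto

lemma linear_induct [case_names add scale fock]:
  assumes "\<And>u v. P u \<Longrightarrow> P v \<Longrightarrow> P (u + v)" "\<And>c v. P v \<Longrightarrow> P (scale c v)" "\<And>\<mu>. P (fock \<mu>)"
  shows "P v"
proof -
  have "P 0" using assms(2)[OF assms(3), of 0] by simp
  then have "P (\<Sum>\<mu>\<in>F. scale (coeff v \<mu>) (fock \<mu>))" for F
    by (induction F rule: infinite_finite_induct) (simp_all add: assms)
  then show ?thesis
    using coeff_expansion[OF finite_coeff order_refl, of v] by metis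
qed

text \<open>What \<open>creat x\<close> must become under conjugation by a lift of A.\<close>

definition creat_image :: "complex ^ 'n ^ 'n \<Rightarrow> 'n \<times> nat \<Rightarrow> 'v \<Rightarrow> 'v" where
  "creat_image A x v = (\<Sum>j\<in>UNIV. scale (A $ j $ fst x) (creat (j, snd x) v))"

lemma creat_image_linear [simp]:
  "creat_image A x (u + v) = creat_image A x u + creat_image A x v"
  "creat_image A x (scale c v) = scale c (creat_image A x v)"
  by (simp_all add: creat_image_def scale_right_distrib sum.distrib scale_sum_right mult.commute)

lemma creat_image_commute: "creat_image A x (creat_image A y v) = creat_image A y (creat_image A x v)"
proof -
  have "creat_image A x (creat_image A y v) = (\<Sum>j\<in>UNIV. \<Sum>l\<in>UNIV.
      scale (A $ j $ fst x * A $ l $ fst y) (creat (j, snd x) (creat (l, snd y) v)))"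
    by (simp add: creat_image_def scale_sum_right)
  also have "\<dots> = (\<Sum>l\<in>UNIV. \<Sum>j\<in>UNIV.
      scale (A $ l $ fst y * A $ j $ fst x) (creat (l, snd y) (creat (j, snd x) v)))"
    by (subst sum.swap) (simp add: creat_commute mult.commute)
  also have "\<dots> = creat_image A y (creat_image A x v)"
    by (simp add: creat_image_def scale_sum_right)
  finally show ?thesis .
qed

text \<open>A substitution of variables in the polynomial algebra of creation operators.
  Orthogonality of A makes it compatible with the annihilation modes and thereby with all fields
  (\<open>lift_h\<close>, \<open>lift_Y\<close>).\<close>

definition lift :: "complex ^ 'n ^ 'n \<Rightarrow> 'v \<Rightarrow> 'v" where
  "lift A = extend (fold_mset (creat_image A) vac)"

lemma lift_linear [simp]:
  "lift A (u + v) = lift A u + lift A v" "lift A (scale c v) = scale c (lift A v)"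
  by (simp_all add: lift_def extend_add extend_scale)

lemma lift_zero [simp]: "lift A 0 = 0"
  using lift_linear(2)[of A 0 0] by simp

lemma lift_diff [simp]: "lift A (u - v) = lift A u - lift A v"
  using lift_linear(1)[of A "u - v" v] by simp

lemma lift_sum [simp]: "lift A (sum f I) = (\<Sum>x\<in>I. lift A (f x))"
  by (induction I rule: infinite_finite_induct) auto

lemma lift_vac [simp]: "lift A vac = vac"
  using extend_fock[of "fold_mset (creat_image A) vac" "{#}"] by (simp add: lift_def)

lemma lift_creat: "lift A (creat x v) = creat_image A x (lift A v)"
proof -
  interpret comp_fun_commute "creat_image A"
    by unfold_locales (auto simp: creat_image_commute)
  show ?thesis
  proof (induction v rule: linear_induct)
    case (fock \<mu>)
    have "lift A (fock (add_mset x \<mu>)) = creat_image A x (lift A (fock \<mu>))"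
      unfolding lift_def extend_fock by simp
    then show ?case by simp
  qed simp_all
qed

lemma orthogonal_cols:
  assumes "orthogonal_matrix (A :: complex ^ 'n ^ 'n)"
  shows "(\<Sum>j\<in>UNIV. A $ j $ a * A $ j $ b) = (if a = b then 1 else 0)"
proof -
  have "(transpose A ** A) $ a $ b = mat 1 $ a $ b"
    using assms by (simp add: orthogonal_matrix_def)
  then show ?thesis by (simp add: matrix_matrix_mult_def transpose_def mat_def)
qed

lemma orthogonal_matrix_transpose: "orthogonal_matrix (A :: complex ^ 'n ^ 'n) \<Longrightarrow> orthogonal_matrix (transpose A)"
  by (simp add: orthogonal_matrix_def)

lemma orthogonal_rows:
  assumes "orthogonal_matrix (A :: complex ^ 'n ^ 'n)"
  shows "(\<Sum>j\<in>UNIV. A $ a $ j * A $ b $ j) = (if a = b then 1 else 0)"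
  using orthogonal_cols[OF orthogonal_matrix_transpose[OF assms], of a b] by (simp add: transpose_def)

text \<open>For r > 0 the mode is commuted past one creation operator at a time; orthonormality of
  the columns of A is what matches the central terms on both sides.\<close>

lemma lift_h:
  assumes A: "orthogonal_matrix A"
  shows "lift A (h i r v) = (\<Sum>j\<in>UNIV. scale (A $ j $ i) (h j r (lift A v)))"
proof -
  consider "r < 0" | "r = 0" | "r > 0" by linarith
  then show ?thesis
  proof cases
    case 1
    then show ?thesis
      using lift_creat[of A "(i, nat (- r - 1))" v] by (simp add: creat_def creat_image_def)
  next
    case 2
    then show ?thesis by simp
  next
    case 3
    show ?thesis
    proof (induction v rule: fock_induct)
      case (creat x v)
      obtain c k where x: "x = (c, k)" by fastforce
      have rel: "h j r (creat (l, k) w) = creat (l, k) (h j r w)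
          + (if j = l then (if r = int k + 1 then scale (of_int r) w else 0) else 0)" for j l w
        unfolding creat_def fst_conv snd_conv by (subst heisenberg_relation) (auto simp: algebra_simps)
      let ?z = "if r = int k + 1 then scale (of_int r) (lift A v) else 0"
      have "lift A (h i r (creat x v)) = lift A (creat (c, k) (h i r v)) + (if i = c then ?z else 0)"
        unfolding x rel by simp
      also have "lift A (creat (c, k) (h i r v))
          = (\<Sum>l\<in>UNIV. \<Sum>j\<in>UNIV. scale (A $ l $ c * A $ j $ i) (creat (l, k) (h j r (lift A v))))"
        by (simp add: lift_creat creat creat_image_def scale_sum_right)
      also have "\<dots> = (\<Sum>j\<in>UNIV. \<Sum>l\<in>UNIV. scale (A $ j $ i * A $ l $ c) (creat (l, k) (h j r (lift A v))))"
        by (subst sum.swap) (simp add: mult.commute)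
      also have "(if i = c then ?z else 0) = (\<Sum>j\<in>UNIV. scale (A $ j $ i * A $ j $ c) ?z)"
        by (simp only: scale_sum_left[symmetric] orthogonal_cols[OF A]) simp
      also have "\<dots> = (\<Sum>j\<in>UNIV. \<Sum>l\<in>UNIV. scale (A $ j $ i * A $ l $ c) (if j = l then ?z else 0))"
      proof (rule sum.cong)
        fix j :: 'n
        have "(\<Sum>l\<in>UNIV. scale (A $ j $ i * A $ l $ c) (if j = l then ?z else 0))
            = (\<Sum>l\<in>UNIV. if j = l then scale (A $ j $ i * A $ j $ c) ?z else 0)"
          by (rule sum.cong) auto
        then show "scale (A $ j $ i * A $ j $ c) ?z = (\<Sum>l\<in>UNIV. scale (A $ j $ i * A $ l $ c) (if j = l then ?z else 0))"
          by simp
      qed simp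
      also have "(\<Sum>j\<in>UNIV. \<Sum>l\<in>UNIV. scale (A $ j $ i * A $ l $ c) (creat (l, k) (h j r (lift A v)))) + \<dots>
          = (\<Sum>j\<in>UNIV. scale (A $ j $ i) (\<Sum>l\<in>UNIV. scale (A $ l $ c)
              (creat (l, k) (h j r (lift A v)) + (if j = l then ?z else 0))))"
        by (simp add: scale_sum_right scale_right_distrib sum.distrib del: creat_linear)
      also have "\<dots> = (\<Sum>j\<in>UNIV. scale (A $ j $ i) (\<Sum>l\<in>UNIV. scale (A $ l $ c) (h j r (creat (l, k) (lift A v)))))"
        unfolding rel ..
      also have "\<dots> = (\<Sum>j\<in>UNIV. scale (A $ j $ i) (h j r (lift A (creat x v))))"
        by (simp add: x lift_creat creat_image_def Y_sum_right Y_scale_right)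
      finally show ?case .
    qed (use 3 in \<open>simp_all add: Y_add_right Y_scale_right creation sum.distrib scale_right_distrib scale_sum_right mult.commute\<close>)
  qed
qed

lemma lift_transpose:
  assumes A: "orthogonal_matrix A"
  shows "lift (transpose A) (lift A v) = v"
proof (induction v rule: fock_induct)
  case (creat x v)
  obtain c k where x: "x = (c, k)" by fastforce
  have transpose_nth: "transpose A $ a $ b = A $ b $ a" for a b
    by (simp add: transpose_def)
  have "lift (transpose A) (lift A (creat x v)) = (\<Sum>j\<in>UNIV. \<Sum>l\<in>UNIV. scale (A $ j $ c * A $ j $ l) (creat (l, k) v))"
    by (simp add: x lift_creat creat_image_def creat transpose_nth scale_sum_right)
  also have "\<dots> = (\<Sum>l\<in>UNIV. scale (\<Sum>j\<in>UNIV. A $ j $ c * A $ j $ l) (creat (l, k) v))"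
    by (subst sum.swap) (simp add: scale_sum_left)
  also have "\<dots> = (\<Sum>l\<in>UNIV. if c = l then creat (l, k) v else 0)"
    by (rule sum.cong) (auto simp: orthogonal_cols[OF A])
  finally show ?case by (simp add: x)
qed simp_all

text \<open>The elements whose fields are intertwined by the lift form a vertex subalgebra, by
  comparing two associativity expansions of common length; \<open>lift_h\<close> puts the generators
  into it.\<close>

lemma lift_Y:
  assumes A: "orthogonal_matrix A"
  shows "lift A (Y a r b) = Y (lift A a) r (lift A b)"
proof -
  let ?A = "{a. \<forall>r b. lift A (Y a r b) = Y (lift A a) r (lift A b)}"
  have "vertex_subalgebra ?A"
    unfolding vertex_subalgebra_def
  proof (intro conjI ballI allI)
    show "subspace ?A"
      by (auto simp: subspace_def Y_add_left Y_scale_left)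
    show "vac \<in> ?A"
      by (auto simp: vacuum)
    fix a b r assume ab: "a \<in> ?A" "b \<in> ?A"
    show "Y a r b \<in> ?A"
    proof (intro CollectI allI)
      fix s u
      let ?S = "\<lambda>a b u N. (\<Sum>j<N. scale ((- 1) ^ j * ((of_int r :: complex) gchoose j))
        (Y a (r - int j) (Y b (s + int j) u)
          - scale ((- 1) powi r) (Y b (s + r - int j) (Y a (int j) u))))"
      obtain N1 where N1: "\<forall>N\<ge>N1. Y (Y a r b) s u = ?S a b u N"
        using Y_associativity_ex[of a r b s u] by blast
      obtain N2 where N2: "\<forall>N\<ge>N2. Y (Y (lift A a) r (lift A b)) s (lift A u) = ?S (lift A a) (lift A b) (lift A u) N"
        using Y_associativity_ex[of "lift A a" r "lift A b" s "lift A u"] by blast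
      have N: "Y (Y a r b) s u = ?S a b u (max N1 N2)"
        "Y (Y (lift A a) r (lift A b)) s (lift A u) = ?S (lift A a) (lift A b) (lift A u) (max N1 N2)"
        using N1[rule_format, of "max N1 N2"] N2[rule_format, of "max N1 N2"] by (simp_all only: max.cobounded1 max.cobounded2)
      have "lift A (Y (Y a r b) s u) = lift A (?S a b u (max N1 N2))" by (rule arg_cong[OF N(1)])
      also have "\<dots> = ?S (lift A a) (lift A b) (lift A u) (max N1 N2)"
        using ab by simp
      also have "\<dots> = Y (Y (lift A a) r (lift A b)) s (lift A u)"
        by (rule N(2)[symmetric])
      finally show "lift A (Y (Y a r b) s u) = Y (lift A (Y a r b)) s (lift A u)"
        using ab by simp
    qed
  qed
  moreover have "\<alpha> i \<in> ?A" for i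
  proof -
    have "lift A (\<alpha> i) = (\<Sum>j\<in>UNIV. scale (A $ j $ i) (\<alpha> j))"
      using lift_h[OF A, of i "-1" vac] by (simp add: creation)
    then show ?thesis by (auto simp: lift_h[OF A] Y_sum_left Y_scale_left)
  qed
  then have "range \<alpha> \<subseteq> ?A" by auto
  ultimately have "?A = UNIV" by (rule generated)
  then show ?thesis by blast
qed

lemma lifts_lift:
  assumes A: "orthogonal_matrix A"
  shows "lifts A (lift A)"
proof -
  have "bij (lift A)"
  proof (rule o_bij)
    show "lift (transpose A) \<circ> lift A = id" using lift_transpose[OF A] by auto
    show "lift A \<circ> lift (transpose A) = id"
      using lift_transpose[OF orthogonal_matrix_transpose[OF A]] by auto
  qed
  moreover have "Vector_Spaces.linear scale scale (lift A)"
    by unfold_locales auto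
  moreover have "lift A (\<alpha> i) = (\<Sum>j\<in>UNIV. scale (A $ j $ i) (\<alpha> j))" for i
    using lift_h[OF A, of i "-1" vac] by (simp add: creation)
  ultimately show ?thesis
    by (simp add: lifts_def automorphism_def lift_Y[OF A])
qed

text \<open>Lifts exist and are unique, so the quantifier over lifts collapses to the explicit
  \<open>lift A\<close>.\<close>

lemma orthogonal_invariants_iff:
  "a \<in> orthogonal_invariants \<longleftrightarrow> (\<forall>A. orthogonal_matrix A \<longrightarrow> lift A a = a)"
  unfolding orthogonal_invariants_def using lifts_unique[OF lifts_lift] lifts_lift by blast

section \<open>Contracted quadratic operators and their brackets with Heisenberg modes\<close>

definition Om :: "int \<Rightarrow> int \<Rightarrow> 'v \<Rightarrow> 'v" where
  "Om r s v = (\<Sum>i\<in>UNIV. h i r (h i s v))"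

lemma Om_linear [simp]:
  "Om r s (u + v) = Om r s u + Om r s v" "Om r s (scale c v) = scale c (Om r s v)" "Om r s 0 = 0"
  "Om r s (u - v) = Om r s u - Om r s v" "Om r s (sum f A) = (\<Sum>a\<in>A. Om r s (f a))"
  by (simp_all add: Om_def Y_add_right Y_scale_right Y_diff_right Y_sum_right sum.distrib
      scale_sum_right sum_subtractf sum.swap[of _ A])

lemma lift_Om:
  assumes A: "orthogonal_matrix A"
  shows "lift A (Om r s v) = Om r s (lift A v)"
proof -
  have "lift A (Om r s v) = (\<Sum>i\<in>UNIV. \<Sum>j\<in>UNIV. \<Sum>l\<in>UNIV.
      scale (A $ j $ i * A $ l $ i) (h j r (h l s (lift A v))))"
    by (simp add: Om_def lift_h[OF A] Y_sum_right Y_scale_right scale_sum_right)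
  also have "\<dots> = (\<Sum>j\<in>UNIV. \<Sum>i\<in>UNIV. \<Sum>l\<in>UNIV.
      scale (A $ j $ i * A $ l $ i) (h j r (h l s (lift A v))))"
    by (rule sum.swap)
  also have "\<dots> = (\<Sum>j\<in>UNIV. \<Sum>l\<in>UNIV. \<Sum>i\<in>UNIV.
      scale (A $ j $ i * A $ l $ i) (h j r (h l s (lift A v))))"
    by (rule sum.cong[OF refl], rule sum.swap)
  also have "\<dots> = (\<Sum>j\<in>UNIV. \<Sum>l\<in>UNIV. if j = l then h j r (h l s (lift A v)) else 0)"
    by (intro sum.cong refl, subst scale_sum_left[symmetric], subst orthogonal_rows[OF A]) simp
  also have "\<dots> = Om r s (lift A v)"
    by (simp add: Om_def)
  finally show ?thesis .
qed

lemma Om_invariant: "v \<in> orthogonal_invariants \<Longrightarrow> Om r s v \<in> orthogonal_invariants"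
  by (auto simp: orthogonal_invariants_iff lift_Om)

lemma vac_invariant: "vac \<in> orthogonal_invariants"
  by (auto simp: orthogonal_invariants_iff)

lemma subspace_invariants: "subspace orthogonal_invariants"
  using vertex_subalgebra_orthogonal_invariants by (simp add: vertex_subalgebra_def)

lemma h_Om: "h i t (Om r s v) = Om r s (h i t v)
    + (if t + r = 0 then scale (of_int t) (h i s v) else 0)
    + (if t + s = 0 then scale (of_int t) (h i r v) else 0)"
proof -
  have "h i t (h j r (h j s v)) = h j r (h j s (h i t v))
    + (if i = j then if t + r = 0 then scale (of_int t) (h i s v) else 0 else 0)
    + (if i = j then if t + s = 0 then scale (of_int t) (h i r v) else 0 else 0)" for j
    by (subst heisenberg_relation, subst (2) heisenberg_relation)
      (auto simp: Y_add_right Y_scale_right)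
  then show ?thesis
    by (simp add: Om_def Y_sum_right sum.distrib)
qed

definition quad :: "nat \<Rightarrow> nat \<Rightarrow> 'v" where
  "quad k l = Om (- int k - 1) (- int l - 1) vac"

lemma quad_commute: "quad k l = quad l k"
  unfolding quad_def Om_def by (rule sum.cong) (use creat_commute[of "(_, k)" "(_, l)" vac] in \<open>auto simp: creat_def\<close>)

lemma quad_invariant: "quad k l \<in> orthogonal_invariants"
  by (simp add: quad_def Om_invariant vac_invariant)

lemma Om_vac: "s \<ge> 0 \<Longrightarrow> Om r s vac = 0"
  by (simp add: Om_def creation)

lemma Om_vac': "s < 0 \<Longrightarrow> r \<ge> 0 \<Longrightarrow> \<exists>c. Om r s vac = (if r + s = 0 then scale c vac else 0)"
  unfolding Om_def
  by (subst heisenberg_relation)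
    (auto simp: creation simp flip: scale_sum_left scale_left_distrib intro!: exI[of _ "of_nat CARD('n) * of_int r"]
      simp: sum_constant_scale)

text \<open>The contribution of contracting alpha^i(t) with the first factor of
  \<open>quad k l\<close> inside its mode m: (k+1) binom(t,k+1) comes from the commutator formula,
  the rest is \<open>act_derivative\<close> for the surviving factor alpha^i(-l-1) vac in mode
  t+m-k-1.\<close>

definition quad_coeff :: "nat \<Rightarrow> nat \<Rightarrow> int \<Rightarrow> int \<Rightarrow> complex" where
  "quad_coeff k l m t = (of_nat k + 1) * (of_int t gchoose (k + 1))
     * ((- 1) ^ l * (of_int (t + m - int k - 1) gchoose l))"

lemma h_quad_mode:
  "h i t (Y (quad k l) m v) - Y (quad k l) m (h i t v)
    = scale (quad_coeff k l m t + quad_coeff l k m t) (h i (t + m - int k - int l - 1) v)"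
proof -
  have hq: "h i (int j) (quad k l) = (if j = k + 1 then scale (of_nat k + 1) (h i (- int l - 1) vac) else 0)
      + (if j = l + 1 then scale (of_nat l + 1) (h i (- int k - 1) vac) else 0)" for j
    unfolding quad_def by (subst h_Om) (auto simp: creation ac_simps)
  have deriv: "Y (h i (- int l - 1) vac) n v = scale ((- 1) ^ l * (of_int n gchoose l)) (h i (n - int l) v)" for l n
    by (rule Y_derivative)
  have idx: "t + m - int l - int k - 1 = t + m - int k - int l - 1" by simp
  have T: "scale (of_int t gchoose j) (Y (if j = k + 1 then scale (of_nat k + 1) (h i (- int l - 1) vac) else 0) (t + m - int j) v)
      = (if j = k + 1 then scale (quad_coeff k l m t) (h i (t + m - int k - int l - 1) v) else 0)" for j k l
  proof (cases "j = k + 1")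
    case True
    have "t + m - int (k + 1) = t + m - int k - 1" "t + m - int k - 1 - int l = t + m - int k - int l - 1"
      by simp_all
    with True show ?thesis
      by (simp only: deriv Y_scale_left quad_coeff_def if_True simp_thms scale_scale mult.assoc mult.left_commute)
  qed simp
  have "h i t (Y (quad k l) m v) - Y (quad k l) m (h i t v) = (\<Sum>j<k + l + 2. scale ((of_int t :: complex) gchoose j)
      (Y (h i (int j) (quad k l)) (t + m - int j) v))"
    by (rule Y_commutator) (auto simp: hq)
  also have "\<dots> = (\<Sum>j<k + l + 2. (if j = k + 1 then scale (quad_coeff k l m t) (h i (t + m - int k - int l - 1) v) else 0)
      + (if j = l + 1 then scale (quad_coeff l k m t) (h i (t + m - int k - int l - 1) v) else 0))"
    by (simp only: hq Y_add_left scale_right_distrib T idx)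
  also have "\<dots> = scale (quad_coeff k l m t + quad_coeff l k m t) (h i (t + m - int k - int l - 1) v)"
    by (simp add: sum.distrib scale_left_distrib)
  finally show ?thesis .
qed

end

section \<open>Weights and the Hermitian form\<close>

context heisenberg_vertex_algebra
begin

lemma virasoro_quad: "virasoro = scale (1 / 2) (quad 0 0)"
  by (simp add: virasoro_def quad_def Om_def creation)

lemma quad_mode_vac: "m \<ge> 0 \<Longrightarrow> Y (quad k l) m vac = 0"
  by (simp add: creation)

lemma h_virasoro: "h i t (Y virasoro m v) = Y virasoro m (h i t v) + scale (of_int t) (h i (t + m - 1) v)"
proof -
  have "h i t (Y virasoro m v) - Y virasoro m (h i t v)
      = scale (1/2) (h i t (Y (quad 0 0) m v) - Y (quad 0 0) m (h i t v))"
    by (simp add: virasoro_quad Y_scale_left Y_scale_right scale_right_diff_distrib)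
  also have "\<dots> = scale (of_int t) (h i (t + m - 1) v)"
    unfolding h_quad_mode by (simp add: quad_coeff_def)
  finally show ?thesis by (simp add: algebra_simps)
qed

lemma virasoro_h: "Y virasoro m (h i t v) = h i t (Y virasoro m v) - scale (of_int t) (h i (t + m - 1) v)"
  by (simp add: h_virasoro)

definition wt :: "('n \<times> nat) multiset \<Rightarrow> nat" where
  "wt \<mu> = (\<Sum>x\<in>#\<mu>. snd x + 1)"

lemma wt_simps [simp]: "wt {#} = 0" "wt (add_mset x \<mu>) = snd x + 1 + wt \<mu>"
  by (simp_all add: wt_def)

lemma virasoro_fock: "Y virasoro 1 (fock \<mu>) = scale (of_nat (wt \<mu>)) (fock \<mu>)"
proof (induction \<mu>)
  case (add x \<mu>)
  have "Y virasoro 1 (creat x (fock \<mu>)) = creat x (Y virasoro 1 (fock \<mu>)) + scale (of_nat (snd x) + 1) (creat x (fock \<mu>))"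
    unfolding creat_def virasoro_h by (simp add: scale_minus_left algebra_simps scale_left_diff_distrib)
  also have "\<dots> = scale (of_nat (wt (add_mset x \<mu>))) (creat x (fock \<mu>))"
    unfolding add creat_linear scale_left_distrib[symmetric] by (simp add: algebra_simps)
  finally show ?case by simp
qed (simp add: creation)

lemma coeff_virasoro: "coeff (Y virasoro 1 v) \<mu> = of_nat (wt \<mu>) * coeff v \<mu>"
  by (induction v rule: linear_induct)
    (auto simp: Y_add_right Y_scale_right virasoro_fock coeff_fock algebra_simps)

lemma weight_space_iff: "v \<in> weight_space m \<longleftrightarrow> (\<forall>\<mu>. coeff v \<mu> \<noteq> 0 \<longrightarrow> int (wt \<mu>) = m)"
proof
  assume v: "v \<in> weight_space m"
  show "\<forall>\<mu>. coeff v \<mu> \<noteq> 0 \<longrightarrow> int (wt \<mu>) = m"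
  proof (intro allI impI)
    fix \<mu> assume "coeff v \<mu> \<noteq> 0"
    moreover have "of_nat (wt \<mu>) * coeff v \<mu> = of_int m * coeff v \<mu>"
      using v by (simp add: weight_space_def flip: coeff_virasoro)
    ultimately have "of_int (int (wt \<mu>)) = (of_int m :: complex)" by simp
    then show "int (wt \<mu>) = m" by (simp only: of_int_eq_iff)
  qed
next
  assume "\<forall>\<mu>. coeff v \<mu> \<noteq> 0 \<longrightarrow> int (wt \<mu>) = m"
  then have "coeff (Y virasoro 1 v) \<mu> = coeff (scale (of_int m) v) \<mu>" for \<mu>
    by (cases "coeff v \<mu> = 0") (auto simp: coeff_virasoro)
  then show "v \<in> weight_space m"
    by (auto simp: weight_space_def intro: coeff_eqI)
qed

lemma fock_weight: "fock \<mu> \<in> weight_space (int (wt \<mu>))"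
  by (auto simp: weight_space_iff coeff_fock)

lemma vac_weight: "vac \<in> weight_space 0"
  using fock_weight[of "{#}"] by simp

lemma subspace_weight_space: "subspace (weight_space m)"
  by (auto simp: subspace_def weight_space_def Y_add_right Y_scale_right scale_right_distrib mult.commute)

lemma weight_space_negative: "m < 0 \<Longrightarrow> v \<in> weight_space m \<Longrightarrow> v = 0"
  by (rule coeff_eqI) (auto simp: weight_space_iff)

lemma h_weight: "v \<in> weight_space m \<Longrightarrow> h i t v \<in> weight_space (m - t)"
  by (simp add: weight_space_def virasoro_h Y_scale_right scale_left_diff_distrib)

lemma Om_weight: "v \<in> weight_space m \<Longrightarrow> Om r s v \<in> weight_space (m - r - s)"
  unfolding Om_def
  by (intro subspace_sum[OF subspace_weight_space]) (metis h_weight diff_diff_eq add.commute)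

lemma quad_weight: "quad k l \<in> weight_space (int k + int l + 2)"
  using Om_weight[OF vac_weight, of "- int k - 1" "- int l - 1"]
  by (simp add: quad_def algebra_simps)

text \<open>With T v written as \<open>Y v (- 2) vac\<close>, this is the bracket [T, a(r)] = -r
  a(r-1).\<close>

lemma translation_mode: "Y (Y a r b) (- 2) vac = Y a r (Y b (- 2) vac) - scale (of_int r) (Y a (r - 1) b)"
proof -
  have "Y (Y a r b) (- 2) vac = (\<Sum>j<2. scale ((- 1) ^ j * ((of_int r :: complex) gchoose j))
        (Y a (r - int j) (Y b (- 2 + int j) vac)
          - scale ((- 1) powi r) (Y b (- 2 + r - int j) (Y a (int j) vac))))"
    by (rule Y_associativity) (auto simp: creation)
  then show ?thesis by (simp add: numeral_2_eq_2 creation scale_minus_left)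
qed

text \<open>L_{-1} and T have the same brackets with creation operators, and both kill
  \<open>vac\<close>.\<close>

lemma virasoro_translation: "Y virasoro 0 v = Y v (- 2) vac"
proof (induction v rule: fock_induct)
  case (creat x v)
  then show ?case
    unfolding creat_def translation_mode virasoro_h by simp
qed (auto simp: Y_add_right Y_scale_right Y_add_left Y_scale_left creation vacuum)

lemma Y_weight:
  assumes "a \<in> weight_space m" "b \<in> weight_space k"
  shows "Y a r b \<in> weight_space (m + k - r - 1)"
proof -
  obtain N where N: "\<forall>j\<ge>N. Y virasoro (0 + int j) a = 0"
    using Y_truncation_nat by blast
  have "Y virasoro 1 (Y a r b) - Y a r (Y virasoro 1 b)
      = (\<Sum>j<max N 2. scale ((of_int 1 :: complex) gchoose j) (Y (Y virasoro (int j) a) (1 + r - int j) b))"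
    by (rule Y_commutator) (use N in auto)
  \<comment> \<open>binom(1, j) leaves j = 0, which is translation, and j = 1, which is the weight
    of a.\<close>
  also have "\<dots> = (\<Sum>j<2. scale ((of_int 1 :: complex) gchoose j) (Y (Y virasoro (int j) a) (1 + r - int j) b))"
  proof (rule sum.mono_neutral_right)
    show "\<forall>j\<in>{..<max N 2} - {..<2}. scale (of_int 1 gchoose j) (Y (Y virasoro (int j) a) (1 + r - int j) b) = 0"
    proof
      fix j assume "j \<in> {..<max N 2} - {..<2}"
      then have "(of_nat 1 gchoose j :: complex) = 0" by (subst binomial_gbinomial[symmetric]) auto
      then show "scale (of_int 1 gchoose j) (Y (Y virasoro (int j) a) (1 + r - int j) b) = 0" by simp
    qed
  qed auto
  also have "\<dots> = Y (Y a (- int 1 - 1) vac) (1 + r) b + Y (Y virasoro 1 a) r b"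
    by (simp add: numeral_2_eq_2 virasoro_translation)
  also have "\<dots> = scale (of_int (m - r - 1)) (Y a r b)"
    using assms unfolding Y_derivative weight_space_def
    by (simp add: Y_scale_left algebra_simps scale_left_diff_distrib scale_minus_left)
  finally show ?thesis
    using assms(2) by (simp add: weight_space_def Y_scale_right algebra_simps scale_left_diff_distrib)
qed

definition proj :: "int \<Rightarrow> 'v \<Rightarrow> 'v" where
  "proj m = extend (\<lambda>\<mu>. if int (wt \<mu>) = m then fock \<mu> else 0)"

lemma coeff_proj: "coeff (proj m v) \<mu> = (if int (wt \<mu>) = m then coeff v \<mu> else 0)"
  unfolding proj_def
  by (induction v rule: linear_induct) (auto simp: extend_add extend_scale coeff_fock)

lemma proj_weight: "proj m v \<in> weight_space m"
  by (auto simp: weight_space_iff coeff_proj)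

lemma sum_proj: "\<exists>M. finite M \<and> v = (\<Sum>m\<in>M. proj m v)"
proof (intro exI conjI)
  let ?M = "(\<lambda>\<mu>. int (wt \<mu>)) ` {\<mu>. coeff v \<mu> \<noteq> 0}"
  show fin: "finite ?M" using finite_coeff by simp
  show "v = (\<Sum>m\<in>?M. proj m v)"
  proof (rule coeff_eqI)
    fix \<mu>
    have "coeff (\<Sum>m\<in>?M. proj m v) \<mu> = (\<Sum>m\<in>?M. if m = int (wt \<mu>) then coeff v \<mu> else 0)"
      unfolding coeff_sum coeff_proj by (rule sum.cong) auto
    also have "\<dots> = coeff v \<mu>" using fin by auto
    finally show "coeff v \<mu> = coeff (\<Sum>m\<in>?M. proj m v) \<mu>" ..
  qed
qed

lemma lift_weight:
  assumes "orthogonal_matrix A" "v \<in> weight_space m"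
  shows "lift A v \<in> weight_space m"
proof -
  have "lift A virasoro = virasoro"
    using quad_invariant assms(1) by (simp add: virasoro_quad orthogonal_invariants_iff)
  then have "Y virasoro 1 (lift A v) = lift A (Y virasoro 1 v)"
    by (simp add: lift_Y[OF assms(1)])
  then show ?thesis using assms(2) by (simp add: weight_space_def)
qed

lemma lift_proj:
  assumes "orthogonal_matrix A"
  shows "lift A (proj m v) = proj m (lift A v)"
proof (induction v rule: linear_induct)
  case (fock \<mu>)
  have "lift A (fock \<mu>) \<in> weight_space (int (wt \<mu>))"
    by (rule lift_weight[OF assms fock_weight])
  then have "proj m (lift A (fock \<mu>)) = (if int (wt \<mu>) = m then lift A (fock \<mu>) else 0)"
    by (intro coeff_eqI) (auto simp: coeff_proj weight_space_iff)
  then show ?case by (simp add: proj_def)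
qed (simp_all add: proj_def extend_add extend_scale)

lemma proj_invariant: "v \<in> orthogonal_invariants \<Longrightarrow> proj m v \<in> orthogonal_invariants"
  by (simp add: orthogonal_invariants_iff lift_proj)

lemma invariant_decomposition:
  assumes "v \<in> orthogonal_invariants"
  shows "\<exists>M c. finite M \<and> (\<forall>m\<in>M. c m \<in> invariant_weight_space m) \<and> v = (\<Sum>m\<in>M. c m)"
proof -
  obtain M where M: "finite M" "v = (\<Sum>m\<in>M. proj m v)" using sum_proj by blast
  show ?thesis
  proof (intro exI conjI ballI)
    show "finite M" by fact
    show "v = (\<Sum>m\<in>M. proj m v)" by fact
    show "proj m v \<in> invariant_weight_space m" for m
      by (simp add: invariant_weight_space_def proj_weight proj_invariant[OF assms])
  qed
qed

lemma subspace_invariant_weight_space: "subspace (invariant_weight_space m)"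
  unfolding invariant_weight_space_def
  by (intro subspace_inter subspace_invariants subspace_weight_space)

lemma Y_invariant_weight:
  "a \<in> invariant_weight_space m \<Longrightarrow> b \<in> invariant_weight_space k \<Longrightarrow>
    Y a r b \<in> invariant_weight_space (m + k - r - 1)"
  using vertex_subalgebra_orthogonal_invariants
  by (auto simp: invariant_weight_space_def vertex_subalgebra_def Y_weight)

lemma Om_invariant_weight:
  "v \<in> invariant_weight_space m \<Longrightarrow> Om r s v \<in> invariant_weight_space (m - r - s)"
  by (auto simp: invariant_weight_space_def Om_invariant Om_weight)

lemma quad_invariant_weight: "quad k l \<in> invariant_weight_space (int k + int l + 2)"
  by (simp add: invariant_weight_space_def quad_invariant quad_weight)

lemma vac_invariant_weight: "vac \<in> invariant_weight_space 0"
  by (simp add: invariant_weight_space_def vac_invariant vac_weight)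

section \<open>The Hermitian form and orthogonal projection\<close>

definition ip :: "'v \<Rightarrow> 'v \<Rightarrow> complex" where
  "ip u v = (\<Sum>\<mu>|coeff u \<mu> \<noteq> 0. cnj (coeff u \<mu>) * coeff v \<mu> * of_real (nrm \<mu>))"

lemma ip_eq:
  assumes "finite F" "{\<mu>. coeff u \<mu> \<noteq> 0} \<subseteq> F \<or> {\<mu>. coeff v \<mu> \<noteq> 0} \<subseteq> F"
  shows "ip u v = (\<Sum>\<mu>\<in>F. cnj (coeff u \<mu>) * coeff v \<mu> * of_real (nrm \<mu>))"
proof -
  have "ip u v = (\<Sum>\<mu>\<in>F \<union> {\<mu>. coeff u \<mu> \<noteq> 0}. cnj (coeff u \<mu>) * coeff v \<mu> * of_real (nrm \<mu>))"
    unfolding ip_def using finite_coeff assms(1) by (intro sum.mono_neutral_left) auto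
  also have "\<dots> = (\<Sum>\<mu>\<in>F. cnj (coeff u \<mu>) * coeff v \<mu> * of_real (nrm \<mu>))"
    using finite_coeff assms by (intro sum.mono_neutral_right) auto
  finally show ?thesis .
qed

lemma ip_right [simp]:
  "ip u (v + w) = ip u v + ip u w" "ip u (scale c v) = c * ip u v" "ip u 0 = 0"
  by (auto simp: ip_def algebra_simps sum.distrib sum_distrib_left)

lemma ip_diff_right [simp]: "ip u (v - w) = ip u v - ip u w"
  using ip_right(1)[of u "v - w" w] by simp

lemma ip_cnj: "ip u v = cnj (ip v u)"
  by (subst (1 2) ip_eq[of "{\<mu>. coeff u \<mu> \<noteq> 0}"]) (auto simp: finite_coeff mult.commute)

lemma ip_left [simp]:
  "ip (u + w) v = ip u v + ip w v" "ip (scale c u) v = cnj c * ip u v" "ip 0 v = 0"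
  using ip_cnj[of "u + w" v] ip_cnj[of "scale c u" v] ip_cnj[of u v] ip_cnj[of w v]
  by (simp_all add: ip_def[of 0])

lemma ip_sum_right [simp]: "ip u (sum f A) = (\<Sum>x\<in>A. ip u (f x))"
  by (induction A rule: infinite_finite_induct) auto

lemma ip_sum_left [simp]: "ip (sum f A) u = (\<Sum>x\<in>A. ip (f x) u)"
  by (induction A rule: infinite_finite_induct) auto

lemma ip_fock: "ip (fock \<mu>) (fock \<nu>) = (if \<mu> = \<nu> then of_real (nrm \<mu>) else 0)"
  by (subst ip_eq[of "{\<mu>}"]) (auto simp: coeff_fock)

lemma ip_creat: "ip (creat x u) v = ip u (annih x v)"
proof (induction u rule: linear_induct)
  case (fock \<mu>)
  show ?case
  proof (induction v rule: linear_induct)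
    case (fock \<nu>)
    show ?case
    proof (cases "x \<in># \<nu>")
      case True
      then obtain \<nu>' where "\<nu> = add_mset x \<nu>'" by (metis insert_DiffM)
      then show ?thesis
        by (auto simp: annih_fock ip_fock nrm_add simp del: fock_add simp flip: fock_add)
    next
      case False
      then have "add_mset x \<mu> \<noteq> \<nu>" by auto
      moreover have "annih x (fock \<nu>) = 0"
        using False by (simp add: annih_fock not_in_iff)
      ultimately show ?thesis by (simp add: ip_fock flip: fock_add)
    qed
  qed simp_all
qed simp_all

lemma ip_annih: "ip (annih x u) v = ip u (creat x v)"
  using ip_creat[of x v u] ip_cnj by metis

lemma ip_self: "ip v v = of_real (\<Sum>\<mu>|coeff v \<mu> \<noteq> 0. (cmod (coeff v \<mu>))\<^sup>2 * nrm \<mu>)"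
  unfolding ip_def of_real_sum
  by (rule sum.cong) (simp_all only: of_real_mult complex_norm_square mult_ac)

lemma Re_ip_nonneg: "Re (ip v v) \<ge> 0"
  unfolding ip_self Re_complex_of_real
  by (intro sum_nonneg mult_nonneg_nonneg) (auto simp: less_imp_le[OF nrm_pos])

lemma ip_self_eq_0: "Re (ip v v) = 0 \<longleftrightarrow> v = 0"
proof
  assume "Re (ip v v) = 0"
  then have "\<forall>\<mu>\<in>{\<mu>. coeff v \<mu> \<noteq> 0}. (cmod (coeff v \<mu>))\<^sup>2 * nrm \<mu> = 0"
    unfolding ip_self Re_complex_of_real
    by (subst (asm) sum_nonneg_eq_0_iff) (auto simp: finite_coeff less_imp_le[OF nrm_pos])
  then have "coeff v \<mu> = 0" for \<mu>
    using nrm_pos[of \<mu>] by auto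
  then show "v = 0" by (intro coeff_eqI) auto
qed simp

text \<open>Gram-Schmidt, one vector at a time: s is replaced by its residual s - p against the span
  of S, and T - b is then corrected along that residual.\<close>

lemma orthogonal_projection:
  assumes "finite S"
  shows "\<exists>b\<in>span S. \<forall>s\<in>span S. ip s (T - b) = 0"
proof -
  have "\<exists>b\<in>span S. \<forall>s\<in>S. ip s (T - b) = 0" for T
    using assms
  proof (induction S arbitrary: T)
    case empty
    then show ?case by auto
  next
    case (insert s S)
    obtain b where b: "b \<in> span S" "\<forall>s\<in>S. ip s (T - b) = 0" using insert by blast
    obtain p where p: "p \<in> span S" "\<forall>u\<in>S. ip u (s - p) = 0" using insert by blast
    have perp: "ip u (s - p) = 0" if "u \<in> span S" for u
      using that by (induction rule: span_induct_alt) (use p in auto)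
    have perpb: "ip u (T - b) = 0" if "u \<in> span S" for u
      using that by (induction rule: span_induct_alt) (use b in auto)
    have sp: "span S \<subseteq> span (insert s S)" by (rule span_mono) auto
    have sin: "s \<in> span (insert s S)" by (rule span_base) auto
    let ?d = "s - p"
    \<comment> \<open>If the residual is zero, division by zero gives c = 0, which still satisfies
      the next equation.\<close>
    define c where "c = ip ?d (T - b) / ip ?d ?d"
    have c: "c * ip ?d ?d = ip ?d (T - b)"
    proof (cases "?d = 0")
      case False
      then have "ip ?d ?d \<noteq> 0" using ip_self_eq_0[of ?d] by auto
      then show ?thesis by (simp add: c_def)
    qed simp
    show ?case
    proof (intro bexI ballI)
      show "b + scale c ?d \<in> span (insert s S)"
        using b p sp sin by (auto intro!: span_add span_scale span_diff)
      fix u assume "u \<in> insert s S"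
      then consider "u = s" | "u \<in> S" by blast
      then show "ip u (T - (b + scale c ?d)) = 0"
      proof cases
        case 1
        have "ip s (T - (b + scale c ?d)) = ip ?d (T - b - scale c ?d) + ip p (T - b) - c * ip p ?d"
          using ip_left(1)[of ?d p "T - b - scale c ?d"] by (simp add: algebra_simps)
        then show ?thesis
          using 1 c perp[OF p(1)] perpb[OF p(1)] by simp
      next
        case 2
        then show ?thesis
          using b perp[OF span_base[OF 2]] by (simp add: algebra_simps)
      qed
    qed
  qed
  then obtain b where b: "b \<in> span S" "\<forall>s\<in>S. ip s (T - b) = 0" by blast
  have "ip u (T - b) = 0" if "u \<in> span S" for u
    using that by (induction rule: span_induct_alt) (use b in auto)
  then show ?thesis using b by blast
qed

end

section \<open>The first fundamental theorem for the orthogonal group\<close>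

context heisenberg_vertex_algebra
begin

definition rotation :: "'n \<Rightarrow> 'n \<Rightarrow> complex \<Rightarrow> complex ^ 'n ^ 'n" where
  "rotation a b \<theta> = (\<chi> j i. if j = i then (if i = a \<or> i = b then cos \<theta> else 1)
     else if j = a \<and> i = b then - sin \<theta> else if j = b \<and> i = a then sin \<theta> else 0)"

lemma orthogonal_rotation:
  assumes "a \<noteq> b" shows "orthogonal_matrix (rotation a b \<theta>)"
proof -
  have cols: "(\<Sum>j\<in>UNIV. rotation a b \<theta> $ j $ i * rotation a b \<theta> $ j $ c) = (if i = c then 1 else 0)" for i c \<theta>
  proof -
    let ?f = "\<lambda>j. rotation a b \<theta> $ j $ i * rotation a b \<theta> $ j $ c"
    have sq: "cos \<theta> * cos \<theta> + sin \<theta> * sin \<theta> = 1"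
      using sin_cos_squared_add2[of \<theta>] by (simp add: power2_eq_square)
    have "sum ?f UNIV = ?f a + (?f b + sum ?f (UNIV - {a} - {b}))"
      using assms by (subst sum.remove[of UNIV a], simp, simp, subst sum.remove[of _ b]) auto
    also have "sum ?f (UNIV - {a} - {b}) = (\<Sum>j\<in>UNIV - {a} - {b}. if j = i then (if i = c then 1 else 0) else 0)"
      by (rule sum.cong) (auto simp: rotation_def)
    also have "\<dots> = (if i \<noteq> a \<and> i \<noteq> b \<and> i = c then 1 else 0)"
      by (subst sum.delta) auto
    finally have eq: "sum ?f UNIV = ?f a + (?f b + (if i \<noteq> a \<and> i \<noteq> b \<and> i = c then 1 else 0))" .
    consider "i = a" | "i = b" "i \<noteq> a" | "i \<noteq> a" "i \<noteq> b" by blast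
    then show ?thesis
    proof cases
      case 1
      then show ?thesis using assms sq unfolding eq by (cases "c = a"; cases "c = b") (simp_all add: rotation_def)
    next
      case 2
      then show ?thesis using assms sq unfolding eq
        by (cases "c = a"; cases "c = b") (simp_all add: rotation_def add.commute)
    next
      case 3
      then show ?thesis using assms unfolding eq by (simp add: rotation_def)
    qed
  qed
  have tr: "transpose (rotation a b \<theta>) = rotation a b (- \<theta>)"
    using assms by (auto simp: rotation_def transpose_def vec_eq_iff)
  have inv: "rotation a b (- \<theta>) ** rotation a b \<theta> = mat 1" for \<theta>
  proof -
    have "(rotation a b (- \<theta>) ** rotation a b \<theta>) $ i $ c = (if i = c then 1 else 0)" for i c
    proof -
      have "rotation a b (- \<theta>) $ i $ j = rotation a b \<theta> $ j $ i" for j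
        using assms by (simp add: rotation_def)
      then show ?thesis using cols[of \<theta> i c] by (simp add: matrix_matrix_mult_def)
    qed
    then show ?thesis by (simp add: vec_eq_iff mat_def)
  qed
  show ?thesis
    using inv[of \<theta>] inv[of "- \<theta>"] unfolding orthogonal_matrix_def tr by simp
qed

lemma rotation_0: "rotation a b 0 = mat 1"
  by (auto simp: rotation_def mat_def vec_eq_iff)

lemma DERIV_rotation:
  assumes "a \<noteq> b"
  shows "((\<lambda>\<theta>. rotation a b \<theta> $ j $ c) has_field_derivative
    ((if j = b \<and> c = a then 1 else 0) - (if j = a \<and> c = b then 1 else 0))) (at 0)"
proof -
  have cos': "(cos has_field_derivative (0::complex)) (at 0)" and sin': "(sin has_field_derivative (1::complex)) (at 0)"
    using DERIV_cos[of "0::complex"] DERIV_sin[of "0::complex"] by auto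
  consider "j = c" "c = a \<or> c = b" | "j = c" "c \<noteq> a" "c \<noteq> b" | "j = a" "c = b" | "j = b" "c = a" | "j \<noteq> c" "\<not> (j = a \<and> c = b)" "\<not> (j = b \<and> c = a)" by blast
  then show ?thesis
    using assms cos' sin' DERIV_minus[OF sin'] by cases (auto simp: rotation_def)
qed

lemma lift_mat_1 [simp]: "lift (mat 1) v = v"
proof (induction v rule: fock_induct)
  case (creat x v)
  have "lift (mat 1) (creat x v) = (\<Sum>j\<in>UNIV. if j = fst x then creat (j, snd x) v else 0)"
    unfolding lift_creat creat_image_def creat by (rule sum.cong) (auto simp: mat_def)
  then show ?case by simp
qed simp_all

text \<open>The cutoff K keeps the sum finite and loses nothing on vectors whose monomials satisfy
  \<open>bounded_modes K\<close>. The factors 1/(k+1) cancel the central terms, so that the operator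
  is the derivation replacing a variable of colour b by the one of colour a.\<close>

definition polar :: "nat \<Rightarrow> 'n \<Rightarrow> 'n \<Rightarrow> 'v \<Rightarrow> 'v" where
  "polar K a b v = (\<Sum>k<K. scale (1 / (of_nat k + 1)) (creat (a, k) (annih (b, k) v)))"

lemma polar_linear [simp]:
  "polar K a b (u + v) = polar K a b u + polar K a b v" "polar K a b (scale c v) = scale c (polar K a b v)"
  "polar K a b 0 = 0" "polar K a b (sum f A) = (\<Sum>x\<in>A. polar K a b (f x))"
  by (simp_all add: polar_def scale_right_distrib sum.distrib scale_sum_right mult.commute sum.swap[of _ A])

lemma of_nat_plus_1_neq_0: "of_nat k + 1 \<noteq> (0 :: complex)"
  by (metis of_nat_Suc of_nat_eq_0_iff nat.distinct(1) add.commute)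

lemma polar_creat:
  "polar K a b (creat (c, k) v) = creat (c, k) (polar K a b v) + (if b = c \<and> k < K then creat (a, k) v else 0)"
proof -
  have "polar K a b (creat (c, k) v) = (\<Sum>j<K. scale (1 / (of_nat j + 1)) (creat (c, k) (creat (a, j) (annih (b, j) v)))
      + (if j = k then (if b = c then creat (a, k) v else 0) else 0))"
    unfolding polar_def
    by (rule sum.cong) (auto simp: annih_creat scale_right_distrib of_nat_plus_1_neq_0 creat_commute)
  also have "\<dots> = creat (c, k) (polar K a b v) + (if b = c \<and> k < K then creat (a, k) v else 0)"
    by (auto simp: sum.distrib polar_def)
  finally show ?thesis .
qed

lemma polar_vac [simp]: "polar K a b vac = 0"
  by (simp add: polar_def)

lemma ip_polar: "ip (polar K a b u) v = ip u (polar K b a v)"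
  by (simp add: polar_def ip_creat ip_annih)

definition bounded_modes :: "nat \<Rightarrow> ('n \<times> nat) multiset \<Rightarrow> bool" where
  "bounded_modes K \<mu> \<longleftrightarrow> (\<forall>x\<in>#\<mu>. snd x < K)"

text \<open>The Fock space has no topology, so the derivative is tested by a linear functional l. It
  stays arbitrary in the induction because the product rule composes it with a creation
  operator.\<close>

lemma DERIV_lift_rotation_fock:
  fixes l :: "'v \<Rightarrow> complex"
  assumes "a \<noteq> b" "bounded_modes K \<mu>"
    and l: "\<And>u v. l (u + v) = l u + l v" "\<And>c v. l (scale c v) = c * l v"
  shows "((\<lambda>\<theta>. l (lift (rotation a b \<theta>) (fock \<mu>))) has_field_derivative
    l (polar K b a (fock \<mu>) - polar K a b (fock \<mu>))) (at 0)"
  using assms(2) l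
proof (induction \<mu> arbitrary: l)
  case empty
  have "l 0 = 0" using empty(3)[of 0 0] by simp
  then show ?case by simp
next
  case (add x \<mu>)
  obtain c k where x: "x = (c, k)" by fastforce
  let ?v = "fock \<mu>" and ?D = "polar K b a (fock \<mu>) - polar K a b (fock \<mu>)"
  let ?A = "\<lambda>j. (if j = b \<and> c = a then 1 else 0) - (if j = a \<and> c = b then 1 else 0) :: complex"
  have k: "k < K" and bd: "bounded_modes K \<mu>"
    using add.prems(1) by (auto simp: x bounded_modes_def)
  have l0: "l 0 = 0" using add.prems(3)[of 0 0] by simp
  have lsum: "l (sum f I) = (\<Sum>x\<in>I. l (f x))" for f and I :: "'n set"
    by (induction I rule: infinite_finite_induct) (auto simp: l0 add.prems(2))
  have ldiff: "l (u - v) = l u - l v" for u v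
    using add.prems(2)[of "u - v" v] by simp
  have fun_eq: "l (lift (rotation a b \<theta>) (fock (add_mset x \<mu>)))
      = (\<Sum>j\<in>UNIV. rotation a b \<theta> $ j $ c * l (creat (j, k) (lift (rotation a b \<theta>) ?v)))" for \<theta>
    by (simp add: x lift_creat creat_image_def lsum add.prems(3))
  have "((\<lambda>\<theta>. rotation a b \<theta> $ j $ c * l (creat (j, k) (lift (rotation a b \<theta>) ?v))) has_field_derivative
      (?A j * l (creat (j, k) ?v) + (if j = c then 1 else 0) * l (creat (j, k) ?D))) (at 0)" for j
  proof -
    have "((\<lambda>\<theta>. (\<lambda>u. l (creat (j, k) u)) (lift (rotation a b \<theta>) ?v)) has_field_derivative
      (\<lambda>u. l (creat (j, k) u)) ?D) (at 0)"
      by (rule add.IH[OF bd, of "\<lambda>u. l (creat (j, k) u)"]) (simp_all only: creat_linear add.prems(2,3))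
    then have "((\<lambda>\<theta>. rotation a b \<theta> $ j $ c * l (creat (j, k) (lift (rotation a b \<theta>) ?v))) has_field_derivative
      (?A j * l (creat (j, k) (lift (rotation a b 0) ?v)) + l (creat (j, k) ?D) * rotation a b 0 $ j $ c)) (at 0)"
      by (rule DERIV_mult[OF DERIV_rotation[OF assms(1)]])
    moreover have "rotation a b 0 $ j $ c = (if j = c then 1 else 0)"
      by (simp add: rotation_0 mat_def)
    ultimately show ?thesis
      by (simp only: rotation_0 lift_mat_1 mult.commute[of "l (creat (j, k) ?D)"])
  qed
  then have "((\<lambda>\<theta>. l (lift (rotation a b \<theta>) (fock (add_mset x \<mu>)))) has_field_derivative
      (\<Sum>j\<in>UNIV. ?A j * l (creat (j, k) ?v) + (if j = c then 1 else 0) * l (creat (j, k) ?D))) (at 0)"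
    unfolding fun_eq by (rule DERIV_sum)
  moreover have "(\<Sum>j\<in>UNIV. ?A j * l (creat (j, k) ?v) + (if j = c then 1 else 0) * l (creat (j, k) ?D))
      = l (polar K b a (fock (add_mset x \<mu>)) - polar K a b (fock (add_mset x \<mu>)))"
  proof -
    have "?A j * l (creat (j, k) ?v) = (if j = b then if c = a then l (creat (b, k) ?v) else 0 else 0)
        - (if j = a then if c = b then l (creat (a, k) ?v) else 0 else 0)" for j
      by auto
    moreover have "(if j = c then 1 else 0) * l (creat (j, k) ?D) = (if j = c then l (creat (c, k) ?D) else 0)" for j
      by simp
    ultimately have "(\<Sum>j\<in>UNIV. ?A j * l (creat (j, k) ?v) + (if j = c then 1 else 0) * l (creat (j, k) ?D))
      = (if c = a then l (creat (b, k) ?v) else 0) - (if c = b then l (creat (a, k) ?v) else 0) + l (creat (c, k) ?D)"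
      by (simp only: sum.distrib sum_subtractf) simp
    also have "\<dots> = l (polar K b a (fock (add_mset x \<mu>)) - polar K a b (fock (add_mset x \<mu>)))"
      using k by (auto simp: x polar_creat add.prems(2) ldiff l0)
    finally show ?thesis .
  qed
  ultimately show ?case by simp
qed

text \<open>Coefficients of the rotated invariant are constant in the angle, and their derivative at
  0 is the difference of the two polarizations.\<close>

lemma polar_invariant_commute:
  assumes t: "t \<in> orthogonal_invariants" "\<And>\<mu>. coeff t \<mu> \<noteq> 0 \<Longrightarrow> bounded_modes K \<mu>"
  shows "polar K b a t = polar K a b t"
proof (cases "a = b")
  case False
  have "polar K b a t - polar K a b t = 0"
  proof (rule coeff_eqI)
    fix \<nu>
    let ?S = "{\<mu>. coeff t \<mu> \<noteq> 0}"
    let ?l = "\<lambda>v. coeff v \<nu>"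
    have minus: "coeff (u - v) \<nu> = coeff u \<nu> - coeff v \<nu>" for u v
      using coeff_add[of "u - v" v \<nu>] by simp
    have exp: "t = (\<Sum>\<mu>\<in>?S. scale (coeff t \<mu>) (fock \<mu>))"
      by (rule coeff_expansion[symmetric]) (auto simp: finite_coeff)
    have "((\<lambda>\<theta>. \<Sum>\<mu>\<in>?S. coeff t \<mu> * ?l (lift (rotation a b \<theta>) (fock \<mu>))) has_field_derivative
        (\<Sum>\<mu>\<in>?S. coeff t \<mu> * ?l (polar K b a (fock \<mu>) - polar K a b (fock \<mu>)))) (at 0)"
      by (intro DERIV_sum DERIV_cmult DERIV_lift_rotation_fock False) (auto simp: t)
    moreover have "(\<Sum>\<mu>\<in>?S. coeff t \<mu> * ?l (lift (rotation a b \<theta>) (fock \<mu>))) = ?l t" for \<theta>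
    proof -
      have "?l t = ?l (lift (rotation a b \<theta>) t)"
        using t(1) orthogonal_rotation[OF False] by (simp add: orthogonal_invariants_iff)
      also have "\<dots> = (\<Sum>\<mu>\<in>?S. coeff t \<mu> * ?l (lift (rotation a b \<theta>) (fock \<mu>)))"
        by (subst (1) exp) simp
      finally show ?thesis ..
    qed
    moreover have "(\<Sum>\<mu>\<in>?S. coeff t \<mu> * ?l (polar K b a (fock \<mu>) - polar K a b (fock \<mu>)))
        = ?l (polar K b a t - polar K a b t)"
    proof -
      have "?l (polar K b a t - polar K a b t) = ?l (polar K b a (\<Sum>\<mu>\<in>?S. scale (coeff t \<mu>) (fock \<mu>))
          - polar K a b (\<Sum>\<mu>\<in>?S. scale (coeff t \<mu>) (fock \<mu>)))"
        using exp by simp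
      then show ?thesis by (simp add: minus sum_subtractf right_diff_distrib)
    qed
    ultimately have "((\<lambda>\<theta>. ?l t) has_field_derivative ?l (polar K b a t - polar K a b t)) (at 0)"
      by simp
    then show "?l (polar K b a t - polar K a b t) = coeff 0 \<nu>"
      using DERIV_unique[OF _ DERIV_const] by fastforce
  qed
  then show ?thesis by simp
qed simp

definition occ :: "'n \<Rightarrow> ('n \<times> nat) multiset \<Rightarrow> nat" where
  "occ a \<mu> = size (filter_mset (\<lambda>x. fst x = a) \<mu>)"

lemma occ_simps [simp]: "occ a {#} = 0" "occ a (add_mset x \<mu>) = (if fst x = a then 1 else 0) + occ a \<mu>"
  by (simp_all add: occ_def)

definition reflection :: "'n \<Rightarrow> complex ^ 'n ^ 'n" where
  "reflection a = (\<chi> j i. if j = i then (if i = a then - 1 else 1) else 0)"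

lemma orthogonal_reflection: "orthogonal_matrix (reflection a)"
proof -
  have tr: "transpose (reflection a) = reflection a"
    by (auto simp: reflection_def transpose_def vec_eq_iff)
  have "(\<Sum>k\<in>UNIV. reflection a $ i $ k * reflection a $ k $ j) = (\<Sum>k\<in>UNIV. if k = i then (if i = j then 1 else 0) else 0)" for i j
    by (rule sum.cong) (auto simp: reflection_def)
  then show ?thesis
    unfolding orthogonal_matrix_def tr by (simp add: vec_eq_iff matrix_matrix_mult_def mat_def)
qed

lemma lift_reflection_fock: "lift (reflection a) (fock \<mu>) = scale ((- 1) ^ occ a \<mu>) (fock \<mu>)"
proof (induction \<mu>)
  case (add x \<mu>)
  have "creat_image (reflection a) x v = (\<Sum>j\<in>UNIV. if j = fst x then scale (if fst x = a then - 1 else 1) (creat x v) else 0)" for v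
    unfolding creat_image_def by (rule sum.cong) (auto simp: reflection_def)
  then show ?case by (simp add: lift_creat add)
qed simp

lemma coeff_lift_reflection: "coeff (lift (reflection a) v) \<mu> = (- 1) ^ occ a \<mu> * coeff v \<mu>"
  by (induction v rule: linear_induct) (auto simp: lift_reflection_fock coeff_fock algebra_simps)

lemma even_occ:
  assumes "t \<in> orthogonal_invariants" "coeff t \<mu> \<noteq> 0"
  shows "even (occ a \<mu>)"
proof (rule ccontr)
  assume "odd (occ a \<mu>)"
  then have "coeff t \<mu> = - coeff t \<mu>"
    using coeff_lift_reflection[of a t \<mu>] assms(1) orthogonal_reflection
    by (simp add: orthogonal_invariants_iff)
  then show False using assms(2) by simp
qed

lemma polar_fock: "bounded_modes K \<mu> \<Longrightarrow> polar K a a (fock \<mu>) = scale (of_nat (occ a \<mu>)) (fock \<mu>)"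
proof (induction \<mu>)
  case (add x \<mu>)
  obtain c k where x: "x = (c, k)" by fastforce
  then show ?case using add by (auto simp: bounded_modes_def polar_creat scale_left_distrib)
qed simp

lemma coeff_polar:
  assumes "\<And>\<mu>. coeff t \<mu> \<noteq> 0 \<Longrightarrow> bounded_modes K \<mu>"
  shows "coeff (polar K a a t) \<nu> = of_nat (occ a \<nu>) * coeff t \<nu>"
proof -
  let ?S = "{\<mu>. coeff t \<mu> \<noteq> 0}"
  have exp: "t = (\<Sum>\<mu>\<in>?S. scale (coeff t \<mu>) (fock \<mu>))"
    by (rule coeff_expansion[symmetric]) (auto simp: finite_coeff)
  have "coeff (polar K a a (\<Sum>\<mu>\<in>?S. scale (coeff t \<mu>) (fock \<mu>))) \<nu>
      = (\<Sum>\<mu>\<in>?S. if \<mu> = \<nu> then of_nat (occ a \<nu>) * coeff t \<nu> else 0)"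
    by (simp only: polar_linear coeff_sum, rule sum.cong) (auto simp: polar_fock assms coeff_fock)
  then show ?thesis using exp by (auto simp: finite_coeff)
qed

text \<open>Normal ordering each E_ab E_ab leaves creation operators applied to a term that sums
  over b to a Laplacian of t, plus a contraction that occurs only for b = a and gives E_aa.\<close>

lemma sum_polar_polar:
  assumes harmonic: "\<And>k l. Om (int k + 1) (int l + 1) t = 0"
  shows "(\<Sum>b\<in>UNIV. polar K a b (polar K a b t)) = polar K a a t"
proof -
  let ?c = "\<lambda>k::nat. 1 / (of_nat k + 1) :: complex"
  have rel: "annih (b, k) (creat (a, l) w) = creat (a, l) (annih (b, k) w)
      + (if b = a then (if k = l then scale (of_nat k + 1) w else 0) else 0)" for b k l w
    by (simp add: annih_creat)
  let ?w = "\<lambda>b k l. creat (a, k) (creat (a, l) (annih (b, k) (annih (b, l) t)))"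
  let ?d = "\<lambda>b k l. if b = a then if l = k then scale (?c k) (creat (a, k) (annih (a, k) t)) else 0 else 0"
  have summand: "scale (?c k) (creat (a, k) (annih (b, k) (scale (?c l) (creat (a, l) (annih (b, l) t)))))
      = scale (?c k * ?c l) (?w b k l) + ?d b k l" for b k l
    by (auto simp: rel scale_right_distrib of_nat_plus_1_neq_0)
  have "(\<Sum>b\<in>UNIV. polar K a b (polar K a b t))
      = (\<Sum>b\<in>UNIV. \<Sum>k<K. \<Sum>l<K. scale (?c k * ?c l) (?w b k l) + ?d b k l)"
    unfolding summand[symmetric] by (simp add: polar_def scale_sum_right)
  also have "\<dots> = (\<Sum>b\<in>UNIV. \<Sum>k<K. \<Sum>l<K. scale (?c k * ?c l) (?w b k l))
      + (\<Sum>b\<in>UNIV. \<Sum>k<K. \<Sum>l<K. ?d b k l)"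
    by (simp only: sum.distrib)
  also have "(\<Sum>b\<in>UNIV. \<Sum>k<K. \<Sum>l<K. ?d b k l)
      = (\<Sum>b\<in>UNIV. if b = a then polar K a a t else 0)"
    by (rule sum.cong) (auto simp: polar_def)
  also have "\<dots> = polar K a a t" by simp
  also have "(\<Sum>b\<in>UNIV. \<Sum>k<K. \<Sum>l<K. scale (?c k * ?c l)
      (creat (a, k) (creat (a, l) (annih (b, k) (annih (b, l) t)))))
    = (\<Sum>k<K. \<Sum>l<K. scale (?c k * ?c l) (creat (a, k) (creat (a, l) (Om (int k + 1) (int l + 1) t))))"
    by (subst sum.swap, rule sum.cong[OF refl], subst sum.swap)
      (simp add: Om_def annih_def scale_sum_right)
  finally show ?thesis by (simp add: harmonic)
qed

lemma harmonic_invariant_eq_0: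
  assumes t: "t \<in> invariant_weight_space m" "m > 0"
    and harmonic: "\<And>k l. Om (int k + 1) (int l + 1) t = 0"
  shows "t = 0"
proof -
  \<comment> \<open>A variable with index k has weight k+1, so monomials of weight m only use
    indices below m.\<close>
  define K where "K = nat m"
  have inv: "t \<in> orthogonal_invariants" and wtm: "t \<in> weight_space m"
    using t by (auto simp: invariant_weight_space_def)
  have "snd x < wt \<mu>" if "x \<in># \<mu>" for x :: "'n \<times> nat" and \<mu>
    using that by (induction \<mu>) auto
  then have bd: "bounded_modes K \<mu>" if "coeff t \<mu> \<noteq> 0" for \<mu>
    using that wtm by (auto simp: bounded_modes_def K_def weight_space_iff)
  have "annih (a, k) t = 0" if "k < K" for a k
  proof -
    define R where "R = Re (ip t (polar K a a t))"
    have R_sum: "R = (\<Sum>k<K. Re (ip (annih (a, k) t) (annih (a, k) t)) / (real k + 1))"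
    proof -
      have "ip t (creat (a, k) w) = ip (annih (a, k) t) w" for k w
        by (simp add: ip_annih)
      moreover have "(1 / (complex_of_nat k + 1)) = of_real (1 / (real k + 1))" for k
        by simp
      ultimately show ?thesis
        unfolding R_def polar_def by (simp only: ip_right ip_sum_right Re_sum) simp
    qed
    have upper: "Re (ip (polar K a a t) (polar K a a t)) \<le> R"
    proof -
      have "Re (ip (polar K a a t) (polar K a a t)) \<le> (\<Sum>b\<in>UNIV. Re (ip (polar K b a t) (polar K b a t)))"
        by (rule member_le_sum) (auto simp: Re_ip_nonneg)
      also have "\<dots> = (\<Sum>b\<in>UNIV. Re (ip t (polar K a b (polar K a b t))))"
      proof (rule sum.cong)
        fix b
        have "polar K b a t = polar K a b t"
          by (rule polar_invariant_commute[OF inv bd])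
        then show "Re (ip (polar K b a t) (polar K b a t)) = Re (ip t (polar K a b (polar K a b t)))"
          unfolding ip_polar by (rule arg_cong)
      qed simp
      also have "\<dots> = R"
        unfolding R_def sum_polar_polar[OF harmonic, symmetric] ip_sum_right Re_sum ..
      finally show ?thesis .
    qed
    have lower: "2 * R \<le> Re (ip (polar K a a t) (polar K a a t))"
    proof -
      let ?S = "{\<mu>. coeff t \<mu> \<noteq> 0}"
      have cp: "coeff (polar K a a t) \<nu> = of_nat (occ a \<nu>) * coeff t \<nu>" for \<nu>
        by (rule coeff_polar) (rule bd)
      have Re1: "Re (cnj z * (of_nat n * z) * of_real r) = real n * ((cmod z)\<^sup>2 * r)" for z n r
      proof -
        have "cnj z * (of_nat n * z) * of_real r = of_real (real n * ((cmod z)\<^sup>2 * r))"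
          by (simp only: of_real_mult complex_norm_square of_real_of_nat_eq mult_ac)
        then show ?thesis by (simp only: Re_complex_of_real)
      qed
      have Re2: "Re (cnj (of_nat n * z) * (of_nat n * z) * of_real r) = (real n)\<^sup>2 * ((cmod z)\<^sup>2 * r)" for z n r
      proof -
        have "cnj (of_nat n * z) * (of_nat n * z) * of_real r = of_real ((real n)\<^sup>2 * ((cmod z)\<^sup>2 * r))"
          by (simp only: power2_eq_square[of "real n"] of_real_mult complex_norm_square of_real_of_nat_eq
              complex_cnj_mult complex_cnj_of_nat mult_ac)
        then show ?thesis by (simp only: Re_complex_of_real)
      qed
      have "R = (\<Sum>\<mu>\<in>?S. real (occ a \<mu>) * ((cmod (coeff t \<mu>))\<^sup>2 * nrm \<mu>))"
        unfolding R_def ip_def Re_sum cp Re1 ..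
      moreover have "Re (ip (polar K a a t) (polar K a a t))
          = (\<Sum>\<mu>\<in>?S. (real (occ a \<mu>))\<^sup>2 * ((cmod (coeff t \<mu>))\<^sup>2 * nrm \<mu>))"
      proof -
        have "ip (polar K a a t) (polar K a a t) = (\<Sum>\<mu>\<in>?S. cnj (coeff (polar K a a t) \<mu>)
            * coeff (polar K a a t) \<mu> * of_real (nrm \<mu>))"
          by (rule ip_eq) (auto simp: finite_coeff cp)
        then show ?thesis unfolding cp by (simp only: Re_sum Re2)
      qed
      moreover have "2 * (real (occ a \<mu>) * ((cmod (coeff t \<mu>))\<^sup>2 * nrm \<mu>))
          \<le> (real (occ a \<mu>))\<^sup>2 * ((cmod (coeff t \<mu>))\<^sup>2 * nrm \<mu>)" if "\<mu> \<in> ?S" for \<mu>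
      proof -
        have "even (occ a \<mu>)" using even_occ[OF inv] that by auto
        then have "occ a \<mu> = 0 \<or> 2 \<le> occ a \<mu>" by presburger
        then have "2 * real (occ a \<mu>) \<le> (real (occ a \<mu>))\<^sup>2" by (auto simp: power2_eq_square)
        then show ?thesis
          using mult_right_mono[of "2 * real (occ a \<mu>)" _ "(cmod (coeff t \<mu>))\<^sup>2 * nrm \<mu>"] nrm_pos[of \<mu>]
          by (simp add: mult.assoc less_imp_le)
      qed
      ultimately show ?thesis by (simp only: sum_distrib_left sum_mono)
    qed
    have "R \<ge> 0" unfolding R_sum by (intro sum_nonneg divide_nonneg_nonneg Re_ip_nonneg) auto
    with upper lower have "R = 0" by linarith
    then have "\<forall>k\<in>{..<K}. Re (ip (annih (a, k) t) (annih (a, k) t)) / (real k + 1) = 0"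
      unfolding R_sum by (subst (asm) sum_nonneg_eq_0_iff) (auto intro!: divide_nonneg_nonneg Re_ip_nonneg)
    then have "Re (ip (annih (a, k) t) (annih (a, k) t)) = 0" using \<open>k < K\<close> by (auto simp: add_eq_0_iff)
    then show ?thesis by (simp add: ip_self_eq_0)
  qed
  then have kill: "annih x t = 0" if "snd x < K" for x
    using that by (cases x) auto
  \<comment> \<open>As m > 0, every monomial of t contains a variable; moved across the form it
    becomes an annihilator acting on t. So t is orthogonal to its own monomials.\<close>
  have "ip (fock \<mu>) t = 0" if "coeff t \<mu> \<noteq> 0" for \<mu>
  proof -
    have "\<mu> \<noteq> {#}" using that wtm t(2) by (auto simp: weight_space_iff)
    then obtain x \<mu>' where \<mu>: "\<mu> = add_mset x \<mu>'" by (meson multiset_cases)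
    moreover have "snd x < K" using bd[OF that] by (simp add: \<mu> bounded_modes_def)
    ultimately show ?thesis by (simp add: ip_creat kill)
  qed
  moreover have "ip t t = ip (\<Sum>\<mu>|coeff t \<mu> \<noteq> 0. scale (coeff t \<mu>) (fock \<mu>)) t"
    by (subst coeff_expansion) (auto simp: finite_coeff)
  ultimately have "ip t t = 0" by simp
  then show ?thesis using ip_self_eq_0[of t] by simp
qed

section \<open>Products of quadratics span the invariants\<close>

definition qprod :: "(nat \<times> nat) list \<Rightarrow> 'v" where
  "qprod xs = foldr (\<lambda>x. Om (- int (fst x) - 1) (- int (snd x) - 1)) xs vac"

definition qwt :: "(nat \<times> nat) list \<Rightarrow> nat" where
  "qwt xs = (\<Sum>x\<leftarrow>xs. fst x + snd x + 2)"

lemma qprod_simps [simp]: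
  "qprod [] = vac" "qprod (x # xs) = Om (- int (fst x) - 1) (- int (snd x) - 1) (qprod xs)"
  by (simp_all add: qprod_def)

lemma qwt_simps [simp]: "qwt [] = 0" "qwt (x # xs) = fst x + snd x + 2 + qwt xs"
  by (simp_all add: qwt_def)

lemma qprod_weight: "qprod xs \<in> invariant_weight_space (int (qwt xs))"
proof (induction xs)
  case (Cons x xs)
  then show ?case
    using Om_invariant_weight[OF Cons, of "- int (fst x) - 1" "- int (snd x) - 1"] by (simp add: algebra_simps)
qed (simp add: vac_invariant_weight)

definition qspan :: "int \<Rightarrow> 'v set" where
  "qspan m = span (qprod ` {xs. int (qwt xs) = m})"

lemma qspan_subset: "qspan m \<subseteq> invariant_weight_space m"
  unfolding qspan_def
  by (rule span_minimal) (use qprod_weight subspace_invariant_weight_space in auto)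

lemma Om_qspan: "v \<in> qspan m \<Longrightarrow> Om (- int k - 1) (- int l - 1) v \<in> qspan (m + int k + int l + 2)"
  unfolding qspan_def
proof (induction rule: span_induct_alt)
  case (step c x y)
  then obtain xs where xs: "x = qprod xs" "int (qwt xs) = m" by auto
  have "Om (- int k - 1) (- int l - 1) x = qprod ((k, l) # xs)" "int (qwt ((k, l) # xs)) = m + int k + int l + 2"
    using xs by simp_all
  then have "Om (- int k - 1) (- int l - 1) x \<in> span (qprod ` {xs. int (qwt xs) = m + int k + int l + 2})"
    by (metis (mono_tags, lifting) imageI mem_Collect_eq span_base)
  then show ?case using step by (auto intro!: span_add span_scale)
qed (simp add: span_zero)

lemma ip_Om: "ip (Om r s u) v = ip u (Om (- s) (- r) v)"
proof -
  have "ip (h i r u) v = ip u (h i (- r) v)" for i r u v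
  proof -
    consider "r < 0" | "r = 0" | "r > 0" by linarith
    then show ?thesis
    proof cases
      case 1
      then show ?thesis using ip_creat[of "(i, nat (- r - 1))" u v] by (simp add: creat_def annih_def)
    next
      case 3
      then show ?thesis using ip_annih[of "(i, nat (r - 1))" u v] by (simp add: creat_def annih_def)
    qed simp
  qed
  then show ?thesis by (simp add: Om_def)
qed

lemma finite_wt: "finite {\<mu>::('n \<times> nat) multiset. wt \<mu> = m}"
proof -
  let ?X = "(UNIV :: 'n set) \<times> {..<m}"
  have small: "snd x < wt \<mu>" if "x \<in># \<mu>" for x :: "'n \<times> nat" and \<mu>
    using that by (induction \<mu>) auto
  have size: "size \<mu> \<le> wt \<mu>" for \<mu> :: "('n \<times> nat) multiset"
    by (induction \<mu>) auto
  have "{\<mu>::('n \<times> nat) multiset. wt \<mu> = m} \<subseteq> mset ` {xs. set xs \<subseteq> ?X \<and> length xs \<le> m}"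
  proof
    fix \<mu> :: "('n \<times> nat) multiset" assume "\<mu> \<in> {\<mu>. wt \<mu> = m}"
    moreover obtain xs where "\<mu> = mset xs" using ex_mset by metis
    ultimately show "\<mu> \<in> mset ` {xs. set xs \<subseteq> ?X \<and> length xs \<le> m}"
      using small[of _ \<mu>] size[of \<mu>] by (intro image_eqI[of _ _ xs]) (auto simp: mem_Times_iff)
  qed
  moreover have "finite {xs. set xs \<subseteq> ?X \<and> length xs \<le> m}"
    by (rule finite_lists_length_le) simp
  ultimately show ?thesis by (meson finite_imageI finite_subset)
qed

text \<open>Weight spaces are finite-dimensional; this supplies the finite spanning set that
  \<open>orthogonal_projection\<close> asks for.\<close>

lemma finite_basis_subspace:
  assumes "U \<subseteq> weight_space m" "subspace U"
  shows "\<exists>S. finite S \<and> span S = U"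
proof -
  let ?F = "fock ` {\<mu>. wt \<mu> = nat m}"
  have fin: "finite ?F" using finite_wt by blast
  obtain B where B: "B \<subseteq> U" "independent B" "U \<subseteq> span B"
    using basis_exists[of U] by metis
  have "weight_space m \<subseteq> span ?F"
  proof
    fix v assume v: "v \<in> weight_space m"
    have "v = (\<Sum>\<mu>|coeff v \<mu> \<noteq> 0. scale (coeff v \<mu>) (fock \<mu>))"
      by (rule coeff_expansion[symmetric]) (auto simp: finite_coeff)
    also have "\<dots> \<in> span ?F"
      using v by (intro span_sum span_scale span_base) (auto simp: weight_space_iff)
    finally show "v \<in> span ?F" .
  qed
  then have "B \<subseteq> span ?F" using B(1) assms(1) by blast
  then have "finite B" using independent_span_bound[OF fin B(2)] by simp
  moreover have "span B = U" using B span_minimal[OF B(1) assms(2)] by blast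
  ultimately show ?thesis by blast
qed

theorem invariant_weight_space_eq_qspan: "invariant_weight_space m = qspan m"
proof (rule antisym[OF _ qspan_subset])
  show "invariant_weight_space m \<subseteq> qspan m"
  proof (induction "nat m" arbitrary: m rule: less_induct)
    case less
    show ?case
    proof
      fix T assume T: "T \<in> invariant_weight_space m"
      have W: "T \<in> weight_space m" using T by (simp add: invariant_weight_space_def)
      consider "m < 0" | "m = 0" | "m > 0" by linarith
      then show "T \<in> qspan m"
      proof cases
        case 1
        then show ?thesis using weight_space_negative[OF 1 W] by (simp add: qspan_def span_zero)
      next
        case 2
        have "wt \<mu> = 0 \<Longrightarrow> \<mu> = {#}" for \<mu> :: "('n \<times> nat) multiset"
          by (cases \<mu>) auto
        then have "T = scale (coeff T {#}) (fock {#})"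
          using W 2 by (intro coeff_eqI) (auto simp: coeff_fock weight_space_iff simp del: fock_empty)
        moreover have "qprod [] \<in> qspan m"
          unfolding qspan_def by (rule span_base) (use 2 in \<open>auto intro!: image_eqI[of _ _ "[]"]\<close>)
        ultimately show ?thesis unfolding qspan_def by (metis span_scale qprod_simps(1) fock_empty)
      next
        case 3
        obtain S where S: "finite S" "span S = qspan m"
          using finite_basis_subspace[of "qspan m" m] qspan_subset[of m]
          by (force simp: qspan_def invariant_weight_space_def)
        obtain b where b: "b \<in> qspan m" "\<forall>s\<in>qspan m. ip s (T - b) = 0"
          using orthogonal_projection[OF S(1), of T] unfolding S(2) by blast
        have t: "T - b \<in> invariant_weight_space m"
          using T b(1) qspan_subset subspace_diff[OF subspace_invariant_weight_space] by blast
        have "Om (int k + 1) (int l + 1) (T - b) = 0" for k l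
        proof -
          let ?u = "Om (int k + 1) (int l + 1) (T - b)"
          let ?m = "m - int k - int l - 2"
          have "?u \<in> invariant_weight_space ?m"
            using Om_invariant_weight[OF t, of "int k + 1" "int l + 1"] by (simp add: algebra_simps)
          \<comment> \<open>By induction \<open>?u\<close> is a combination of products of lower
            weight, so a quadratic applied to it lies in \<open>qspan m\<close> and is orthogonal to
            T - b. Moving that quadratic across the form leaves the norm of
            \<open>?u\<close>.\<close>
          then have "?u \<in> qspan ?m" using less[of ?m] 3 by auto
          then have "Om (- int l - 1) (- int k - 1) ?u \<in> qspan (?m + int l + int k + 2)"
            by (rule Om_qspan)
          then have "ip (Om (- int l - 1) (- int k - 1) ?u) (T - b) = 0"
            using b(2) by (simp add: algebra_simps)
          moreover have "- (- int k - 1) = int k + 1" "- (- int l - 1) = int l + 1" by simp_all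
          ultimately have "ip ?u ?u = 0"
            by (simp only: ip_Om)
          then show ?thesis using ip_self_eq_0[of ?u] by simp
        qed
        then have "T - b = 0" by (rule harmonic_invariant_eq_0[OF t 3])
        then show ?thesis using b(1) by simp
      qed
    qed
  qed
qed

end

section \<open>Modes of the quadratic invariants\<close>

definition fdiff :: "(nat \<Rightarrow> complex) \<Rightarrow> nat \<Rightarrow> complex" where
  "fdiff g y = g (y + 1) - g y"

lemma fdiff_funpow_linear: "(fdiff ^^ s) (\<lambda>y. a * g y + b * h y) y = a * (fdiff ^^ s) g y + b * (fdiff ^^ s) h y"
proof (induction s arbitrary: y)
  case (Suc s)
  then show ?case by (simp add: fdiff_def algebra_simps)
qed simp

text \<open>By Pascal's rule one difference lowers the binomial by one degree; at y = 0 this makes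
  the binomials dual to the iterated differences.\<close>

lemma fdiff_funpow_gbinomial:
  "(fdiff ^^ s) (\<lambda>y. of_nat y gchoose l) y = (if s \<le> l then of_nat y gchoose (l - s) else 0)"
proof (induction s arbitrary: y)
  case (Suc s)
  have "(fdiff ^^ Suc s) (\<lambda>y. of_nat y gchoose l) y
      = (if s \<le> l then of_nat (y + 1) gchoose (l - s) else 0) - (if s \<le> l then of_nat y gchoose (l - s) else 0)"
    by (simp add: fdiff_def Suc)
  also have "\<dots> = (if Suc s \<le> l then of_nat y gchoose (l - Suc s) else 0)"
  proof (cases "Suc s \<le> l")
    case True
    then have "l - s = Suc (l - Suc s)" by simp
    then show ?thesis
      using True gbinomial_Suc_Suc[of "of_nat y :: complex" "l - Suc s"] by (simp add: add.commute)
  qed (cases "s = l", auto)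
  finally show ?case .
qed simp

text \<open>This is \<open>quad_coeff\<close> at the zero mode m = k+l+1 with the factor t
  removed.\<close>

definition symbol :: "nat \<Rightarrow> nat \<Rightarrow> int \<Rightarrow> complex" where
  "symbol k l t = (of_int t - 1 gchoose k) * (- of_int t - 1 gchoose l)"

lemma symbol_minus: "symbol k l (- t) = symbol l k t"
  by (simp add: symbol_def)

text \<open>Mirrors the translate of \<open>quad k l\<close>, which is (k+1)
  \<open>quad (Suc k) l\<close> + (l+1) \<open>quad k (Suc l)\<close> and whose zero mode is
  -(k+l+2) times that of \<open>quad k l\<close>. It allows the first index to be lowered to
  0.\<close>

lemma symbol_Suc:
  "(of_nat k + 1) * symbol (Suc k) l t = - (of_nat k + of_nat l + 2) * symbol k l t - (of_nat l + 1) * symbol k (Suc l) t"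
proof -
  have rec: "(of_nat k + 1) * (z gchoose Suc k) = (z - of_nat k) * (z gchoose k)" for z :: complex and k
    using gbinomial_mult_1[of z k] by (simp add: algebra_simps)
  have "(of_nat k + 1) * symbol (Suc k) l t + (of_nat l + 1) * symbol k (Suc l) t
      = ((of_nat k + 1) * (of_int t - 1 gchoose Suc k)) * (- of_int t - 1 gchoose l)
      + (of_int t - 1 gchoose k) * ((of_nat l + 1) * (- of_int t - 1 gchoose Suc l))"
    by (simp add: symbol_def algebra_simps)
  also have "\<dots> = - (of_nat k + of_nat l + 2) * symbol k l t"
    unfolding rec symbol_def by (simp add: algebra_simps)
  finally show ?thesis by (simp add: algebra_simps)
qed

context heisenberg_vertex_algebra
begin

lemma quad_coeff_zero_mode: "quad_coeff k l (int k + int l + 1) t = of_int t * symbol k l t"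
proof -
  have "(of_nat k + 1) * (of_int t gchoose (k + 1)) = (of_int t :: complex) * (of_int t - 1 gchoose k)"
    using gbinomial_absorption[of k "of_int t :: complex"] by (simp add: algebra_simps)
  moreover have "(- 1) ^ l * (of_int (t + (int k + int l + 1) - int k - 1) gchoose l) = (- of_int t - 1 :: complex) gchoose l"
  proof -
    have e: "- of_int t - 1 = - (of_int t + 1 :: complex)"
      "(of_int (t + (int k + int l + 1) - int k - 1) :: complex) = of_int t + 1 + of_nat l - 1" by simp_all
    show ?thesis
      unfolding e gbinomial_minus ..
  qed
  ultimately show ?thesis
    by (simp only: quad_coeff_def symbol_def mult.assoc)
qed

lemma h_quad_zero_mode:
  "h i t (Y (quad k l) (int k + int l + 1) v) - Y (quad k l) (int k + int l + 1) (h i t v)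
    = scale (of_int t * (symbol k l t + symbol k l (- t))) (h i t v)"
proof -
  have "quad_coeff l k (int k + int l + 1) t = of_int t * symbol k l (- t)"
    using quad_coeff_zero_mode[of l k t] by (simp add: symbol_minus add.commute)
  moreover have "t + (int k + int l + 1) - int k - int l - 1 = t" by simp
  ultimately show ?thesis
    unfolding h_quad_mode quad_coeff_zero_mode by (simp only: distrib_left)
qed

text \<open>Every creation operator is an eigenvector for the bracket with each of these zero modes,
  and they kill \<open>vac\<close>, so they are simultaneously diagonal on monomials.\<close>

lemma quad_zero_modes_commute:
  "Y (quad k l) (int k + int l + 1) (Y (quad k' l') (int k' + int l' + 1) v)
    = Y (quad k' l') (int k' + int l' + 1) (Y (quad k l) (int k + int l + 1) v)"
proof (induction v rule: fock_induct)
  case (creat x v)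
  obtain c t where x: "creat x = h c t" unfolding creat_def by blast
  have rel: "Y (quad k l) (int k + int l + 1) (h c t v)
      = h c t (Y (quad k l) (int k + int l + 1) v) - scale (of_int t * (symbol k l t + symbol k l (- t))) (h c t v)" for k l v
    using h_quad_zero_mode[of c t k l v] by (simp add: algebra_simps)
  show ?case
    unfolding x rel by (simp add: Y_diff_right Y_scale_right rel creat scale_right_diff_distrib mult.commute)
qed (auto simp: Y_add_right Y_scale_right quad_mode_vac)

definition qgen :: "int \<Rightarrow> 'v set" where
  "qgen w = {quad k l |k l. int k + int l + 2 = w} \<union> (if w = 0 then {vac} else {})"

lemma Om_vac_in_span: "Om r s vac \<in> span (qgen (- r - s))"
proof -
  consider "s \<ge> 0" | "s < 0" "r \<ge> 0" | "s < 0" "r < 0" by linarith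
  then show ?thesis
  proof cases
    case 1
    then show ?thesis by (simp add: Om_vac span_zero)
  next
    case 2
    then obtain c where "Om r s vac = (if r + s = 0 then scale c vac else 0)" using Om_vac' by blast
    then show ?thesis by (auto simp: qgen_def span_zero intro!: span_scale intro: span_base)
  next
    case 3
    then obtain k l where "r = - int k - 1" "s = - int l - 1"
      using that[of "nat (- r - 1)" "nat (- s - 1)"] by simp
    then have "Om r s vac = quad k l" "int k + int l + 2 = - r - s" by (simp_all add: quad_def)
    then have "Om r s vac \<in> qgen (- r - s)" unfolding qgen_def by blast
    then show ?thesis by (rule span_base)
  qed
qed

text \<open>A nonnegative mode of a quadratic kills \<open>vac\<close>, and its bracket with a
  Heisenberg mode is a multiple of another one; so it acts on the two factors of the second
  quadratic one at a time.\<close>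

lemma quad_mode_quad_in_span:
  assumes "j \<ge> 0"
  shows "Y (quad k l) j (quad k' l') \<in> span (qgen (int k + int l + int k' + int l' + 3 - j))"
proof -
  let ?c = "\<lambda>t. quad_coeff k l j t + quad_coeff l k j t" and ?d = "j - int k - int l - 1"
  have rel: "Y (quad k l) j (h i t v) = h i t (Y (quad k l) j v) - scale (?c t) (h i (t + ?d) v)" for i t v
    using h_quad_mode[of i t k l j v] by (simp add: algebra_simps)
  have "Y (quad k l) j (Om r s vac) = - scale (?c s) (Om r (s + ?d) vac) - scale (?c r) (Om (r + ?d) s vac)" for r s
    by (simp add: Om_def Y_sum_right rel quad_mode_vac[OF assms] Y_minus_right Y_scale_right
        sum_subtractf sum_negf scale_sum_right)
  then have eq: "Y (quad k l) j (quad k' l') = - scale (?c (- int l' - 1)) (Om (- int k' - 1) (- int l' - 1 + ?d) vac)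
      - scale (?c (- int k' - 1)) (Om (- int k' - 1 + ?d) (- int l' - 1) vac)"
    unfolding quad_def[of k' l'] .
  have "- (- int k' - 1) - (- int l' - 1 + ?d) = int k + int l + int k' + int l' + 3 - j"
    "- (- int k' - 1 + ?d) - (- int l' - 1) = int k + int l + int k' + int l' + 3 - j" by simp_all
  then show ?thesis
    unfolding eq using Om_vac_in_span[of "- int k' - 1" "- int l' - 1 + ?d"] Om_vac_in_span[of "- int k' - 1 + ?d" "- int l' - 1"]
    by (intro span_diff span_neg span_scale) (simp_all only:)
qed

lemma quad_translation:
  "Y (quad k l) (- 2) vac = scale (of_nat k + 1) (quad (Suc k) l) + scale (of_nat l + 1) (quad k (Suc l))"
proof -
  have idx: "- int (Suc k) - 1 = - int k - 1 - 1" for k by simp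
  have "Y (h i (- int k - 1) (h i (- int l - 1) vac)) (- 2) vac
      = scale (of_nat k + 1) (h i (- int (Suc k) - 1) (h i (- int l - 1) vac))
      + scale (of_nat l + 1) (h i (- int k - 1) (h i (- int (Suc l) - 1) vac))" for i
    unfolding translation_mode idx
    by (simp add: vacuum Y_minus_right Y_add_right Y_diff_right Y_scale_right scale_left_diff_distrib scale_minus_left scale_left_distrib
        algebra_simps)
  then show ?thesis
    by (simp add: quad_def Om_def Y_sum_left scale_sum_right sum.distrib)
qed

text \<open>One creation mode with one annihilation mode acts as a derivation that changes a single
  factor, so the number of factors is kept. The inner induction of
  \<open>quadratic_commutant\<close> rests on this.\<close>

lemma qprod_Om:
  assumes "s \<ge> 1" "t \<ge> 0"
  shows "Om (- s) t (qprod zs) \<in> span (qprod ` {ys. length ys = length zs \<and> int (qwt ys) = int (qwt zs) + s - t})"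
proof (cases "t = 0")
  case True
  then show ?thesis by (simp add: Om_def span_zero)
next
  case False
  show ?thesis
  proof (induction zs)
    case Nil
    show ?case using assms by (simp add: Om_vac span_zero)
  next
    case (Cons z zs)
    obtain k l where z: "z = (k, l)" by fastforce
    let ?S = "\<lambda>zs. qprod ` {ys. length ys = length zs \<and> int (qwt ys) = int (qwt zs) + s - t}"
    let ?r = "- int k - 1" and ?q = "- int l - 1" and ?w = "qprod zs"
    have "h i (- s) (h i t (Om ?r ?q v)) = Om ?r ?q (h i (- s) (h i t v))
      + (if t + ?r = 0 then scale (of_int t) (h i (- s) (h i ?q v)) else 0)
      + (if t + ?q = 0 then scale (of_int t) (h i (- s) (h i ?r v)) else 0)" for i v
      using assms False
      by (subst h_Om, simp only: Y_add_right, subst h_Om) (auto simp: Y_scale_right)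
    then have "Om (- s) t (Om ?r ?q ?w) = Om ?r ?q (Om (- s) t ?w)
      + (if t + ?r = 0 then scale (of_int t) (Om (- s) ?q ?w) else 0)
      + (if t + ?q = 0 then scale (of_int t) (Om (- s) ?r ?w) else 0)"
      unfolding Om_def[of "- s"] by (simp add: sum.distrib scale_sum_right)
    then have "Om (- s) t (qprod (z # zs)) = Om ?r ?q (Om (- s) t ?w)
      + (if t + ?r = 0 then scale (of_int t) (Om (- s) ?q ?w) else 0)
      + (if t + ?q = 0 then scale (of_int t) (Om (- s) ?r ?w) else 0)"
      by (simp add: z)
    moreover have "Om ?r ?q v \<in> span (?S (z # zs))" if "v \<in> span (?S zs)" for v
      using that
    proof (induction rule: span_induct_alt)
      case (step c x y)
      then obtain xs where xs: "x = qprod xs" "length xs = length zs" "int (qwt xs) = int (qwt zs) + s - t" by auto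
      have "Om ?r ?q x \<in> ?S (z # zs)"
        using xs by (intro image_eqI[of _ _ "z # xs"]) (simp_all add: z)
      then show ?case using step by (auto intro!: span_add span_scale intro: span_base)
    qed (simp add: span_zero)
    then have "Om ?r ?q (Om (- s) t ?w) \<in> span (?S (z # zs))" using Cons by blast
    moreover have "(if t + ?r = 0 then scale (of_int t) (Om (- s) ?q ?w) else 0) \<in> span (?S (z # zs))"
    proof (cases "t + ?r = 0")
      case True
      have "Om (- s) ?q ?w \<in> ?S (z # zs)"
        using assms True by (intro image_eqI[of _ _ "(nat (s - 1), l) # zs"]) (simp_all add: z)
      then show ?thesis by (auto intro!: span_scale span_zero intro: span_base)
    qed (simp add: span_zero)
    moreover have "(if t + ?q = 0 then scale (of_int t) (Om (- s) ?r ?w) else 0) \<in> span (?S (z # zs))"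
    proof (cases "t + ?q = 0")
      case True
      have "Om (- s) ?r ?w \<in> ?S (z # zs)"
        using assms True by (intro image_eqI[of _ _ "(nat (s - 1), k) # zs"]) (simp_all add: z)
      then show ?thesis by (auto intro!: span_scale span_zero intro: span_base)
    qed (simp add: span_zero)
    ultimately show ?case by (simp only: span_add)
  qed
qed

text \<open>The vertex algebra product with a quadratic and the polynomial product differ by
  operators with a creation mode on the left and a nonnegative mode on the right, which by
  \<open>qprod_Om\<close> do not lengthen a product of quadratics.\<close>

lemma quad_normal_order:
  "Y (quad k l) (- 1) v - Om (- int k - 1) (- int l - 1) v
    \<in> span {Om (- s) t v |s t. s \<ge> 1 \<and> t \<ge> 0 \<and> s - t = int k + int l + 2}" (is "_ \<in> span ?S")
proof -
  let ?b = "\<lambda>i. h i (- int l - 1) vac"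
  have deriv: "Y (?b i) n v = scale ((- 1) ^ l * (of_int n gchoose l)) (h i (n - int l) v)" for i n v
    by (rule Y_derivative)
  \<comment> \<open>Associativity truncates separately for each i; since there are finitely many i,
    one bound serves all.\<close>
  have "\<exists>N. \<forall>i. \<forall>M\<ge>N. Y (h i (- int k - 1) (?b i)) (- 1) v
    = (\<Sum>j<M. scale ((- 1) ^ j * ((of_int (- int k - 1) :: complex) gchoose j))
        (h i (- int k - 1 - int j) (Y (?b i) (- 1 + int j) v)
          - scale ((- 1) powi (- int k - 1)) (Y (?b i) (- 1 + (- int k - 1) - int j) (h i (int j) v))))"
    (is "\<exists>N. \<forall>i. \<forall>M\<ge>N. ?P i M")
  proof -
    have "\<exists>n. \<forall>M\<ge>n. ?P i M" for i by (rule Y_associativity_ex)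
    then have "\<exists>n. \<forall>i. \<forall>M\<ge>n i. ?P i M" by (intro choice allI)
    then obtain n where n: "\<forall>i. \<forall>M\<ge>n i. ?P i M" by (rule exE)
    have le: "n i \<le> Max (range n)" for i by (rule Max_ge) auto
    show ?thesis
      by (intro exI[of _ "Max (range n)"] allI impI n[rule_format] order_trans[OF le])
  qed
  then obtain N where N0: "\<forall>i. \<forall>M\<ge>N. ?P i M" by (rule exE)
  \<comment> \<open>\<open>Suc N\<close> guarantees that the leading term j = 0 is present and can
    be split off.\<close>
  have N: "?P i (Suc N)" for i by (rule N0[rule_format]) simp
  let ?A = "\<lambda>j::nat. (- 1) ^ j * ((of_int (- int k - 1) :: complex) gchoose j)"
  let ?B = "\<lambda>n::int. (- 1) ^ l * ((of_int n :: complex) gchoose l)"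
  let ?T1 = "\<lambda>j. scale (?A j * ?B (- 1 + int j)) (Om (- int k - 1 - int j) (- 1 + int j - int l) v)"
  let ?T2 = "\<lambda>j. scale (?A j * ((- 1) powi (- int k - 1) * ?B (- 1 + (- int k - 1) - int j)))
      (Om (- 1 + (- int k - 1) - int j - int l) (int j) v)"
  have "Y (quad k l) (- 1) v = (\<Sum>j<Suc N. ?T1 j - ?T2 j)"
  proof -
    have "Y (quad k l) (- 1) v = (\<Sum>i\<in>UNIV. Y (h i (- int k - 1) (?b i)) (- 1) v)"
      by (simp add: quad_def Om_def Y_sum_left)
    also have "\<dots> = (\<Sum>i\<in>UNIV. \<Sum>j<Suc N. scale (?A j * ?B (- 1 + int j)) (h i (- int k - 1 - int j) (h i (- 1 + int j - int l) v))
        - scale (?A j * ((- 1) powi (- int k - 1) * ?B (- 1 + (- int k - 1) - int j)))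
            (h i (- 1 + (- int k - 1) - int j - int l) (h i (int j) v)))"
      unfolding N by (simp only: deriv Y_scale_right scale_right_diff_distrib scale_scale)
    also have "\<dots> = (\<Sum>j<Suc N. ?T1 j - ?T2 j)"
      by (subst sum.swap) (simp only: sum_subtractf Om_def scale_sum_right)
    finally show ?thesis .
  qed
  also have "\<dots> = ?T1 0 + ((\<Sum>j=1..N. ?T1 j) - (\<Sum>j<Suc N. ?T2 j))"
  proof -
    have "{..<Suc N} = insert 0 {1..N}" by auto
    then have "(\<Sum>j<Suc N. f j) = f 0 + (\<Sum>j=1..N. f j)" for f :: "nat \<Rightarrow> 'v" by simp
    from this[of ?T1] show ?thesis by (simp only: sum_subtractf add_diff_eq)
  qed
  also have "?T1 0 = Om (- int k - 1) (- int l - 1) v"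
  proof -
    have "(- 1) ^ l * ((- 1 :: complex) gchoose l) = 1"
      using gbinomial_minus[of "1 :: complex" l] by (simp add: flip: binomial_gbinomial mult.assoc power_mult_distrib)
    moreover have "- 1 - int l = - int l - 1" by simp
    ultimately show ?thesis by (simp add: \<open>- 1 - int l = - int l - 1\<close>)
  qed
  finally have eq: "Y (quad k l) (- 1) v - Om (- int k - 1) (- int l - 1) v = (\<Sum>j=1..N. ?T1 j) - (\<Sum>j<Suc N. ?T2 j)"
    by (simp only: add_diff_cancel_left')
  have "?T1 j \<in> span ?S" if "j \<ge> 1" for j
  proof (cases "j \<le> l")
    case True
    \<comment> \<open>Here 0 <= j-1 < l, so the binomial vanishes: exactly the terms whose inner
      mode j-1-l is still negative drop out.\<close>
    have "((of_int (- 1 + int j) :: complex) gchoose l) = of_nat ((j - 1) choose l)"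
      using that by (simp add: binomial_gbinomial of_nat_diff)
    then have "?B (- 1 + int j) = 0" using True that by (simp add: binomial_eq_0)
    then show ?thesis by (simp only: mult_zero_right scale_zero_left span_zero)
  next
    case False
    have "Om (- (int k + 1 + int j)) (- 1 + int j - int l) v \<in> ?S"
      by (intro CollectI exI conjI, rule refl) (use False in auto)
    moreover have "- (int k + 1 + int j) = - int k - 1 - int j" by simp
    ultimately have "Om (- int k - 1 - int j) (- 1 + int j - int l) v \<in> ?S" by (simp only:)
    then show ?thesis by (intro span_scale span_base)
  qed
  moreover have "?T2 j \<in> span ?S" for j
  proof -
    have "Om (- (int k + int l + 2 + int j)) (int j) v \<in> ?S"
      by (intro CollectI exI conjI, rule refl) auto
    moreover have "- (int k + int l + 2 + int j) = - 1 + (- int k - 1) - int j - int l" by simp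
    ultimately have "Om (- 1 + (- int k - 1) - int j - int l) (int j) v \<in> ?S" by (simp only:)
    then show ?thesis by (intro span_scale span_base)
  qed
  ultimately show ?thesis
    unfolding eq by (intro span_diff span_sum) auto
qed

end

section \<open>Zero modes on a module\<close>

locale heisenberg_invariants_module =
  heisenberg_vertex_algebra scale Y vac \<alpha> +
  irreducible_admissible_module scale Y vac scaleM
    "heisenberg_vertex_algebra.orthogonal_invariants scale Y vac \<alpha>" act
    "heisenberg_vertex_algebra.invariant_weight_space scale Y vac \<alpha>" G
  for scale :: "complex \<Rightarrow> 'v::ab_group_add \<Rightarrow> 'v"
    and Y :: "'v \<Rightarrow> int \<Rightarrow> 'v \<Rightarrow> 'v"
    and vac :: 'v
    and \<alpha> :: "'n::finite \<Rightarrow> 'v"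
    and scaleM :: "complex \<Rightarrow> 'm::ab_group_add \<Rightarrow> 'm"
    and act :: "'v \<Rightarrow> int \<Rightarrow> 'm \<Rightarrow> 'm"
    and G :: "nat \<Rightarrow> 'm set"
begin

abbreviation quad_zero :: "nat \<Rightarrow> nat \<Rightarrow> 'm \<Rightarrow> 'm" where
  "quad_zero k l \<equiv> act (quad k l) (int k + int l + 1)"

section \<open>Transfer of zero-mode relations from the Fock space to the module\<close>

lemma quad_zero_Suc:
  "scaleM (of_nat k + 1) (quad_zero (Suc k) l u)
    = - scaleM (of_nat k + of_nat l + 2) (quad_zero k l u) - scaleM (of_nat l + 1) (quad_zero k (Suc l) u)"
proof -
  have idx: "int (Suc k) + int l + 1 = int k + int l + 2" "int k + int (Suc l) + 1 = int k + int l + 2" by simp_all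
  have "act (Y (quad k l) (- int 1 - 1) vac) (int k + int l + 2) u
      = scaleM ((- 1) ^ 1 * ((of_int (int k + int l + 2) :: complex) gchoose 1)) (act (quad k l) (int k + int l + 2 - int 1) u)"
    by (rule act_derivative[OF quad_invariant])
  moreover have "int k + int l + 2 - int 1 = int k + int l + 1" "- int 1 - 1 = - 2" by simp_all
  moreover have "act (Y (quad k l) (- 2) vac) (int k + int l + 2) u
      = scaleM (of_nat k + 1) (quad_zero (Suc k) l u) + scaleM (of_nat l + 1) (quad_zero k (Suc l) u)"
    unfolding quad_translation idx
    using subspace_invariants quad_invariant by (simp add: act_add_left act_scale_left subspace_scale)
  ultimately have "scaleM (of_nat k + 1) (quad_zero (Suc k) l u) + scaleM (of_nat l + 1) (quad_zero k (Suc l) u)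
      = - scaleM (of_nat k + of_nat l + 2) (quad_zero k l u)"
  proof -
    assume 1: "act (Y (quad k l) (- int 1 - 1) vac) (int k + int l + 2) u
      = scaleM ((- 1) ^ 1 * ((of_int (int k + int l + 2) :: complex) gchoose 1)) (act (quad k l) (int k + int l + 2 - int 1) u)"
      and 2: "int k + int l + 2 - int 1 = int k + int l + 1" "- int 1 - 1 = - 2"
      and 3: "act (Y (quad k l) (- 2) vac) (int k + int l + 2) u
      = scaleM (of_nat k + 1) (quad_zero (Suc k) l u) + scaleM (of_nat l + 1) (quad_zero k (Suc l) u)"
    have "(- 1) ^ 1 * ((of_int (int k + int l + 2) :: complex) gchoose 1) = - (of_nat k + of_nat l + 2)" by simp
    then show ?thesis
      using 1 unfolding 2 3 by (simp only: M.scale_minus_left)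
  qed
  then show ?thesis by (simp only: eq_diff_eq)
qed

text \<open>
  \<open>symbol 0 s\<close> takes the value \<open>binom(y, s)\<close> at \<open>- 1 - y\<close>, so Newton interpolation at the negative integers
  is the linear map sending each \<open>symbol k l\<close> to the zero mode of \<open>quad k l\<close>, applied to \<open>u\<close>.
\<close>

definition newton :: "nat \<Rightarrow> 'm \<Rightarrow> (int \<Rightarrow> complex) \<Rightarrow> 'm" where
  "newton N u f = (\<Sum>s\<le>N. scaleM ((fdiff ^^ s) (\<lambda>y. f (- 1 - int y)) 0) (quad_zero 0 s u))"

lemma newton_linear: "newton N u (\<lambda>t. a * f t + b * g t) = scaleM a (newton N u f) + scaleM b (newton N u g)"
  unfolding newton_def fdiff_funpow_linear
  by (simp add: M.scale_left_distrib sum.distrib M.scale_sum_right)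

lemma newton_zero [simp]: "newton N u (\<lambda>t. 0) = 0"
  using newton_linear[of N u 0 "\<lambda>t. 0" 0 "\<lambda>t. 0"] by simp

text \<open>For k = 0 the differences at 0 of y -> binom(y,l) pick out s = l. The step works because
  \<open>symbol_Suc\<close> and \<open>quad_zero_Suc\<close> are the same recursion, and it never
  raises the sum of the indices above the bound N.\<close>

lemma newton_symbol: "k + l \<le> N \<Longrightarrow> newton N u (symbol k l) = quad_zero k l u"
proof (induction k arbitrary: l)
  case 0
  have "(\<lambda>y. symbol 0 l (- 1 - int y)) = (\<lambda>y. of_nat y gchoose l)"
    by (auto simp: symbol_def)
  moreover have "(fdiff ^^ s) (\<lambda>y. of_nat y gchoose l) 0 = (if s = l then 1 else 0)" for s
    unfolding fdiff_funpow_gbinomial by (simp add: gbinomial_0_left)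
  ultimately have "newton N u (symbol 0 l) = (\<Sum>s\<le>N. if s = l then quad_zero 0 l u else 0)"
    unfolding newton_def by (intro sum.cong refl) (simp only: if_distrib if_distribR M.scale_one M.scale_zero_left cong: if_cong, auto)
  then show ?case using 0 by simp
next
  case (Suc k)
  let ?c = "of_nat k + 1 :: complex"
  have c: "?c \<noteq> 0" by (rule of_nat_plus_1_neq_0)
  have "symbol (Suc k) l = (\<lambda>t. (- (of_nat k + of_nat l + 2) / ?c) * symbol k l t + (- (of_nat l + 1) / ?c) * symbol k (Suc l) t)"
  proof
    fix t
    show "symbol (Suc k) l t = (- (of_nat k + of_nat l + 2) / ?c) * symbol k l t + (- (of_nat l + 1) / ?c) * symbol k (Suc l) t"
    proof -
      have "symbol (Suc k) l t = (?c * symbol (Suc k) l t) / ?c" using c by simp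
      also have "\<dots> = (- (of_nat k + of_nat l + 2) / ?c) * symbol k l t + (- (of_nat l + 1) / ?c) * symbol k (Suc l) t"
        unfolding symbol_Suc diff_divide_distrib
        by (simp only: times_divide_eq_left minus_divide_left mult_minus_left diff_conv_add_uminus)
      finally show ?thesis .
    qed
  qed
  then have "newton N u (symbol (Suc k) l) = scaleM (- (of_nat k + of_nat l + 2) / ?c) (quad_zero k l u)
      + scaleM (- (of_nat l + 1) / ?c) (quad_zero k (Suc l) u)"
    using Suc.prems Suc.IH[of l] Suc.IH[of "Suc l"] by (simp only: newton_linear)
  also have "\<dots> = scaleM (1 / ?c) (- scaleM (of_nat k + of_nat l + 2) (quad_zero k l u) - scaleM (of_nat l + 1) (quad_zero k (Suc l) u))"
  proof -
    have "scaleM (- A / z) x + scaleM (- B / z) y = scaleM (1 / z) (- scaleM A x - scaleM B y)" for A B z x y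
      by (simp add: M.scale_right_diff_distrib M.scale_minus_left)
    then show ?thesis .
  qed
  also have "\<dots> = quad_zero (Suc k) l u"
    unfolding quad_zero_Suc[symmetric] using c by simp
  finally show ?case .
qed

text \<open>
  \<open>symbol_rel N u S s\<close> says that \<open>S\<close> is the zero mode, on the vertex algebra itself, of a combination of
  \<open>vac\<close> and the quadratics, and \<open>s\<close> the value at \<open>u\<close> of the same zero mode on the module. Both are governed
  by one symbol \<open>f\<close>, of which \<open>S\<close> only sees the even part; hence \<open>S = 0\<close> forces \<open>s = 0\<close>.
\<close>

definition symbol_rel :: "nat \<Rightarrow> 'm \<Rightarrow> ('v \<Rightarrow> 'v) \<Rightarrow> 'm \<Rightarrow> bool" where
  "symbol_rel N u S s \<longleftrightarrow> (\<exists>c f. S vac = scale c vac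
     \<and> (\<forall>i t v. h i t (S v) - S (h i t v) = scale (of_int t * (f t + f (- t))) (h i t v))
     \<and> s = scaleM c u + newton N u f \<and> newton N u (\<lambda>t. f (- t)) = newton N u f)"

lemma symbol_rel_combine:
  assumes "symbol_rel N u S s" "symbol_rel N u T t"
  shows "symbol_rel N u (\<lambda>v. scale a (S v) + T v) (scaleM a s + t)"
proof -
  obtain c f where 1: "S vac = scale c vac"
     "\<And>i t v. h i t (S v) - S (h i t v) = scale (of_int t * (f t + f (- t))) (h i t v)"
     "s = scaleM c u + newton N u f" "newton N u (\<lambda>t. f (- t)) = newton N u f"
    using assms(1) unfolding symbol_rel_def by blast
  obtain d g where 2: "T vac = scale d vac"
     "\<And>i t v. h i t (T v) - T (h i t v) = scale (of_int t * (g t + g (- t))) (h i t v)"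
     "t = scaleM d u + newton N u g" "newton N u (\<lambda>t. g (- t)) = newton N u g"
    using assms(2) unfolding symbol_rel_def by blast
  show ?thesis
    unfolding symbol_rel_def
  proof (intro exI conjI allI)
    show "scale a (S vac) + T vac = scale (a * c + d) vac"
      by (simp add: 1 2 scale_left_distrib)
    fix i t v
    have "h i t (scale a (S v) + T v) - (scale a (S (h i t v)) + T (h i t v))
        = scale a (h i t (S v) - S (h i t v)) + (h i t (T v) - T (h i t v))"
      by (simp add: Y_add_right Y_scale_right scale_right_diff_distrib)
    also have "\<dots> = scale (of_int t * ((a * f t + 1 * g t) + (a * f (- t) + 1 * g (- t)))) (h i t v)"
      unfolding 1(2) 2(2) scale_scale scale_left_distrib[symmetric] by (simp add: algebra_simps)
    finally show "h i t (scale a (S v) + T v) - (scale a (S (h i t v)) + T (h i t v))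
        = scale (of_int t * ((a * f t + 1 * g t) + (a * f (- t) + 1 * g (- t)))) (h i t v)" .
  next
    show "scaleM a s + t = scaleM (a * c + d) u + newton N u (\<lambda>t. a * f t + 1 * g t)"
      unfolding newton_linear 1(3) 2(3) by (simp add: M.scale_left_distrib M.scale_right_distrib)
    show "newton N u (\<lambda>t. a * f (- t) + 1 * g (- t)) = newton N u (\<lambda>t. a * f t + 1 * g t)"
      unfolding newton_linear[of N u a f 1 g] newton_linear[of N u a "\<lambda>t. f (- t)" 1 "\<lambda>t. g (- t)"] 1(4) 2(4) ..
  qed
qed

lemma symbol_rel_zero: "symbol_rel N u (\<lambda>v. 0) 0"
  unfolding symbol_rel_def by (intro exI[of _ 0] exI[of _ "\<lambda>t. 0"]) simp

lemma symbol_rel_sum: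
  "(\<And>x. x \<in> A \<Longrightarrow> symbol_rel N u (S x) (s x)) \<Longrightarrow>
    symbol_rel N u (\<lambda>v. \<Sum>x\<in>A. scale (a x) (S x v)) (\<Sum>x\<in>A. scaleM (a x) (s x))"
  by (induction A rule: infinite_finite_induct) (simp_all add: symbol_rel_zero symbol_rel_combine)

text \<open>The parity condition holds because the reflected symbol belongs to
  \<open>quad l k\<close>, which equals \<open>quad k l\<close>.\<close>

lemma symbol_rel_quad:
  assumes "k + l \<le> N"
  shows "symbol_rel N u (Y (quad k l) (int k + int l + 1)) (quad_zero k l u)"
  unfolding symbol_rel_def
proof (intro exI conjI allI)
  show "Y (quad k l) (int k + int l + 1) vac = scale 0 vac" by (simp add: quad_mode_vac)
  show "h i t (Y (quad k l) (int k + int l + 1) v) - Y (quad k l) (int k + int l + 1) (h i t v)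
      = scale (of_int t * (symbol k l t + symbol k l (- t))) (h i t v)" for i t v
    by (rule h_quad_zero_mode)
  show "quad_zero k l u = scaleM 0 u + newton N u (symbol k l)"
    using newton_symbol[OF assms] by simp
  have "(\<lambda>t. symbol k l (- t)) = symbol l k" by (auto simp: symbol_minus)
  then show "newton N u (\<lambda>t. symbol k l (- t)) = newton N u (symbol k l)"
    using newton_symbol[of k l N u] newton_symbol[of l k N u] assms
    by (simp add: quad_commute[of k l] add.commute)
qed

lemma symbol_rel_vac: "symbol_rel N u (Y vac (- 1)) (act vac (- 1) u)"
  unfolding symbol_rel_def
  by (intro exI[of _ 1] exI[of _ "\<lambda>t. 0"]) (simp add: vacuum act_vacuum)

lemma qgen_invariant: "x \<in> span (qgen w) \<Longrightarrow> x \<in> orthogonal_invariants"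
proof -
  have "qgen w \<subseteq> orthogonal_invariants"
    by (auto simp: qgen_def quad_invariant vac_invariant)
  then show "x \<in> span (qgen w) \<Longrightarrow> x \<in> orthogonal_invariants"
    using span_minimal[OF _ subspace_invariants] by blast
qed

lemma symbol_rel_span:
  assumes "x \<in> span (qgen w)" "w \<le> int N + 2"
  shows "symbol_rel N u (Y x (w - 1)) (act x (w - 1) u)"
proof -
  have "x \<in> orthogonal_invariants \<and> symbol_rel N u (Y x (w - 1)) (act x (w - 1) u)"
    using assms(1)
  proof (induction rule: span_induct_alt)
    case base
    then show ?case using subspace_invariants by (simp add: symbol_rel_zero subspace_0)
  next
    case (step c x y)
    have "symbol_rel N u (Y x (w - 1)) (act x (w - 1) u)"
    proof -
      consider k l where "x = quad k l" "w = int k + int l + 2" | "x = vac" "w = 0"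
        using step(1) by (auto simp: qgen_def split: if_splits)
      then show ?thesis
      proof cases
        case 1
        then have w: "w - 1 = int k + int l + 1" and N: "k + l \<le> N" using assms(2) by auto
        show ?thesis unfolding w 1(1) by (rule symbol_rel_quad[OF N])
      next
        case 2
        then show ?thesis using symbol_rel_vac by simp
      qed
    qed
    from symbol_rel_combine[OF this conjunct2[OF step(2)], of c]
    have "symbol_rel N u (\<lambda>v. scale c (Y x (w - 1) v) + Y y (w - 1) v) (scaleM c (act x (w - 1) u) + act y (w - 1) u)" .
    moreover have "(\<lambda>v. scale c (Y x (w - 1) v) + Y y (w - 1) v) = Y (scale c x + y) (w - 1)"
      by (auto simp: Y_add_left Y_scale_left)
    moreover have inv: "x \<in> orthogonal_invariants" "y \<in> orthogonal_invariants"
      using qgen_invariant[OF span_base[OF step(1)]] step(2) by simp_all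
    moreover have "scale c x + y \<in> orthogonal_invariants"
      using inv subspace_invariants by (simp add: subspace_scale subspace_add)
    moreover have "act (scale c x + y) (w - 1) u = scaleM c (act x (w - 1) u) + act y (w - 1) u"
      using inv subspace_invariants by (simp add: act_add_left act_scale_left subspace_scale)
    ultimately show ?case by simp
  qed
  then show ?thesis ..
qed

text \<open>Newton interpolation only uses the nodes -1-y, and for negative t the vector
  \<open>h i t vac\<close> is nonzero, so the even part of f vanishes at all nodes. As f and its
  reflection interpolate to the same vector, twice that vector is 0.\<close>

lemma symbol_rel_eq_0:
  assumes "symbol_rel N u (\<lambda>v. 0) s"
  shows "s = 0"
proof -
  obtain c f where f0: "0 = scale c vac"
     "\<forall>i t v. h i t 0 - 0 = scale (of_int t * (f t + f (- t))) (h i t v)"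
     "s = scaleM c u + newton N u f" "newton N u (\<lambda>t. f (- t)) = newton N u f"
    using assms unfolding symbol_rel_def by blast
  have f: "scale c vac = 0" "scale (of_int t * (f t + f (- t))) (h i t v) = 0"
     "s = scaleM c u + newton N u f" "newton N u (\<lambda>t. f (- t)) = newton N u f" for i t v
    using f0(2)[rule_format, of i t v] by (simp_all only: f0(1)[symmetric] f0(3,4) Y_zero_right diff_0_right)
  have "c = 0" using f(1) nonzero by simp
  have neg: "f t + f (- t) = 0" if "t < 0" for t
  proof -
    fix i :: 'n
    have "h i t vac = fock {#(i, nat (- t - 1))#}" using that by (simp add: creat_def)
    moreover have "fock {#(i, nat (- t - 1))#} \<noteq> 0"
      using coeff_fock[of "{#(i, nat (- t - 1))#}" "{#(i, nat (- t - 1))#}"] by force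
    ultimately have "of_int t * (f t + f (- t)) = 0" using f(2)[of t i vac] by auto
    then show ?thesis using that by simp
  qed
  have "newton N u f + newton N u f = newton N u (\<lambda>t. 1 * f t + 1 * f (- t))"
    unfolding newton_linear using f(4) by simp
  also have "\<dots> = newton N u (\<lambda>t. 0)"
    unfolding newton_def using neg[of "- 1 - int _"] by simp
  finally have "scaleM 2 (newton N u f) = 0"
    using M.scale_left_distrib[of 1 1 "newton N u f"] by simp
  then have "newton N u f = 0" by simp
  then show ?thesis using f(3) \<open>c = 0\<close> by simp
qed

text \<open>The commutator formula has the same coefficients on the Fock space and on the module.
  Its right side is a zero mode of quadratics and \<open>vac\<close>; it vanishes on the Fock space,
  hence on the module by \<open>symbol_rel_eq_0\<close>.\<close>

lemma quad_zero_commute: "quad_zero k l (quad_zero k' l' u) = quad_zero k' l' (quad_zero k l u)"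
proof -
  define p where "p = int k + int l + 1"
  define q where "q = int k' + int l' + 1"
  obtain n where "\<forall>j\<ge>n. Y (quad k l) (0 + int j) (quad k' l') = 0"
    using Y_truncation_nat by blast
  then have n: "\<And>j. j \<ge> n \<Longrightarrow> Y (quad k l) (int j) (quad k' l') = 0" by simp
  \<comment> \<open>The largest weight that occurs, at j = 0, is k+l+k'+l'+3 = N+2, the limit
    allowed by \<open>symbol_rel_span\<close>.\<close>
  define N where "N = k + l + k' + l' + 1"
  have rel: "symbol_rel N u (Y (Y (quad k l) (int j) (quad k' l')) (p + q - int j))
      (act (Y (quad k l) (int j) (quad k' l')) (p + q - int j) u)" for j
  proof -
    have "symbol_rel N u (Y (Y (quad k l) (int j) (quad k' l')) (p + q + 1 - int j - 1))
      (act (Y (quad k l) (int j) (quad k' l')) (p + q + 1 - int j - 1) u)"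
      using quad_mode_quad_in_span[of "int j" k l k' l']
      by (intro symbol_rel_span) (simp_all add: p_def q_def N_def algebra_simps)
    moreover have "p + q + 1 - int j - 1 = p + q - int j" by simp
    ultimately show ?thesis by (simp only:)
  qed
  have "(\<lambda>v. \<Sum>j<n. scale ((of_int p :: complex) gchoose j) (Y (Y (quad k l) (int j) (quad k' l')) (p + q - int j) v)) = (\<lambda>v. 0)"
  proof
    fix v
    have "Y (quad k l) p (Y (quad k' l') q v) - Y (quad k' l') q (Y (quad k l) p v)
      = (\<Sum>j<n. scale ((of_int p :: complex) gchoose j) (Y (Y (quad k l) (int j) (quad k' l')) (p + q - int j) v))"
      by (rule Y_commutator) (rule n)
    then show "(\<Sum>j<n. scale ((of_int p :: complex) gchoose j) (Y (Y (quad k l) (int j) (quad k' l')) (p + q - int j) v)) = 0"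
      unfolding p_def q_def quad_zero_modes_commute[of k l k' l'] by simp
  qed
  moreover have "symbol_rel N u (\<lambda>v. \<Sum>j<n. scale ((of_int p :: complex) gchoose j) (Y (Y (quad k l) (int j) (quad k' l')) (p + q - int j) v))
     (\<Sum>j<n. scaleM ((of_int p :: complex) gchoose j) (act (Y (quad k l) (int j) (quad k' l')) (p + q - int j) u))"
    by (rule symbol_rel_sum) (rule rel)
  ultimately have "(\<Sum>j<n. scaleM ((of_int p :: complex) gchoose j) (act (Y (quad k l) (int j) (quad k' l')) (p + q - int j) u)) = 0"
    using symbol_rel_eq_0 by simp
  moreover have "act (quad k l) p (act (quad k' l') q u) - act (quad k' l') q (act (quad k l) p u)
      = (\<Sum>j<n. scaleM ((of_int p :: complex) gchoose j) (act (Y (quad k l) (int j) (quad k' l')) (p + q - int j) u))"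
    by (rule commutator) (auto simp: quad_invariant n)
  ultimately show ?thesis by (simp add: p_def q_def)
qed

section \<open>Zhu's product and the commuting zero modes\<close>

lemma invariant_weightD: "a \<in> invariant_weight_space m \<Longrightarrow> a \<in> orthogonal_invariants"
  by (simp add: invariant_weight_space_def)

lemma zero_mode_closed: "a \<in> invariant_weight_space m \<Longrightarrow> u \<in> G 0 \<Longrightarrow> act a (m - 1) u \<in> G 0"
  using grading_shift[of a m u 0 "m - 1"] by (simp add: graded_piece_def)

lemma positive_mode: "a \<in> invariant_weight_space m \<Longrightarrow> u \<in> G 0 \<Longrightarrow> r \<ge> m \<Longrightarrow> act a r u = 0"
  using grading_shift[of a m u 0 r] by (simp add: graded_piece_def)

text \<open>The Borcherds identity at p = m, q = k-1, r = -1. Modes above the zero mode kill the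
  lowest piece, so the right side reduces to one product.\<close>

lemma zhu_product:
  assumes "a \<in> invariant_weight_space m" "b \<in> invariant_weight_space k" "u \<in> G 0"
    and N: "\<And>j. j \<ge> N \<Longrightarrow> Y a (int j - 1) b = 0"
  shows "act a (m - 1) (act b (k - 1) u)
    = (\<Sum>j<N. scaleM ((of_int m :: complex) gchoose j) (act (Y a (int j - 1) b) (m + k - 1 - int j) u))"
proof -
  have "(\<Sum>j<N. scaleM ((of_int m :: complex) gchoose j) (act (Y a (- 1 + int j) b) (m + (k - 1) - int j) u))
   = (\<Sum>j\<in>{0}. scaleM ((- 1) ^ j * ((of_int (- 1) :: complex) gchoose j))
        (act a (m + - 1 - int j) (act b (k - 1 + int j) u)
          - scaleM ((- 1) powi (- 1)) (act b (k - 1 + - 1 - int j) (act a (m + int j) u))))"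
    by (rule borcherds_sums)
      (use assms invariant_weightD positive_mode[OF assms(1,3)] positive_mode[OF assms(2,3)] in
        \<open>auto simp: algebra_simps\<close>)
  then show ?thesis
    using positive_mode[OF assms(1,3), of m] invariant_weightD[OF assms(2)]
    by (simp add: algebra_simps)
qed

text \<open>Zhu's product writes the zero mode of \<open>Y (quad k l) (- 1) b\<close> as a product
  of zero modes minus terms of lower weight; passing to the polynomial product costs terms of equal
  weight with fewer factors. X stays abstract because the lemma is applied to two kinds of
  operators.\<close>

lemma quadratic_commutant:
  assumes X: "\<And>u. u \<in> G 0 \<Longrightarrow> X u \<in> G 0"
      "\<And>u v. u \<in> G 0 \<Longrightarrow> v \<in> G 0 \<Longrightarrow> X (u + v) = X u + X v"
      "\<And>c u. u \<in> G 0 \<Longrightarrow> X (scaleM c u) = scaleM c (X u)"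
    and quad: "\<And>k l u. u \<in> G 0 \<Longrightarrow> X (quad_zero k l u) = quad_zero k l (X u)"
  shows "a \<in> invariant_weight_space m \<Longrightarrow> u \<in> G 0 \<Longrightarrow> X (act a (m - 1) u) = act a (m - 1) (X u)"
proof -
  define P where "P m = {a \<in> invariant_weight_space m. \<forall>u\<in>G 0. X (act a (m - 1) u) = act a (m - 1) (X u)}" for m
  have G0: "M.subspace (G 0)" by (rule grading_subspace)
  have X0: "X 0 = 0" using X(3)[of 0 0] M.subspace_0[OF G0] by simp
  have sub: "subspace (P m)" for m
    unfolding P_def subspace_def
    using subspace_invariant_weight_space[of m] invariant_weightD[of _ m]
    by (auto simp: subspace_def act_add_left act_scale_left X zero_mode_closed X0)
  have Xsum: "X (\<Sum>j\<in>A. scaleM (c j) (f j)) = (\<Sum>j\<in>A. scaleM (c j) (X (f j)))"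
    if "\<And>j. j \<in> A \<Longrightarrow> f j \<in> G 0" for A c and f :: "nat \<Rightarrow> 'm"
    using that
  proof (induction A rule: infinite_finite_induct)
    case (insert x F)
    have "(\<Sum>j\<in>F. scaleM (c j) (f j)) \<in> G 0"
      using insert by (intro M.subspace_sum G0 M.subspace_scale) auto
    then show ?case using insert X(2,3) M.subspace_scale[OF G0] by simp
  qed (simp_all add: X0)
  have main: "invariant_weight_space m \<subseteq> P m" for m
  proof (induction "nat m" arbitrary: m rule: less_induct)
    case less
    have "qprod xs \<in> P m" if "int (qwt xs) = m" for xs
      using that
    proof (induction "length xs" arbitrary: xs)
      case 0
      then show ?case using vac_invariant_weight by (auto simp: P_def act_vacuum)
    next
      case (Suc n)
      obtain k l ys where xs: "xs = (k, l) # ys" using Suc(2) by (cases xs) auto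
      let ?m = "int (qwt ys)" and ?w = "int k + int l + 2"
      have m: "m = ?w + ?m" using Suc(3) xs by simp
      have b: "qprod ys \<in> invariant_weight_space ?m" by (rule qprod_weight)
      have q: "quad k l \<in> invariant_weight_space ?w" by (rule quad_invariant_weight)
      have lower: "invariant_weight_space m' \<subseteq> P m'" if "m' < m" for m'
        using less[of m'] that m by auto
      have ord: "Y (quad k l) (- 1) (qprod ys) \<in> P m"
      proof -
        have e: "?w + ?m - (- 1) - 1 = m" "?w + ?m - (int j - 1) - 1 = m - int j" for j
          by (simp_all add: m)
        have mem: "Y (quad k l) (- 1) (qprod ys) \<in> invariant_weight_space m"
          using Y_invariant_weight[OF q b, of "- 1"] unfolding e .
        obtain N0 where N0: "\<forall>j\<ge>N0. Y (quad k l) (- 1 + int j) (qprod ys) = 0"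
          using Y_truncation_nat by blast
        let ?y = "\<lambda>j. Y (quad k l) (int j - 1) (qprod ys)"
        have y: "?y j \<in> invariant_weight_space (m - int j)" for j
          using Y_invariant_weight[OF q b, of "int j - 1"] unfolding e .
        have prod: "act (?y 0) (m - 1) u = quad_zero k l (act (qprod ys) (?m - 1) u)
            - (\<Sum>j=1..N0. scaleM ((of_int ?w :: complex) gchoose j) (act (?y j) (m - int j - 1) u))" if "u \<in> G 0" for u
        proof -
          have "act (quad k l) (?w - 1) (act (qprod ys) (?m - 1) u)
            = (\<Sum>j<Suc N0. scaleM ((of_int ?w :: complex) gchoose j) (act (?y j) (?w + ?m - 1 - int j) u))"
            by (rule zhu_product[OF q b that]) (use N0 in \<open>auto simp: algebra_simps\<close>)
          also have "{..<Suc N0} = insert 0 {1..N0}" by auto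
          also have "(\<Sum>j\<in>insert 0 {1..N0}. scaleM ((of_int ?w :: complex) gchoose j) (act (?y j) (?w + ?m - 1 - int j) u))
            = act (?y 0) (m - 1) u + (\<Sum>j=1..N0. scaleM ((of_int ?w :: complex) gchoose j) (act (?y j) (m - int j - 1) u))"
            by (simp add: m algebra_simps)
          finally show ?thesis by (simp add: algebra_simps)
        qed
        have "X (act (?y 0) (m - 1) u) = act (?y 0) (m - 1) (X u)" if u: "u \<in> G 0" for u
        proof -
          have bu: "act (qprod ys) (?m - 1) u \<in> G 0" using zero_mode_closed[OF b u] .
          have qb: "quad_zero k l (act (qprod ys) (?m - 1) u) \<in> G 0"
            using zero_mode_closed[OF q bu] by (simp add: algebra_simps)
          have yu: "act (?y j) (m - int j - 1) u \<in> G 0" for j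
            using zero_mode_closed[OF y u] .
          have sg: "(\<Sum>j=1..N0. scaleM ((of_int ?w :: complex) gchoose j) (act (?y j) (m - int j - 1) u)) \<in> G 0"
            by (intro M.subspace_sum G0 M.subspace_scale yu)
          have Xdiff: "X (u - v) = X u - X v" if "u \<in> G 0" "v \<in> G 0" for u v
            using X(2)[of "u - v" v] M.subspace_diff[OF G0] that by simp
          have "X (act (?y 0) (m - 1) u) = X (quad_zero k l (act (qprod ys) (?m - 1) u))
            - (\<Sum>j=1..N0. scaleM ((of_int ?w :: complex) gchoose j) (X (act (?y j) (m - int j - 1) u)))"
            unfolding prod[OF u] Xdiff[OF qb sg] using yu by (subst Xsum) auto
          also have "X (quad_zero k l (act (qprod ys) (?m - 1) u)) = quad_zero k l (act (qprod ys) (?m - 1) (X u))"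
            using quad[OF bu] lower[of ?m] b u m by (auto simp: P_def)
          also have "(\<Sum>j=1..N0. scaleM ((of_int ?w :: complex) gchoose j) (X (act (?y j) (m - int j - 1) u)))
            = (\<Sum>j=1..N0. scaleM ((of_int ?w :: complex) gchoose j) (act (?y j) (m - int j - 1) (X u)))"
          proof (rule sum.cong[OF refl])
            fix j assume "j \<in> {1..N0}"
            then have "?y j \<in> P (m - int j)" using lower[of "m - int j"] y[of j] by auto
            then show "scaleM ((of_int ?w :: complex) gchoose j) (X (act (?y j) (m - int j - 1) u))
              = scaleM ((of_int ?w :: complex) gchoose j) (act (?y j) (m - int j - 1) (X u))"
              using u by (simp add: P_def)
          qed
          finally show ?thesis unfolding prod[OF X(1)[OF u]] .
        qed
        then show ?thesis using mem by (simp add: P_def)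
      qed
      \<comment> \<open>These corrections are combinations of products with as many factors as
        \<open>ys\<close>, one fewer than \<open>xs\<close>, so the inner induction hypothesis
        applies.\<close>
      have "Om (- s) t (qprod ys) \<in> P m" if "s \<ge> 1" "t \<ge> 0" "s - t = int k + int l + 2" for s t
      proof -
        have "qprod ` {zs. length zs = length ys \<and> int (qwt zs) = ?m + s - t} \<subseteq> P m"
          using Suc.hyps(1) Suc.hyps(2) xs that m by auto
        then show ?thesis
          using qprod_Om[OF that(1,2), of ys] span_minimal[OF _ sub] by blast
      qed
      then have "Y (quad k l) (- 1) (qprod ys) - Om (- int k - 1) (- int l - 1) (qprod ys) \<in> P m"
        using quad_normal_order[of k l "qprod ys"] span_minimal[OF _ sub,
          of "{Om (- s) t (qprod ys) |s t. s \<ge> 1 \<and> t \<ge> 0 \<and> s - t = int k + int l + 2}" m] by blast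
      from subspace_diff[OF sub ord this] show ?case by (simp add: xs)
    qed
    then have "qspan m \<subseteq> P m" unfolding qspan_def by (intro span_minimal sub) auto
    then show ?case by (simp add: invariant_weight_space_eq_qspan)
  qed
  then show "a \<in> invariant_weight_space m \<Longrightarrow> u \<in> G 0 \<Longrightarrow> X (act a (m - 1) u) = act a (m - 1) (X u)"
    using main[of m] by (auto simp: P_def)
qed

lemma quad_zero_closed: "u \<in> G 0 \<Longrightarrow> quad_zero k l u \<in> G 0"
  using zero_mode_closed[OF quad_invariant_weight, of u k l] by (simp add: algebra_simps)

text \<open>The commutant lemma is used twice: first with X a quadratic zero mode, giving that the
  zero mode of a commutes with the quadratic ones, then with X the zero mode of a.\<close>

lemma zero_modes_commute:
  assumes "a \<in> invariant_weight_space m" "b \<in> invariant_weight_space k" "u \<in> G 0"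
  shows "act a (m - 1) (act b (k - 1) u) = act b (k - 1) (act a (m - 1) u)"
proof -
  have "quad_zero p q (act a (m - 1) u) = act a (m - 1) (quad_zero p q u)" if "u \<in> G 0" for p q u
    by (rule quadratic_commutant[OF _ _ _ _ assms(1) that])
      (simp_all add: quad_zero_closed act_add_right act_scale_right quad_invariant quad_zero_commute)
  then show ?thesis
    using invariant_weightD[OF assms(1)]
    by (intro quadratic_commutant[OF _ _ _ _ assms(2,3)])
      (simp_all add: zero_mode_closed[OF assms(1)] act_add_right act_scale_right)
qed

end

section \<open>Irreducibility of the lowest piece\<close>

lemma ex_uncountable_fiber:
  assumes "uncountable A" "countable (f ` A)"
  shows "\<exists>t\<in>f ` A. uncountable {x \<in> A. f x = t}"
proof (rule ccontr)
  assume "\<not> ?thesis"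
  then have "countable (\<Union>t\<in>f ` A. {x \<in> A. f x = t})"
    using assms(2) by (intro countable_UN) auto
  moreover have "A = (\<Union>t\<in>f ` A. {x \<in> A. f x = t})" by auto
  ultimately show False using assms(1) by simp
qed

text \<open>Each element lies in the span of a finite subset of S. There are only countably many
  such subsets, so an uncountable B would place uncountably many independent vectors in one
  finite-dimensional span.\<close>

lemma (in vector_space) independent_in_countable_span:
  assumes "independent B" "B \<subseteq> span S" "countable S"
  shows "countable B"
proof (rule ccontr)
  assume unc: "uncountable B"
  have "\<exists>t. finite t \<and> t \<subseteq> S \<and> b \<in> span t" if "b \<in> B" for b
  proof -
    have "b \<in> span S" using assms(2) that by (rule subsetD)
    then obtain t r where t: "finite t" "t \<subseteq> S" "b = (\<Sum>a\<in>t. scale (r a) a)"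
      unfolding span_explicit by auto
    have "b \<in> span t" unfolding t(3) by (intro span_sum span_scale span_base)
    then show ?thesis using t(1,2) by blast
  qed
  then obtain t where t: "\<And>b. b \<in> B \<Longrightarrow> finite (t b) \<and> t b \<subseteq> S \<and> b \<in> span (t b)"
    by metis
  have "t ` B \<subseteq> {A. finite A \<and> A \<subseteq> S}" using t by auto
  then have "countable (t ` B)"
    using countable_Collect_finite_subset[OF assms(3)] countable_subset by blast
  from ex_uncountable_fiber[OF unc this] obtain b0 where b0: "b0 \<in> B" "uncountable {b \<in> B. t b = t b0}"
    by auto
  have "independent {b \<in> B. t b = t b0}"
    using assms(1) by (rule independent_mono) auto
  moreover have "{b \<in> B. t b = t b0} \<subseteq> span (t b0)" using t by fastforce
  ultimately have "finite {b \<in> B. t b = t b0}"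
    using independent_span_bound t[OF b0(1)] by blast
  then show False using b0(2) uncountable_infinite by blast
qed

text \<open>Irreducibility and countable dimension are both encoded in \<open>cyclic\<close>: values
  of single operators at any nonzero vector span, and the index type is countable.\<close>

locale irreducible_commuting_operators = vector_space scale
  for scale :: "complex \<Rightarrow> 'b::ab_group_add \<Rightarrow> 'b" +
  fixes U :: "'b set" and f :: "'i::countable \<Rightarrow> 'b \<Rightarrow> 'b"
  assumes U: "subspace U"
    and closed: "u \<in> U \<Longrightarrow> f i u \<in> U"
    and add: "u \<in> U \<Longrightarrow> v \<in> U \<Longrightarrow> f i (u + v) = f i u + f i v"
    and scale: "u \<in> U \<Longrightarrow> f i (scale c u) = scale c (f i u)"
    and commute: "u \<in> U \<Longrightarrow> f i (f j u) = f j (f i u)"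
    and cyclic: "w \<in> U \<Longrightarrow> w \<noteq> 0 \<Longrightarrow> U \<subseteq> span (range (\<lambda>i. f i w))"
begin

lemma zero: "f i 0 = 0"
  using scale[of 0 i 0] subspace_0[OF U] by simp

text \<open>Commuting operators preserve the eigenspace, so it contains all \<open>f j w\<close>,
  which span U.\<close>

lemma eigenvector_imp_scalar:
  assumes "w \<in> U" "w \<noteq> 0" "f i w = scale c w" "u \<in> U"
  shows "f i u = scale c u"
proof -
  have "subspace {v \<in> U. f i v = scale c v}"
    using U by (auto simp: subspace_def add scale zero scale_right_distrib mult.commute)
  moreover have "range (\<lambda>j. f j w) \<subseteq> {v \<in> U. f i v = scale c v}"
    using assms by (auto simp: closed commute[of w i] scale)
  ultimately have "span (range (\<lambda>j. f j w)) \<subseteq> {v \<in> U. f i v = scale c v}"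
    by (rule span_minimal[rotated])
  then show ?thesis using cyclic[OF assms(1,2)] assms(4) by blast
qed

text \<open>The polynomial p in the operator \<open>f i\<close>, applied to v by Horner's
  scheme.\<close>

definition eval :: "'i \<Rightarrow> complex poly \<Rightarrow> 'b \<Rightarrow> 'b" where
  "eval i p v = fold_coeffs (\<lambda>a w. scale a v + f i w) p 0"

lemma eval_0 [simp]: "eval i 0 v = 0"
  by (simp add: eval_def)

lemma eval_pCons: "eval i (pCons a p) v = scale a v + f i (eval i p v)"
  by (cases "a = 0 \<and> p = 0") (auto simp: eval_def zero)

lemma eval_closed: "v \<in> U \<Longrightarrow> eval i p v \<in> U"
proof (induction p)
  case (pCons a p)
  then show ?case using U closed by (simp add: eval_pCons subspace_add subspace_scale)
qed (simp add: subspace_0[OF U])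

lemma eval_smult: "v \<in> U \<Longrightarrow> eval i (smult c p) v = scale c (eval i p v)"
  by (induction p) (simp_all add: eval_pCons scale_right_distrib scale eval_closed)

lemma eval_add: "v \<in> U \<Longrightarrow> eval i (p + q) v = eval i p v + eval i q v"
  by (induction p q rule: poly_induct2)
    (simp_all add: eval_pCons scale_left_distrib add eval_closed)

lemma eval_add_right: "v \<in> U \<Longrightarrow> w \<in> U \<Longrightarrow> eval i p (v + w) = eval i p v + eval i p w"
  by (induction p) (simp_all add: eval_pCons scale_right_distrib add eval_closed)

lemma eval_scale_right: "v \<in> U \<Longrightarrow> eval i p (scale c v) = scale c (eval i p v)"
  by (induction p) (simp_all add: eval_pCons scale_right_distrib scale eval_closed mult.commute)

lemma eval_f: "v \<in> U \<Longrightarrow> eval i p (f i v) = f i (eval i p v)"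
  by (induction p)
    (simp_all add: eval_pCons zero add scale eval_closed closed subspace_scale[OF U])

lemma eval_linear_factor: "v \<in> U \<Longrightarrow> eval i ([:- c, 1:] * q) v = f i (eval i q v) - scale c (eval i q v)"
proof -
  have "[:- c, 1:] * q = smult (- c) q + pCons 0 q" by simp
  then show "v \<in> U \<Longrightarrow> eval i ([:- c, 1:] * q) v = f i (eval i q v) - scale c (eval i q v)"
    by (simp only: eval_add eval_smult eval_pCons scale_minus_left scale_zero_left) simp
qed

lemma eval_linear_factor': "v \<in> U \<Longrightarrow> eval i ([:- c, 1:] * q) v = eval i q (f i v - scale c v)"
  using eval_add_right[of "f i v" "scale (- c) v" i q] eval_scale_right[of v i q "- c"] subspace_scale[OF U, of v "- c"]
  by (simp only: eval_linear_factor eval_f closed scale_minus_left diff_conv_add_uminus)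

text \<open>p splits into linear factors, and each \<open>f i - z\<close> is injective on U: a
  vector in its kernel would be an eigenvector and make \<open>f i\<close> scalar, against the
  assumption at u.\<close>

lemma eval_nonzero:
  assumes "u \<in> U" "u \<noteq> 0" "\<And>c. f i u \<noteq> scale c u" "p \<noteq> 0"
  shows "eval i p u \<noteq> 0"
  using assms(4)
proof (induction "degree p" arbitrary: p)
  case 0
  then obtain a where "p = [:a:]" by (metis degree_eq_zeroE)
  then show ?case using 0 assms(2) by (simp add: eval_pCons zero)
next
  case (Suc n)
  have "\<not> constant (poly p)" using Suc(2) by (simp add: constant_degree)
  then obtain z where "poly p z = 0" using fundamental_theorem_of_algebra by blast
  then obtain q where q: "p = [:- z, 1:] * q" by (metis dvdE poly_eq_0_iff_dvd)
  then have "q \<noteq> 0" using Suc(3) by auto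
  then have "degree p = Suc (degree q)" unfolding q by (subst degree_mult_eq) auto
  then have "eval i q u \<noteq> 0" using Suc \<open>q \<noteq> 0\<close> by simp
  then have "f i (eval i q u) \<noteq> scale z (eval i q u)"
    using eigenvector_imp_scalar[OF eval_closed[OF assms(1)]] assms(1,3) by blast
  then show ?case unfolding q eval_linear_factor[OF assms(1)] by simp
qed

text \<open>
  If \<open>f i\<close> were not a scalar, the vectors \<open>z c = (f i - c)\<^sup>-\<^sup>1 u\<close> would be an uncountable independent
  family in a space of countable dimension (Dixmier's form of Schur's lemma).
\<close>

lemma ex_eigenvalue:
  assumes u: "u \<in> U" "u \<noteq> 0"
  shows "\<exists>c. f i u = scale c u"
proof (rule ccontr)
  assume "\<not> ?thesis"
  then have ne: "f i u \<noteq> scale c u" for c by blast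
  have "\<exists>z\<in>U. f i z - scale c z = u" for c
  proof -
    \<comment> \<open>\<open>?R\<close> is the image of \<open>f i - c\<close>. By commutation it
      contains every \<open>f j ?w\<close>, hence all of U, which makes \<open>f i - c\<close>
      surjective.\<close>
    let ?R = "{v. \<exists>z\<in>U. f i z - scale c z = v}" and ?w = "f i u - scale c u"
    have w: "?w \<in> U" "?w \<noteq> 0"
      using u U closed ne[of c] by (auto intro!: subspace_diff subspace_scale)
    have "subspace ?R"
      unfolding subspace_def
    proof (intro conjI ballI allI)
      show "0 \<in> ?R" using subspace_0[OF U] zero by force
      show "x + y \<in> ?R" if xy: "x \<in> ?R" "y \<in> ?R" for x y
      proof -
        obtain a b where "a \<in> U" "b \<in> U" "f i a - scale c a = x" "f i b - scale c b = y" using xy by auto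
        then show ?thesis using subspace_add[OF U]
          by (intro CollectI bexI[of _ "a + b"]) (auto simp: add scale_right_distrib)
      qed
      show "scale d x \<in> ?R" if x: "x \<in> ?R" for x d
      proof -
        obtain a where "a \<in> U" "f i a - scale c a = x" using x by auto
        then show ?thesis using subspace_scale[OF U]
          by (intro CollectI bexI[of _ "scale d a"]) (auto simp: scale scale_right_diff_distrib mult.commute)
      qed
    qed
    moreover have "f j ?w \<in> ?R" for j
    proof (intro CollectI bexI)
      show "f j u \<in> U" by (rule closed[OF u(1)])
      have "f j ?w + f j (scale c u) = f j (f i u)"
        using add[OF w(1), of "scale c u" j] subspace_scale[OF U u(1)] by simp
      then show "f i (f j u) - scale c (f j u) = f j ?w"
        using u(1) by (simp add: commute[of u i] scale algebra_simps)
    qed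
    ultimately have "span (range (\<lambda>j. f j ?w)) \<subseteq> ?R" by (intro span_minimal) auto
    then show ?thesis using cyclic[OF w] u(1) by blast
  qed
  then obtain z where z: "\<And>c. z c \<in> U" "\<And>c. f i (z c) - scale c (z c) = u" by metis
  have indep: "a c0 = 0" if "finite F" "(\<Sum>c\<in>F. scale (a c) (z c)) = 0" "c0 \<in> F" for F a c0
  proof -
    \<comment> \<open>Clearing denominators: the product of all \<open>f i - d\<close> turns each
      \<open>z c\<close> into the polynomial \<open>q c\<close> in \<open>f i\<close> applied to
      u.\<close>
    define q where "q c = (\<Prod>d\<in>F - {c}. [:- d, 1:])" for c
    have ev: "eval i (\<Prod>d\<in>F. [:- d, 1:]) (z c) = eval i (q c) u" if "c \<in> F" for c
      using that \<open>finite F\<close> eval_linear_factor'[OF z(1), of i c "q c" c]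
      by (simp add: prod.remove[of F c] q_def z(2))
    have sumz: "(\<Sum>c\<in>A. scale (a c) (z c)) \<in> U" for A
      by (intro subspace_sum[OF U] subspace_scale[OF U] z)
    have evz: "eval i p 0 = 0" for p
      using eval_scale_right[OF u(1), of i p 0] by simp
    have ev_sum: "eval i p (\<Sum>c\<in>A. scale (a c) (z c)) = (\<Sum>c\<in>A. scale (a c) (eval i p (z c)))" for p A
      by (induction A rule: infinite_finite_induct)
        (simp_all add: evz eval_add_right eval_scale_right sumz z subspace_scale[OF U])
    have sum_ev: "eval i (\<Sum>c\<in>A. smult (a c) (q c)) u = (\<Sum>c\<in>A. scale (a c) (eval i (q c) u))" for A
      by (induction A rule: infinite_finite_induct) (simp_all add: eval_add eval_smult u)
    have "eval i (\<Sum>c\<in>F. smult (a c) (q c)) u = eval i (\<Prod>d\<in>F. [:- d, 1:]) (\<Sum>c\<in>F. scale (a c) (z c))"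
      unfolding sum_ev ev_sum using ev by simp
    also have "\<dots> = 0" using that(2) evz by simp
    finally have "(\<Sum>c\<in>F. smult (a c) (q c)) = 0"
      using eval_nonzero[OF u ne] by blast
    \<comment> \<open>Evaluation at c0 isolates one coefficient, because every other
      \<open>q c\<close> has the root c0.\<close>
    then have "0 = (\<Sum>c\<in>F. a c * poly (q c) c0)"
      by (metis (no_types, lifting) poly_0 poly_smult poly_sum sum.cong)
    also have "\<dots> = (\<Sum>c\<in>F. if c = c0 then a c0 * poly (q c0) c0 else 0)"
      using \<open>finite F\<close> \<open>c0 \<in> F\<close> by (intro sum.cong) (auto simp: q_def poly_prod)
    also have "\<dots> = a c0 * poly (q c0) c0" using \<open>finite F\<close> \<open>c0 \<in> F\<close> by simp
    finally show ?thesis using \<open>finite F\<close> by (auto simp: q_def poly_prod)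
  qed
  have inj: "inj z"
  proof (rule injI)
    fix c d assume "z c = z d"
    then have "scale (d - c) (z c) = 0" using z(2)[of c] z(2)[of d]
      by (auto simp: scale_left_diff_distrib algebra_simps)
    moreover have "z c \<noteq> 0" using z(2)[of c] u(2) zero by auto
    ultimately show "c = d" by simp
  qed
  have "independent (range z)"
    unfolding independent_explicit_module
  proof (intro allI impI)
    fix t a v assume t: "finite t" "t \<subseteq> range z" "(\<Sum>v\<in>t. scale (a v) v) = 0" "v \<in> t"
    have tz: "t = z ` (z -` t)" using t(2) by auto
    have "(\<Sum>c\<in>z -` t. scale (a (z c)) (z c)) = (\<Sum>v\<in>z ` (z -` t). scale (a v) v)"
      using inj by (subst sum.reindex) (auto simp: inj_on_def inj_def)
    then have "(\<Sum>c\<in>z -` t. scale (a (z c)) (z c)) = 0" using t(3) tz by simp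
    moreover obtain c where "v = z c" using t by auto
    ultimately show "a v = 0"
      using indep[of "z -` t" "\<lambda>c. a (z c)" c] finite_vimageI[OF t(1) inj] t(4) by simp
  qed
  moreover have "range z \<subseteq> span (range (\<lambda>j. f j u))"
    using z(1) cyclic[OF u] by blast
  ultimately have "countable (range z)"
    by (rule independent_in_countable_span) simp
  then have "countable (UNIV :: complex set)"
    using countable_image_inj_on inj by blast
  then show False using uncountable_UNIV_complex by blast
qed

lemma dim_eq_1:
  assumes "U \<noteq> {0}"
  shows "dim U = 1"
proof -
  obtain u where u: "u \<in> U" "u \<noteq> 0" using assms subspace_0[OF U] by blast
  have "range (\<lambda>i. f i u) \<subseteq> span {u}"
    using ex_eigenvalue[OF u] by (auto simp: span_singleton)
  then have "span (range (\<lambda>i. f i u)) \<subseteq> span {u}" by (rule span_minimal) simp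
  with cyclic[OF u] have "U \<subseteq> span {u}" by (rule order_trans)
  then show ?thesis
    using u by (intro dim_unique[of "{u}"]) auto
qed

end

section \<open>Homogeneous components and submodules generated by one vector\<close>

context admissible_module
begin

definition decomposes :: "(nat \<Rightarrow> 'm) \<Rightarrow> 'm \<Rightarrow> bool" where
  "decomposes c u \<longleftrightarrow> finite {k. c k \<noteq> 0} \<and> (\<forall>k. c k \<in> G k) \<and> u = (\<Sum>k\<in>{k. c k \<noteq> 0}. c k)"

lemma decomposes_unique: "decomposes c u \<Longrightarrow> decomposes d u \<Longrightarrow> c = d"
  using grading_direct_sum[of u] unfolding decomposes_def by blast

lemma decomposes_single: "v \<in> G k \<Longrightarrow> decomposes (\<lambda>j. if j = k then v else 0) v"
  using M.subspace_0[OF grading_subspace] by (cases "v = 0") (auto simp: decomposes_def)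

lemma decomposes_add:
  assumes "decomposes c u" "decomposes d v"
  shows "decomposes (\<lambda>k. c k + d k) (u + v)"
proof -
  let ?F = "{k. c k \<noteq> 0} \<union> {k. d k \<noteq> 0}"
  have fin: "finite ?F" using assms by (simp add: decomposes_def)
  have sub: "{k. c k + d k \<noteq> 0} \<subseteq> ?F" by auto
  have "u = sum c ?F" "v = sum d ?F"
    using assms fin by (auto simp: decomposes_def intro!: sum.mono_neutral_left)
  moreover have "sum (\<lambda>k. c k + d k) {k. c k + d k \<noteq> 0} = sum (\<lambda>k. c k + d k) ?F"
    using fin by (intro sum.mono_neutral_left) auto
  ultimately show ?thesis
    using assms finite_subset[OF sub fin] M.subspace_add[OF grading_subspace]
    by (auto simp: decomposes_def sum.distrib)
qed

lemma decomposes_scale: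
  assumes "decomposes c u"
  shows "decomposes (\<lambda>k. scaleM x (c k)) (scaleM x u)"
  using assms M.subspace_scale[OF grading_subspace] M.subspace_0[OF grading_subspace]
  by (cases "x = 0") (auto simp: decomposes_def M.scale_sum_right)

end

context vertex_module
begin

text \<open>Two successive modes applied to w reduce to single modes, so any nonzero vector of an
  irreducible module reaches all of it without words of modes.\<close>

lemma submodule_span_modes: "submodule (M.span {act a r w |a r. a \<in> W})"
proof -
  let ?S = "{act a r w |a r. a \<in> W}"
  have gen: "act b s (act a q w) \<in> M.span ?S" if ab: "a \<in> W" "b \<in> W" for a b s q
  proof -
    obtain P where P: "\<forall>r\<ge>P. act b r w = 0" using act_truncation[OF ab(2)] by blast
    obtain Q where Q: "\<forall>r\<ge>Q. act a r w = 0" using act_truncation[OF ab(1)] by blast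
    \<comment> \<open>The Borcherds identity reduces to inner modes above \<open>q\<close>, which eventually kill \<open>w\<close>.\<close>
    show ?thesis
    proof (induction "nat (Q - q)" arbitrary: s q rule: less_induct)
      case less
      define n where "n = nat (Q - q)"
      obtain m where m: "\<forall>j\<ge>m. Y b (s - P + int j) a = 0" using truncation_nat by blast
      \<comment> \<open>With p = P the modes \<open>act b (P + int j)\<close> kill w, so the half of
        the identity in reversed order disappears; r = s - P makes the outer mode of the j = 0 term
        equal to s.\<close>
      let ?L = "\<Sum>j<m. scaleM ((of_int P :: complex) gchoose j) (act (Y b (s - P + int j) a) (P + q - int j) w)"
      let ?R = "\<lambda>j. scaleM ((- 1) ^ j * ((of_int (s - P) :: complex) gchoose j)) (act b (s - int j) (act a (q + int j) w))"
      have "?L = (\<Sum>j<Suc n. scaleM ((- 1) ^ j * ((of_int (s - P) :: complex) gchoose j))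
        (act b (P + (s - P) - int j) (act a (q + int j) w)
          - scaleM ((- 1) powi (s - P)) (act a (q + (s - P) - int j) (act b (P + int j) w))))"
        by (rule borcherds_sums) (use ab m P Q in \<open>auto simp: n_def\<close>)
      also have "\<dots> = (\<Sum>j<Suc n. ?R j)"
        using P ab by simp
      also have "{..<Suc n} = insert 0 {1..n}" by auto
      finally have "?L = act b s (act a q w) + (\<Sum>j=1..n. ?R j)" by simp
      then have eq: "act b s (act a q w) = ?L - (\<Sum>j=1..n. ?R j)" by (simp add: algebra_simps)
      have "?L \<in> M.span ?S"
        using ab Y_closed by (intro M.span_sum M.span_scale M.span_base) blast
      moreover have "?R j \<in> M.span ?S" if "j \<in> {1..n}" for j
        using that by (intro M.span_scale less) (auto simp: n_def)
      ultimately show ?case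
        unfolding eq by (rule M.span_diff[OF _ M.span_sum])
    qed
  qed
  have "act b s x \<in> M.span ?S" if "b \<in> W" "x \<in> M.span ?S" for b s x
    using that(2)
  proof (induction rule: M.span_induct_alt)
    case (step c x y)
    then show ?case
      using that(1) gen by (auto simp: act_add_right act_scale_right intro!: M.span_add M.span_scale)
  qed (simp add: that(1) M.span_zero)
  then show ?thesis by (simp add: submodule_def)
qed

end

context heisenberg_invariants_module
begin

text \<open>Indexing by lists of pairs of naturals gives the countable index type that the Schur
  argument needs.\<close>

definition qprod_zero :: "(nat \<times> nat) list \<Rightarrow> 'm \<Rightarrow> 'm" where
  "qprod_zero xs = act (qprod xs) (int (qwt xs) - 1)"

lemma qprod_zero_span:
  assumes "a \<in> invariant_weight_space m"
  shows "act a (m - 1) w \<in> M.span (range (\<lambda>xs. qprod_zero xs w))" (is "_ \<in> ?Z")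
proof -
  let ?A = "{a \<in> orthogonal_invariants. act a (m - 1) w \<in> ?Z}"
  have "subspace ?A"
    using subspace_invariants
    by (auto simp: subspace_def act_add_left act_scale_left M.span_zero M.span_add M.span_scale)
  moreover have "qprod ` {xs. int (qwt xs) = m} \<subseteq> ?A"
    using invariant_weightD[OF qprod_weight] by (auto simp: qprod_zero_def intro!: M.span_base)
  ultimately have "qspan m \<subseteq> ?A"
    unfolding qspan_def by (rule span_minimal[rotated])
  then show ?thesis using assms by (auto simp: invariant_weight_space_eq_qspan)
qed

text \<open>Single modes of homogeneous invariants at w span the module, and of these only zero
  modes contribute in degree 0. \<open>?T\<close> collects the vectors whose degree 0 component lies
  in the desired span; uniqueness of components then returns v.\<close>

lemma top_cyclic:
  assumes w: "w \<in> G 0" "w \<noteq> 0"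
  shows "G 0 \<subseteq> M.span (range (\<lambda>xs. qprod_zero xs w))" (is "_ \<subseteq> ?Z")
proof
  fix v assume v: "v \<in> G 0"
  let ?S = "{act a r w |a r. a \<in> orthogonal_invariants}"
  let ?T = "{x. \<exists>c. decomposes c x \<and> c 0 \<in> ?Z}"
  have "act vac (- 1) w \<in> ?S" using vac_invariant by blast
  then have "w \<in> M.span ?S" by (auto simp: act_vacuum intro: M.span_base)
  then have "M.span ?S = UNIV"
    using irreducible submodule_span_modes[of w] w(2) unfolding irreducible_def by blast
  have T: "M.subspace ?T"
    unfolding M.subspace_def
  proof (intro conjI ballI allI)
    have "0 \<in> G 0" by (rule M.subspace_0[OF grading_subspace])
    from decomposes_single[OF this] show "0 \<in> ?T"
      by (intro CollectI exI conjI) (auto simp: M.span_zero)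
    show "x + y \<in> ?T" if xy: "x \<in> ?T" "y \<in> ?T" for x y
    proof -
      obtain c d where "decomposes c x" "c 0 \<in> ?Z" "decomposes d y" "d 0 \<in> ?Z" using xy by auto
      then show ?thesis
        using decomposes_add[of c x d y] M.span_add[of "c 0" _ "d 0"] by auto
    qed
    show "scaleM a x \<in> ?T" if x: "x \<in> ?T" for a x
    proof -
      obtain c where "decomposes c x" "c 0 \<in> ?Z" using x by auto
      then show ?thesis
        using decomposes_scale[of c x a] M.span_scale[of "c 0" _ a] by auto
    qed
  qed
  have hom: "act a r w \<in> ?T" if a: "a \<in> invariant_weight_space m" for a r m
  proof -
    have gr: "act a r w \<in> graded_piece G (m - r - 1)"
      using grading_shift[OF a w(1), of r] by simp
    consider "m - r - 1 < 0" | "r = m - 1" | "m - r - 1 > 0" by linarith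
    then show ?thesis
    proof cases
      case 1
      then show ?thesis using gr M.subspace_0[OF T] by (simp add: graded_piece_def)
    next
      case 2
      then show ?thesis
        using decomposes_single[OF zero_mode_closed[OF a w(1)]] qprod_zero_span[OF a, of w]
        by (intro CollectI exI[of _ "\<lambda>j. if j = 0 then act a (m - 1) w else 0"]) simp
    next
      case 3
      then have "act a r w \<in> G (nat (m - r - 1))" using gr by (simp add: graded_piece_def)
      from decomposes_single[OF this] show ?thesis
        using 3 by (intro CollectI exI[of _ "\<lambda>j. if j = nat (m - r - 1) then act a r w else 0"])
          (simp add: M.span_zero)
    qed
  qed
  have "?S \<subseteq> ?T"
  proof
    fix x assume "x \<in> ?S"
    then obtain a r where a: "a \<in> orthogonal_invariants" "x = act a r w" by auto
    obtain I c where c: "finite I" "\<forall>m\<in>I. c m \<in> invariant_weight_space m" "a = (\<Sum>m\<in>I. c m)"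
      using invariant_decomposition[OF a(1)] by blast
    have "x = (\<Sum>m\<in>I. act (c m) r w)"
      unfolding a(2) c(3) by (rule act_sum_left) (use c(2) invariant_weightD in blast)
    also have "\<dots> \<in> ?T" by (intro M.subspace_sum[OF T] hom) (use c(2) in blast)
    finally show "x \<in> ?T" .
  qed
  then have "v \<in> ?T" using \<open>M.span ?S = UNIV\<close> M.span_minimal[OF _ T] by blast
  then obtain c where "decomposes c v" "c 0 \<in> ?Z" by blast
  moreover have "c = (\<lambda>j. if j = 0 then v else 0)"
    using decomposes_unique[OF \<open>decomposes c v\<close> decomposes_single[OF v]] .
  ultimately show "v \<in> ?Z" by simp
qed

lemma dim_top: "M.dim (G 0) = 1"
proof -
  interpret irreducible_commuting_operators scaleM "G 0" qprod_zero
  proof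
    show "M.subspace (G 0)" by (rule grading_subspace)
    show "qprod_zero xs u \<in> G 0" if "u \<in> G 0" for xs u
      unfolding qprod_zero_def by (rule zero_mode_closed[OF qprod_weight that])
    show "qprod_zero xs (qprod_zero ys u) = qprod_zero ys (qprod_zero xs u)" if "u \<in> G 0" for xs ys u
      unfolding qprod_zero_def by (rule zero_modes_commute[OF qprod_weight qprod_weight that])
    show "G 0 \<subseteq> M.span (range (\<lambda>xs. qprod_zero xs w))" if "w \<in> G 0" "w \<noteq> 0" for w
      by (rule top_cyclic[OF that])
  qed (simp_all add: qprod_zero_def act_add_right act_scale_right invariant_weightD[OF qprod_weight])
  show ?thesis by (rule dim_eq_1[OF grading_normalized])
qed

end

theorem corollary5p2:
  fixes scale :: "complex \<Rightarrow> 'v::ab_group_add \<Rightarrow> 'v"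
    and Y :: "'v \<Rightarrow> int \<Rightarrow> 'v \<Rightarrow> 'v"
    and vac :: 'v
    and \<alpha> :: "'n::finite \<Rightarrow> 'v"
    and scaleM :: "complex \<Rightarrow> 'm::ab_group_add \<Rightarrow> 'm"
    and act :: "'v \<Rightarrow> int \<Rightarrow> 'm \<Rightarrow> 'm"
    and G :: "nat \<Rightarrow> 'm set"
  assumes "heisenberg_vertex_algebra scale Y vac \<alpha>"
    and "irreducible_admissible_module scale Y vac scaleM
          (heisenberg_vertex_algebra.orthogonal_invariants scale Y vac \<alpha>) act
          (heisenberg_vertex_algebra.invariant_weight_space scale Y vac \<alpha>) G"
  shows "highest_weight_module scale Y vac scaleM
          (heisenberg_vertex_algebra.orthogonal_invariants scale Y vac \<alpha>) act
          (heisenberg_vertex_algebra.invariant_weight_space scale Y vac \<alpha>) G"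
proof -
  interpret heisenberg_invariants_module scale Y vac \<alpha> scaleM act G
    by (rule heisenberg_invariants_module.intro) fact+
  show ?thesis
    by (intro highest_weight_module.intro highest_weight_module_axioms.intro assms(2) dim_top)
qed

end
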